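(* Let $n\ge 1$. Let $q\in[1,\infty)$, $c\in(0,\infty]$, $\mathbf{B}=(\beta_0,\beta_\infty)\in\mathbb{R}^2$ be such that either $q=c=1$ and $\mathbf{B}=(0,0)$, or $1<q<\infty$ and $0<c\le\infty$ (with $\mathbf{B}\in\mathbb{R}^2$ arbitrary). Let $-\infty<\sigma<\infty$, $\mathbf{\Gamma}=(\gamma_0,\gamma_\infty)\in\mathbb{R}^2$, $0<u\le\infty$, $0<b\le\infty$, and $\mathbf{A}=(\alpha_0,\alpha_\infty)\in\mathbb{R}^2$ with $\alpha_0<-\frac1b<\alpha_\infty$. Then $$\dot B_{(q,c;\mathbf{B}),u}^{\sigma+\frac nq,\,\mathbf{\Gamma}+\left(\overleftarrow{\mathbf{A}}-\overleftarrow{\mathbf{B}}+\frac1b\right)}\subset\dot B_{(\infty,b;\mathbf{A}),u}^{\sigma,\mathbf{\Gamma}}.$$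
   Context: Convention: $1/\infty=0$. For a pair $\mathbf{A}=(\alpha_0,\alpha_\infty)\in\mathbb{R}^2$ put $\overleftarrow{\mathbf{A}}=(\alpha_\infty,\alpha_0)$ and, for $s\in\mathbb{R}$, $\mathbf{A}+s=(\alpha_0+s,\alpha_\infty+s)$; pairs are added and subtracted componentwise. The broken-logarithmic function is $l^{\mathbf{A}}(t)=(1+|\ln t|)^{\alpha_0}$ for $0<t\le 1$ and $l^{\mathbf{A}}(t)=(1+|\ln t|)^{\alpha_\infty}$ for $t>1$. For a complex-valued measurable $f$ on $\mathbb{R}^n$, $f^*$ is its non-increasing rearrangement. For $0<p,b\le\infty$, the Lorentz–Zygmund space $L_{p,b;\mathbf{A}}=L_{p,b;\mathbf{A}}(\mathbb{R}^n)$ consists of all measurable $f$ with $\|f\|_{p,b;\mathbf{A}}:=\left\|t^{\frac1p-\frac1b}l^{\mathbf{A}}(t)f^*(t)\right\|_{L_b(0,\infty)}<\infty$. $S$ and $S'$ are the Schwartz space and the space of tempered distributions on $\mathbb{R}^n$; $\mathcal{F}$ is the Fourier transform, $\mathcal{F}f(\xi)=\int e^{-2\pi i x\xi}f(x)\,dx$, extended to $S'$. Fix $\varphi\in S$ with $\operatorname{supp}\varphi=\{\xi:2^{-1}\le|\xi|\le2\}$, $\varphi(\xi)>0$ for $2^{-1}<|\xi|<2$, and $\sum_{k=-\infty}^\infty\varphi(2^{-k}\xi)=1$ for $\xi\ne0$. Put $\varphi_k(\xi)=\varphi(2^{-k}\xi)$ ($k\in\mathbb{Z}$). For $\sigma\in\mathbb{R}$,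 $0<p,b,u\le\infty$, $\mathbf{A},\mathbf{\Gamma}\in\mathbb{R}^2$ with $L_{p,b;\mathbf{A}}\neq\{0\}$, the homogeneous Besov-type space $\dot B^{\sigma,\mathbf{\Gamma}}_{(p,b;\mathbf{A}),u}$ consists of all $f\in S'$ with finite semi-(quasi-)norm $$\|f\|_{\dot B^{\sigma,\mathbf{\Gamma}}_{(p,b;\mathbf{A}),u}}=\left\{\sum_{k=-\infty}^\infty\left(2^{\sigma k}l^{\mathbf{\Gamma}}(2^k)\|\mathcal{F}^{-1}(\varphi_k\mathcal{F}f)\|_{p,b;\mathbf{A}}\right)^u\right\}^{1/u}$$ (supremum over $k\in\mathbb{Z}$ if $u=\infty$). $X\subset Y$ means continuous embedding: every $f\in X$ is in $Y$ and $\|f\|_Y\le C\|f\|_X$ with $C$ independent of $f$. *)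

theory Defs
  imports "HOL-Analysis.Analysis" "HOL-Probability.Essential_Supremum"
begin

section \<open>Extended exponents and broken logarithms\<close>

text \<open>The convention \<open>1/\<infinity> = 0\<close> is the one of \<^typ>\<open>ennreal\<close>. Only exponents in \<open>(0,\<infinity>]\<close> are used.\<close>

definition recip :: "ennreal \<Rightarrow> real" where
  "recip p = enn2real (1 / p)"

text \<open>Real powers on \<open>[0,\<infinity>]\<close>, meant for positive exponents only.\<close>

definition ennpowr :: "ennreal \<Rightarrow> real \<Rightarrow> ennreal" where
  "ennpowr x r = (if x = \<infinity> then \<infinity> else ennreal (enn2real x powr r))"

text \<open>A pair \<open>(\<alpha>\<^sub>0, \<alpha>\<^sub>\<infinity>)\<close> is an element of \<^typ>\<open>real \<times> real\<close>, with the componentwise operations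
  of the library; its reversal is \<^const>\<open>prod.swap\<close>.\<close>

definition broken_log :: "real \<times> real \<Rightarrow> real \<Rightarrow> real" where
  "broken_log A t = (1 + \<bar>ln t\<bar>) powr (if t \<le> 1 then fst A else snd A)"

definition pair_shift :: "real \<times> real \<Rightarrow> real \<Rightarrow> real \<times> real" where
  "pair_shift A s = (fst A + s, snd A + s)"


section \<open>Lorentz--Zygmund quasi-norms\<close>

definition rearrangement :: "('a::euclidean_space \<Rightarrow> complex) \<Rightarrow> real \<Rightarrow> ennreal" where
  "rearrangement f t = Inf {s. emeasure lebesgue {x. s < ennreal (norm (f x))} \<le> ennreal t}"

definition Lp_qnorm :: "'b measure \<Rightarrow> ennreal \<Rightarrow> ('b \<Rightarrow> ennreal) \<Rightarrow> ennreal" where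
  "Lp_qnorm M b h =
     (if b = \<infinity> then esssup M h
      else ennpowr (\<integral>\<^sup>+ t. ennpowr (h t) (enn2real b) \<partial>M) (recip b))"

definition lz_qnorm ::
  "ennreal \<Rightarrow> ennreal \<Rightarrow> real \<times> real \<Rightarrow> ('a::euclidean_space \<Rightarrow> complex) \<Rightarrow> ennreal" where
  "lz_qnorm p b A f =
     Lp_qnorm (lebesgue_on {0<..}) b
       (\<lambda>t. ennreal (t powr (recip p - recip b) * broken_log A t) * rearrangement f t)"


section \<open>Schwartz functions and tempered distributions\<close>

fun mixed_partial :: "'a::euclidean_space list \<Rightarrow> ('a \<Rightarrow> complex) \<Rightarrow> 'a \<Rightarrow> complex" where
  "mixed_partial [] f = f"
| "mixed_partial (v # vs) f = (\<lambda>x. frechet_derivative (mixed_partial vs f) (at x) v)"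

definition smooth :: "('a::euclidean_space \<Rightarrow> complex) \<Rightarrow> bool" where
  "smooth f \<longleftrightarrow> (\<forall>vs\<in>lists Basis. \<forall>x. mixed_partial vs f differentiable (at x))"

definition schwartz :: "('a::euclidean_space \<Rightarrow> complex) \<Rightarrow> bool" where
  "schwartz f \<longleftrightarrow> smooth f \<and>
     (\<forall>m. \<forall>vs\<in>lists Basis. bounded (range (\<lambda>x. (1 + norm x) ^ m *\<^sub>R mixed_partial vs f x)))"

definition schwartz_seminorm :: "nat \<Rightarrow> ('a::euclidean_space \<Rightarrow> complex) \<Rightarrow> real" where
  "schwartz_seminorm N f =
     (SUP (vs, x) \<in> {vs \<in> lists Basis. length vs \<le> N} \<times> UNIV.
        (1 + norm x) ^ N * norm (mixed_partial vs f x))"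

text \<open>A tempered distribution is given by a functional on all functions of which only the values
  on Schwartz functions matter.\<close>

type_synonym 'a functional = "('a \<Rightarrow> complex) \<Rightarrow> complex"

definition tempered :: "('a::euclidean_space) functional \<Rightarrow> bool" where
  "tempered T \<longleftrightarrow>
     (\<forall>f g a b. schwartz f \<longrightarrow> schwartz g \<longrightarrow> T (\<lambda>x. a * f x + b * g x) = a * T f + b * T g) \<and>
     (\<exists>C N. \<forall>f. schwartz f \<longrightarrow> norm (T f) \<le> C * schwartz_seminorm N f)"

definition fourier :: "('a::euclidean_space \<Rightarrow> complex) \<Rightarrow> 'a \<Rightarrow> complex" where
  "fourier f \<xi> = (\<integral>x. exp (- 2 * pi * \<i> * complex_of_real (x \<bullet> \<xi>)) * f x \<partial>lborel)"

definition inv_fourier :: "('a::euclidean_space \<Rightarrow> complex) \<Rightarrow> 'a \<Rightarrow> complex" where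
  "inv_fourier f x = (\<integral>\<xi>. exp (2 * pi * \<i> * complex_of_real (x \<bullet> \<xi>)) * f \<xi> \<partial>lborel)"

definition dist_fourier :: "('a::euclidean_space) functional \<Rightarrow> 'a functional" where
  "dist_fourier T = (\<lambda>\<psi>. T (fourier \<psi>))"

definition dist_inv_fourier :: "('a::euclidean_space) functional \<Rightarrow> 'a functional" where
  "dist_inv_fourier T = (\<lambda>\<psi>. T (inv_fourier \<psi>))"

definition dist_mult :: "('a::euclidean_space \<Rightarrow> complex) \<Rightarrow> 'a functional \<Rightarrow> 'a functional" where
  "dist_mult m T = (\<lambda>\<psi>. T (\<lambda>x. m x * \<psi> x))"

definition represents :: "('a::euclidean_space \<Rightarrow> complex) \<Rightarrow> 'a functional \<Rightarrow> bool" where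
  "represents g T \<longleftrightarrow> g \<in> borel_measurable lebesgue \<and>
     (\<forall>\<psi>. schwartz \<psi> \<longrightarrow> integrable lebesgue (\<lambda>x. g x * \<psi> x) \<and>
                        T \<psi> = (\<integral>x. g x * \<psi> x \<partial>lebesgue))"

text \<open>The representing function is unique almost everywhere and the quasi-norm only depends on its
  class, so the infimum is the quasi-norm of that function; it is \<open>\<infinity>\<close> if there is none.\<close>

definition dist_lz_qnorm ::
  "ennreal \<Rightarrow> ennreal \<Rightarrow> real \<times> real \<Rightarrow> ('a::euclidean_space) functional \<Rightarrow> ennreal" where
  "dist_lz_qnorm p b A T = (INF g \<in> {g. represents g T}. lz_qnorm p b A g)"


section \<open>Homogeneous Besov-type spaces\<close>

definition dyadic_generator :: "('a::euclidean_space \<Rightarrow> real) \<Rightarrow> bool" where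
  "dyadic_generator \<phi> \<longleftrightarrow>
     schwartz (\<lambda>\<xi>. complex_of_real (\<phi> \<xi>)) \<and>
     closure {\<xi>. \<phi> \<xi> \<noteq> 0} = {\<xi>. 1/2 \<le> norm \<xi> \<and> norm \<xi> \<le> 2} \<and>
     (\<forall>\<xi>. 1/2 < norm \<xi> \<and> norm \<xi> < 2 \<longrightarrow> 0 < \<phi> \<xi>) \<and>
     (\<forall>\<xi>. \<xi> \<noteq> 0 \<longrightarrow> ((\<lambda>k::int. \<phi> ((2 powi (- k)) *\<^sub>R \<xi>)) has_sum 1) UNIV)"

definition lp_block ::
  "('a::euclidean_space \<Rightarrow> real) \<Rightarrow> int \<Rightarrow> 'a functional \<Rightarrow> 'a functional" where
  "lp_block \<phi> k T =
     dist_inv_fourier (dist_mult (\<lambda>\<xi>. complex_of_real (\<phi> ((2 powi (- k)) *\<^sub>R \<xi>))) (dist_fourier T))"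

definition besov_qnorm ::
  "('a::euclidean_space \<Rightarrow> real) \<Rightarrow> real \<Rightarrow> real \<times> real \<Rightarrow> ennreal \<Rightarrow> ennreal \<Rightarrow> real \<times> real \<Rightarrow>
   ennreal \<Rightarrow> 'a functional \<Rightarrow> ennreal" where
  "besov_qnorm \<phi> \<sigma> \<Gamma> p b A u T =
     (let a = (\<lambda>k::int. ennreal (2 powr (\<sigma> * real_of_int k) * broken_log \<Gamma> (2 powi k)) *
                        dist_lz_qnorm p b A (lp_block \<phi> k T))
      in if u = \<infinity> then (SUP k. a k)
         else ennpowr (\<Sum>\<^sub>\<infinity>k. ennpowr (a k) (enn2real u)) (recip u))"

text \<open>Spaces of tempered distributions are given by their semi-(quasi-)norm.\<close>

definition tempered_space :: "(('a::euclidean_space) functional \<Rightarrow> ennreal) \<Rightarrow> 'a functional set" where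
  "tempered_space N = {T. tempered T \<and> N T < \<infinity>}"

definition continuously_embedded ::
  "(('a::euclidean_space) functional \<Rightarrow> ennreal) \<Rightarrow> ('a functional \<Rightarrow> ennreal) \<Rightarrow> bool" where
  "continuously_embedded N\<^sub>X N\<^sub>Y \<longleftrightarrow>
     tempered_space N\<^sub>X \<subseteq> tempered_space N\<^sub>Y \<and>
     (\<exists>C::real. \<forall>T \<in> tempered_space N\<^sub>X. N\<^sub>Y T \<le> ennreal C * N\<^sub>X T)"

end

theory Submission
  imports Defs "HOL-Probability.Characteristic_Functions" "HOL-Probability.Sinc_Integral"
begin

text \<open>Everything reduces to one Nikolskii-type inequality for a single dyadic block. Let \<open>K\<close> be a rapidly
  decreasing kernel whose Fourier transform is \<open>1\<close> on the support of \<open>\<phi>\<close> (a sum of five dilates of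
  the inverse transform of \<open>\<phi>\<close>) and let \<open>K\<^sub>k\<close> be its \<open>L\<^sub>1\<close>-normalised dilate by \<open>2\<^sup>k\<close>. If \<open>g\<close> represents the
  \<open>k\<close>-th block, then so does \<open>K\<^sub>k * g\<close>. With \<open>r = 2\<^sup>-\<^sup>k\<^sup>n\<close> and the averages
  \<open>m(t) = t\<^sup>-\<^sup>1 \<integral>\<^sub>0\<^sup>t g\<^sup>*\<close>, cutting \<open>g\<close> at height \<open>2 m(t)\<close> shows \<open>\<bar>K\<^sub>k * g\<bar> \<le> C m(r)\<close> and
  \<open>(K\<^sub>k * g)\<^sup>*(t) \<le> C m(t)\<close>. The hypotheses on \<open>q\<close>, \<open>c\<close>, \<open>B\<close> give
  \<open>m(t) \<le> C t\<^sup>-\<^sup>1\<^sup>/\<^sup>q l\<^sup>-\<^sup>B(t) \<parallel>g\<parallel>\<close>, so that only the explicit weight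
  \<open>min (w(r)) (w(t))\<close>, \<open>w(t) = t\<^sup>-\<^sup>1\<^sup>/\<^sup>q l\<^sup>-\<^sup>B(t)\<close>, has to be integrated against
  \<open>t\<^sup>-\<^sup>1\<^sup>/\<^sup>b l\<^sup>A(t)\<close>. The part \<open>t \<le> r\<close> produces the extra factor \<open>(1 + \<bar>ln r\<bar>)\<^sup>1\<^sup>/\<^sup>b\<close>.\<close>


section \<open>Rapidly decreasing functions\<close>

text \<open>A block is given only as a functional on test functions, and its representative is an
  arbitrary measurable function. The reproducing identity is therefore proved on the test side:
  \<open>correlation\<close>, the transpose of convolution, preserves Schwartz functions and alters
  no value of the block. All derivatives fall on the test function there, so of the kernel only
  rapid decay and the Fourier transform have to be known. This is why decay of the inverse transform
  and Fourier inversion come first.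

  The scale r is the one at which the kernel has height about 1/r and mass about 1, so one cut of g
  serves both estimates. An average appears instead of the rearrangement because the mass above the
  cut has to be bounded.

  For finite b, the condition on A makes the b-th power of the weight integrable near 0 and its
  integral up to r governed by the endpoint r, for small and for large r. Since ln r = -kn ln 2,
  small r belongs to large k, which reverses the pairs. Each block is treated alone and only
  rearrangements are bounded pointwise, so exponents below 1 call for no triangle
  inequality.\<close>

lemma lborel_integral_affine:
  fixes f :: "'a::euclidean_space \<Rightarrow> 'b::{banach,second_countable_topology}"
  assumes f[measurable]: "f \<in> borel_measurable borel" and "c \<noteq> 0"
  shows "(\<integral>x. f x \<partial>lborel) = \<bar>c\<bar> ^ DIM('a) *\<^sub>R (\<integral>x. f (t + c *\<^sub>R x) \<partial>lborel)"
  by (subst lborel_affine[OF \<open>c \<noteq> 0\<close>, of t]) (simp add: integral_density integral_distr)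

lemma lborel_nn_integral_affine:
  fixes f :: "'a::euclidean_space \<Rightarrow> ennreal"
  assumes f[measurable]: "f \<in> borel_measurable borel" and "c \<noteq> 0"
  shows "(\<integral>\<^sup>+x. f x \<partial>lborel) = ennreal (\<bar>c\<bar> ^ DIM('a)) * (\<integral>\<^sup>+x. f (t + c *\<^sub>R x) \<partial>lborel)"
  by (subst lborel_affine[OF \<open>c \<noteq> 0\<close>, of t]) (simp add: nn_integral_density nn_integral_distr nn_integral_cmult)

lemma lborel_integral_translate:
  fixes f :: "'a::euclidean_space \<Rightarrow> 'b::{banach,second_countable_topology}"
  assumes f[measurable]: "f \<in> borel_measurable borel"
  shows "(\<integral>x. f (t + x) \<partial>lborel) = (\<integral>x. f x \<partial>lborel)"
  using lborel_integral_affine[OF f, of 1 t] by simp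

lemma lborel_nn_integral_reflect:
  fixes f :: "'a::euclidean_space \<Rightarrow> ennreal"
  assumes f[measurable]: "f \<in> borel_measurable borel"
  shows "(\<integral>\<^sup>+x. f (t - x) \<partial>lborel) = (\<integral>\<^sup>+x. f x \<partial>lborel)"
  using lborel_nn_integral_affine[OF f, of "-1" t] by simp

lemma lborel_integrable_affine:
  fixes f :: "'a::euclidean_space \<Rightarrow> 'b::{banach,second_countable_topology}"
  assumes f: "integrable lborel f" and c: "c \<noteq> 0"
  shows "integrable lborel (\<lambda>x. f (t + c *\<^sub>R x))"
proof -
  have [measurable]: "f \<in> borel_measurable borel" using f by auto
  show ?thesis
    using f c unfolding integrable_iff_bounded
    by (auto simp: lborel_nn_integral_affine[of "\<lambda>x. ennreal (norm (f x))" c t] ennreal_mult_less_top)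
qed

text \<open>Each of the n factors 1 + (x . b)^2 is at most (1 + |x|)^2, so the weight lies below a
  product of one-dimensional functions 1/(1 + t^2). This is the origin of the exponent 2n in all
  majorants below.\<close>

lemma norm_weight_integrable:
  "integrable lborel (\<lambda>x::'a::euclidean_space. 1 / (1 + norm x) ^ (2 * DIM('a)))"
proof (rule integrableI_bounded)
  have one: "(\<integral>\<^sup>+(x::real). ennreal (1 / (1 + x\<^sup>2)) \<partial>lborel) < \<infinity>"
  proof -
    have "integrable lborel (\<lambda>x::real. inverse (1 + x\<^sup>2))"
      using integrable_inverse_1_plus_square by (simp add: set_integrable_def)
    then show ?thesis
      unfolding integrable_iff_bounded by (simp add: inverse_eq_divide add_nonneg_nonneg)
  qed
  have le: "1 / (1 + norm x) ^ (2 * DIM('a)) \<le> (\<Prod>b\<in>Basis. 1 / (1 + (x \<bullet> b)\<^sup>2))" for x :: 'a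
  proof -
    have "(\<Prod>b\<in>Basis. 1 + (x \<bullet> b)\<^sup>2) \<le> (\<Prod>b\<in>(Basis::'a set). (1 + norm x)\<^sup>2)"
    proof (rule prod_mono)
      fix b :: 'a assume b: "b \<in> Basis"
      have "(x \<bullet> b)\<^sup>2 \<le> (norm x)\<^sup>2"
        using Basis_le_norm[OF b, of x] by (simp add: abs_le_square_iff[symmetric])
      then show "0 \<le> 1 + (x \<bullet> b)\<^sup>2 \<and> 1 + (x \<bullet> b)\<^sup>2 \<le> (1 + norm x)\<^sup>2"
        by (simp add: power2_sum add_increasing2)
    qed
    also have "\<dots> = (1 + norm x) ^ (2 * DIM('a))" by (simp add: power_mult)
    finally have "(\<Prod>b\<in>Basis. 1 + (x \<bullet> b)\<^sup>2) \<le> (1 + norm x) ^ (2 * DIM('a))" .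
    moreover have "0 < (\<Prod>b\<in>Basis. 1 + (x \<bullet> b)\<^sup>2)" by (intro prod_pos) (auto intro: add_pos_nonneg)
    ultimately show ?thesis
      by (simp add: prod_dividef frac_le)
  qed
  have "(\<integral>\<^sup>+(x::'a). ennreal (norm (1 / (1 + norm x) ^ (2 * DIM('a)))) \<partial>lborel)
      \<le> (\<integral>\<^sup>+(x::'a). (\<Prod>b\<in>Basis. ennreal (1 / (1 + (x \<bullet> b)\<^sup>2))) \<partial>lborel)"
    using le by (intro nn_integral_mono) (auto simp: prod_ennreal intro!: ennreal_leI)
  also have "\<dots> = (\<Prod>b\<in>(Basis::'a set). (\<integral>\<^sup>+(x::real). ennreal (1 / (1 + x\<^sup>2)) \<partial>lborel))"
    by (rule nn_integral_lborel_prod) auto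
  also have "\<dots> < \<infinity>" using one by (simp add: power_less_top_ennreal)
  finally show "(\<integral>\<^sup>+(x::'a). ennreal (norm (1 / (1 + norm x) ^ (2 * DIM('a)))) \<partial>lborel) < \<infinity>" .
qed measurable

text \<open>The class for convolution kernels. It contains the Schwartz functions and their inverse
  transforms and is closed under the sums and dilates that build the kernel, so regularity of an
  inverse transform is never at issue.\<close>

definition rapidly_decreasing :: "('a::euclidean_space \<Rightarrow> complex) \<Rightarrow> bool" where
  "rapidly_decreasing K \<longleftrightarrow> K \<in> borel_measurable borel \<and>
     (\<forall>m. \<exists>C. \<forall>x. (1 + norm x) ^ m * norm (K x) \<le> C)"

lemma rapidly_decreasing_measurable: "rapidly_decreasing K \<Longrightarrow> K \<in> borel_measurable borel"
  by (simp add: rapidly_decreasing_def)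

lemma rapidly_decreasing_bound:
  assumes "rapidly_decreasing K"
  obtains C where "0 \<le> C" "\<And>x. norm (K x) \<le> C / (1 + norm x) ^ m"
proof -
  obtain C where C: "\<And>x. (1 + norm x) ^ m * norm (K x) \<le> C"
    using assms unfolding rapidly_decreasing_def by blast
  have "0 \<le> C" using C[of 0] by (smt (verit) norm_ge_zero zero_le_mult_iff zero_le_power)
  moreover have "norm (K x) \<le> C / (1 + norm x) ^ m" for x
    using C[of x] by (simp add: field_simps add_pos_nonneg)
  ultimately show ?thesis using that by blast
qed

lemma rapidly_decreasing_integrable:
  assumes K: "rapidly_decreasing (K :: 'a::euclidean_space \<Rightarrow> complex)"
  shows "integrable lborel (\<lambda>x. (1 + norm x) ^ m * norm (K x))"
proof -
  note [measurable] = rapidly_decreasing_measurable[OF K]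
  obtain C where C: "0 \<le> C" "\<And>x. norm (K x) \<le> C / (1 + norm x) ^ (m + 2 * DIM('a))"
    using rapidly_decreasing_bound[OF K] by blast
  show ?thesis
  proof (rule Bochner_Integration.integrable_bound)
    show "integrable lborel (\<lambda>x::'a. C * (1 / (1 + norm x) ^ (2 * DIM('a))))"
      by (intro integrable_mult_right norm_weight_integrable)
    have "(1 + norm x) ^ m * norm (K x) \<le> C * (1 / (1 + norm x) ^ (2 * DIM('a)))" for x
    proof -
      have "(1 + norm x) ^ m * norm (K x) \<le> (1 + norm x) ^ m * (C / (1 + norm x) ^ (m + 2 * DIM('a)))"
        by (intro mult_left_mono C) auto
      also have "\<dots> = C * (1 / (1 + norm x) ^ (2 * DIM('a)))"
        by (simp add: power_add add_nonneg_eq_0_iff)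
      finally show ?thesis .
    qed
    then show "AE x in lborel. norm ((1 + norm x) ^ m * norm (K x)) \<le> norm (C * (1 / (1 + norm x) ^ (2 * DIM('a))))"
      using C(1) by (intro AE_I2) (simp add: abs_mult)
  qed measurable
qed

lemma rapidly_decreasing_imp_integrable:
  assumes K: "rapidly_decreasing K"
  shows "integrable lborel K"
  using rapidly_decreasing_integrable[OF K, of 0] rapidly_decreasing_measurable[OF K]
  by (simp add: integrable_norm_iff)

lemma rapidly_decreasing_add:
  assumes "rapidly_decreasing f" "rapidly_decreasing g"
  shows "rapidly_decreasing (\<lambda>x. f x + g x)"
  unfolding rapidly_decreasing_def
proof (intro conjI allI)
  show "(\<lambda>x. f x + g x) \<in> borel_measurable borel"
    by (intro borel_measurable_add rapidly_decreasing_measurable assms)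
  fix m
  obtain C D where C: "\<And>x. (1 + norm x) ^ m * norm (f x) \<le> C" and D: "\<And>x. (1 + norm x) ^ m * norm (g x) \<le> D"
    using assms unfolding rapidly_decreasing_def by blast
  have "(1 + norm x) ^ m * norm (f x + g x) \<le> C + D" for x
  proof -
    have "(1 + norm x) ^ m * norm (f x + g x) \<le> (1 + norm x) ^ m * (norm (f x) + norm (g x))"
      by (intro mult_left_mono norm_triangle_ineq) auto
    also have "\<dots> \<le> C + D" using C[of x] D[of x] by (simp add: distrib_left)
    finally show ?thesis .
  qed
  then show "\<exists>C. \<forall>x. (1 + norm x) ^ m * norm (f x + g x) \<le> C" by blast
qed

lemma rapidly_decreasing_sum:
  assumes "\<And>j. j \<in> J \<Longrightarrow> rapidly_decreasing (f j)"
  shows "rapidly_decreasing (\<lambda>x. \<Sum>j\<in>J. f j x)"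
proof (cases "finite J")
  case True
  then show ?thesis using assms
  proof (induction J)
    case empty
    show ?case by (auto simp: rapidly_decreasing_def)
  next
    case (insert a F)
    then show ?case by (simp add: rapidly_decreasing_add)
  qed
qed (auto simp: rapidly_decreasing_def)

lemma rapidly_decreasing_dilate:
  assumes f: "rapidly_decreasing f" and s: "s > 0"
  shows "rapidly_decreasing (\<lambda>x. a * f (s *\<^sub>R x))"
  unfolding rapidly_decreasing_def
proof (intro conjI allI)
  have [measurable]: "f \<in> borel_measurable borel" by (rule rapidly_decreasing_measurable[OF f])
  show "(\<lambda>x. a * f (s *\<^sub>R x)) \<in> borel_measurable borel" by measurable
  fix m
  obtain C where C: "\<And>x. (1 + norm x) ^ m * norm (f x) \<le> C"
    using f unfolding rapidly_decreasing_def by blast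
  have "(1 + norm x) ^ m * norm (a * f (s *\<^sub>R x)) \<le> (1 + 1/s) ^ m * norm a * C" for x
  proof -
    have "1 + norm x \<le> (1 + 1/s) * (1 + norm (s *\<^sub>R x))"
      using s by (simp add: field_simps)
    then have "(1 + norm x) ^ m \<le> (1 + 1/s) ^ m * (1 + norm (s *\<^sub>R x)) ^ m"
      by (metis power_mono power_mult_distrib add_nonneg_nonneg norm_ge_zero zero_le_one)
    then have "(1 + norm x) ^ m * norm (a * f (s *\<^sub>R x)) \<le> ((1 + 1/s) ^ m * (1 + norm (s *\<^sub>R x)) ^ m) * norm (a * f (s *\<^sub>R x))"
      by (rule mult_right_mono) simp
    also have "\<dots> = (1 + 1/s) ^ m * norm a * ((1 + norm (s *\<^sub>R x)) ^ m * norm (f (s *\<^sub>R x)))"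
      by (simp add: norm_mult)
    also have "\<dots> \<le> (1 + 1/s) ^ m * norm a * C"
      using s by (intro mult_left_mono C) auto
    finally show ?thesis .
  qed
  then show "\<exists>C. \<forall>x. (1 + norm x) ^ m * norm (a * f (s *\<^sub>R x)) \<le> C" by blast
qed

section \<open>Schwartz functions and the inverse Fourier transform\<close>

lemma mixed_partial_append: "mixed_partial (us @ vs) f = mixed_partial us (mixed_partial vs f)"
  by (induction us) auto

lemma schwartz_partial:
  assumes "schwartz f" "vs \<in> lists Basis"
  shows "schwartz (mixed_partial vs f)"
proof -
  have "us @ vs \<in> lists Basis" if "us \<in> lists Basis" for us using that assms(2) by simp
  then show ?thesis
    using assms(1) unfolding schwartz_def smooth_def by (metis mixed_partial_append)
qed

lemma schwartz_differentiable: "schwartz f \<Longrightarrow> f differentiable (at x)"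
  unfolding schwartz_def smooth_def by (metis lists.Nil mixed_partial.simps(1))

lemma schwartz_continuous: "schwartz f \<Longrightarrow> continuous_on UNIV f"
  by (meson schwartz_differentiable differentiable_at_imp_differentiable_on differentiable_imp_continuous_on)

lemma schwartz_rapidly_decreasing:
  assumes f: "schwartz f"
  shows "rapidly_decreasing f"
  unfolding rapidly_decreasing_def
proof (intro conjI allI)
  show "f \<in> borel_measurable borel"
    using schwartz_continuous[OF f] by (rule borel_measurable_continuous_onI)
  fix m
  have "bounded (range (\<lambda>x. (1 + norm x) ^ m *\<^sub>R f x))"
    using f unfolding schwartz_def by (metis lists.Nil mixed_partial.simps(1))
  then show "\<exists>C. \<forall>x. (1 + norm x) ^ m * norm (f x) \<le> C"
    by (auto simp: bounded_iff)
qed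

lemma schwartz_has_derivative:
  fixes f :: "'a::euclidean_space \<Rightarrow> complex"
  assumes f: "schwartz f"
  shows "(f has_derivative (\<lambda>h. \<Sum>v\<in>Basis. (h \<bullet> v) *\<^sub>R mixed_partial [v] f x)) (at x)"
proof -
  let ?D = "frechet_derivative f (at x)"
  have D: "(f has_derivative ?D) (at x)"
    using schwartz_differentiable[OF f] frechet_derivative_works by blast
  then have lin: "linear ?D" by (rule has_derivative_linear)
  have *: "?D h = (\<Sum>v\<in>Basis. (h \<bullet> v) *\<^sub>R mixed_partial [v] f x)" for h
  proof -
    have "?D h = ?D (\<Sum>v\<in>Basis. (h \<bullet> v) *\<^sub>R v)" by (simp add: euclidean_representation)
    also have "\<dots> = (\<Sum>v\<in>Basis. (h \<bullet> v) *\<^sub>R mixed_partial [v] f x)"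
      by (simp add: linear_sum[OF lin] linear_scale[OF lin])
    finally show ?thesis .
  qed
  show ?thesis by (rule has_derivative_eq_rhs[OF D], rule ext, rule *)
qed

text \<open>Mean value inequality on the unit ball around x, where the decay of the partial
  derivatives at y and at x agrees up to the factor 2^m. One majorant then serves all difference
  quotients with step at most 1, as dominated convergence in \<open>inv_fourier_partial\<close>
  requires.\<close>

lemma schwartz_increment:
  fixes f :: "'a::euclidean_space \<Rightarrow> complex"
  assumes f: "schwartz f"
  obtains C where "0 \<le> C"
    "\<And>x h. norm h \<le> 1 \<Longrightarrow> norm (f (x + h) - f x) \<le> C / (1 + norm x) ^ m * norm h"
proof -
  have "\<exists>C\<ge>0. \<forall>x. norm (mixed_partial [v] f x) \<le> C / (1 + norm x) ^ m" if "v \<in> Basis" for v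
    using that schwartz_partial[OF f, of "[v]"]
    by (meson rapidly_decreasing_bound schwartz_rapidly_decreasing lists.intros)
  then obtain c where c: "\<And>v. v \<in> Basis \<Longrightarrow> 0 \<le> c v"
    "\<And>v x. v \<in> Basis \<Longrightarrow> norm (mixed_partial [v] f x) \<le> c v / (1 + norm x) ^ m"
    by metis
  define C where "C = 2 ^ m * (\<Sum>v\<in>(Basis::'a set). c v)"
  have "0 \<le> C" using c(1) by (auto simp: C_def intro!: mult_nonneg_nonneg sum_nonneg)
  moreover have "norm (f (x + h) - f x) \<le> C / (1 + norm x) ^ m * norm h" if h: "norm h \<le> 1" for x h
  proof -
    have "norm (f (x + h) - f x) \<le> C / (1 + norm x) ^ m * norm (x + h - x)"
    proof (rule differentiable_bound[of "cball x 1"])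
      fix y assume y: "y \<in> cball x 1"
      show "(f has_derivative (\<lambda>h. \<Sum>v\<in>Basis. (h \<bullet> v) *\<^sub>R mixed_partial [v] f y)) (at y within cball x 1)"
        using schwartz_has_derivative[OF f] by (rule has_derivative_at_withinI)
      have xy: "1 + norm x \<le> 2 * (1 + norm y)"
      proof -
        have "norm (x - y) \<le> 1" using y by (simp add: dist_norm)
        then show ?thesis using norm_triangle_sub[of x y] norm_ge_zero[of y] by argo
      qed
      have le: "1 / (1 + norm y) ^ m \<le> 2 ^ m / (1 + norm x) ^ m"
      proof -
        have "(1 + norm x) ^ m \<le> 2 ^ m * (1 + norm y) ^ m"
          using power_mono[OF xy, of m] by (simp only: power_mult_distrib) simp
        moreover have "0 < (1 + norm x) ^ m" "0 < (1 + norm y) ^ m" by (simp_all add: add_pos_nonneg)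
        ultimately show ?thesis by (simp only: pos_divide_le_eq times_divide_eq_left pos_le_divide_eq mult_1)
      qed
      show "onorm (\<lambda>h. \<Sum>v\<in>Basis. (h \<bullet> v) *\<^sub>R mixed_partial [v] f y) \<le> C / (1 + norm x) ^ m"
      proof (rule onorm_le)
        fix k :: 'a
        have "norm (\<Sum>v\<in>Basis. (k \<bullet> v) *\<^sub>R mixed_partial [v] f y) \<le> (\<Sum>v\<in>Basis. norm k * (c v * (2 ^ m / (1 + norm x) ^ m)))"
        proof (rule sum_norm_le)
          fix v :: 'a assume v: "v \<in> Basis"
          have "norm (mixed_partial [v] f y) \<le> c v * (1 / (1 + norm y) ^ m)" using c(2)[OF v, of y] by simp
          also have "\<dots> \<le> c v * (2 ^ m / (1 + norm x) ^ m)" by (intro mult_left_mono le c v)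
          finally show "norm ((k \<bullet> v) *\<^sub>R mixed_partial [v] f y) \<le> norm k * (c v * (2 ^ m / (1 + norm x) ^ m))"
            using Basis_le_norm[OF v, of k] by (simp only: norm_scaleR) (intro mult_mono, auto)
        qed
        also have "\<dots> = C / (1 + norm x) ^ m * norm k"
          by (simp add: C_def sum_distrib_left sum_distrib_right sum_divide_distrib mult_ac)
        finally show "norm (\<Sum>v\<in>Basis. (k \<bullet> v) *\<^sub>R mixed_partial [v] f y) \<le> C / (1 + norm x) ^ m * norm k" .
      qed
    qed (use h in \<open>auto simp: dist_norm\<close>)
    then show ?thesis by simp
  qed
  ultimately show ?thesis using that by blast
qed

section \<open>Decay of the inverse Fourier transform\<close>

lemma fourier_kernel_norm [simp]:
  "norm (exp (2 * pi * \<i> * complex_of_real r)) = 1" "norm (exp (- (2 * pi * \<i> * complex_of_real r))) = 1"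
proof -
  have "norm (exp (\<i> * complex_of_real (2 * pi * r))) = 1" for r by (rule norm_exp_i_times)
  from this[of r] this[of "-r"]
  show "norm (exp (2 * pi * \<i> * complex_of_real r)) = 1" "norm (exp (- (2 * pi * \<i> * complex_of_real r))) = 1"
    by (simp_all add: mult_ac)
qed

text \<open>Instead of integrating by parts, translation invariance moves the increment of the difference
  quotient of \<open>f\<close> onto the exponential.\<close>

lemma inv_fourier_partial:
  fixes f :: "'a::euclidean_space \<Rightarrow> complex"
  assumes f: "schwartz f" and v: "v \<in> Basis"
  shows "inv_fourier (mixed_partial [v] f) x = - (2 * pi * \<i> * (x \<bullet> v)) * inv_fourier f x"
proof -
  define E where "E \<xi> = exp (2 * pi * \<i> * complex_of_real (x \<bullet> \<xi>))" for \<xi>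
  have E_norm: "norm (E \<xi>) = 1" for \<xi> by (simp add: E_def)
  have E_add: "E (a + b) = E a * E b" for a b
    by (simp add: E_def inner_add_right distrib_left exp_add)
  have E_meas[measurable]: "E \<in> borel_measurable borel" unfolding E_def by measurable
  have fi: "integrable lborel f" and f_meas[measurable]: "f \<in> borel_measurable borel"
    using f by (auto intro: rapidly_decreasing_imp_integrable rapidly_decreasing_measurable schwartz_rapidly_decreasing)
  have [measurable]: "mixed_partial [v] f \<in> borel_measurable borel"
    using schwartz_partial[OF f, of "[v]"] v
    by (auto intro: rapidly_decreasing_measurable schwartz_rapidly_decreasing simp del: mixed_partial.simps)
  define t where "t j = 1 / real (Suc j)" for j
  have t: "0 < t j" "t j \<le> 1" for j by (auto simp: t_def)
  have t0: "t \<longlonglongrightarrow> 0" unfolding t_def by (rule LIMSEQ_Suc[OF lim_1_over_n])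
  define q where "q j \<xi> = E \<xi> * ((f (t j *\<^sub>R v + \<xi>) - f \<xi>) / t j)" for j \<xi>
  have Ef: "integrable lborel (\<lambda>\<xi>. E \<xi> * f \<xi>)"
    by (rule Bochner_Integration.integrable_bound[OF fi]) (auto simp: norm_mult E_norm)
  have Eft: "integrable lborel (\<lambda>\<xi>. E \<xi> * f (t j *\<^sub>R v + \<xi>))" for j
    using lborel_integrable_affine[OF fi, of 1 "t j *\<^sub>R v"]
    by (rule Bochner_Integration.integrable_bound) (auto simp: norm_mult E_norm)
  have qI: "(\<integral>\<xi>. q j \<xi> \<partial>lborel) = (E (- t j *\<^sub>R v) - 1) / t j * inv_fourier f x" for j
  proof -
    have "(\<integral>\<xi>. E \<xi> * f (t j *\<^sub>R v + \<xi>) \<partial>lborel) = (\<integral>\<xi>. E (- t j *\<^sub>R v + (t j *\<^sub>R v + \<xi>)) * f (t j *\<^sub>R v + \<xi>) \<partial>lborel)"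
      by simp
    also have "\<dots> = (\<integral>\<xi>. E (- t j *\<^sub>R v + \<xi>) * f \<xi> \<partial>lborel)"
      by (rule lborel_integral_translate[of "\<lambda>\<xi>. E (- t j *\<^sub>R v + \<xi>) * f \<xi>"]) measurable
    also have "\<dots> = (\<integral>\<xi>. E (- t j *\<^sub>R v) * (E \<xi> * f \<xi>) \<partial>lborel)"
      by (rule Bochner_Integration.integral_cong)
        (simp_all add: E_add mult.assoc del: scaleR_minus_left)
    finally have 1: "(\<integral>\<xi>. E \<xi> * f (t j *\<^sub>R v + \<xi>) \<partial>lborel) = E (- t j *\<^sub>R v) * inv_fourier f x"
      by (simp add: inv_fourier_def E_def)
    have "(\<integral>\<xi>. q j \<xi> \<partial>lborel) = (\<integral>\<xi>. (E \<xi> * f (t j *\<^sub>R v + \<xi>) - E \<xi> * f \<xi>) / t j \<partial>lborel)"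
      by (simp add: q_def algebra_simps)
    also have "\<dots> = ((\<integral>\<xi>. E \<xi> * f (t j *\<^sub>R v + \<xi>) \<partial>lborel) - (\<integral>\<xi>. E \<xi> * f \<xi> \<partial>lborel)) / t j"
      using Ef Eft by simp
    also have "\<dots> = (E (- t j *\<^sub>R v) - 1) / t j * inv_fourier f x"
      unfolding 1 by (simp add: inv_fourier_def E_def algebra_simps diff_divide_distrib)
    finally show ?thesis .
  qed
  \<comment> \<open>The decay order 2n makes the majorant of all quotients \<open>q j\<close> a
    multiple of the integrable weight.\<close>
  obtain C where C: "0 \<le> C"
    "\<And>x h. norm h \<le> 1 \<Longrightarrow> norm (f (x + h) - f x) \<le> C / (1 + norm x) ^ (2 * DIM('a)) * norm h"
    using schwartz_increment[OF f] by blast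
  have lim1: "(\<lambda>j. \<integral>\<xi>. q j \<xi> \<partial>lborel) \<longlonglongrightarrow> (\<integral>\<xi>. E \<xi> * mixed_partial [v] f \<xi> \<partial>lborel)"
  proof (rule integral_dominated_convergence)
    show "integrable lborel (\<lambda>\<xi>::'a. C * (1 / (1 + norm \<xi>) ^ (2 * DIM('a))))"
      by (intro integrable_mult_right norm_weight_integrable)
    show "AE \<xi> in lborel. norm (q j \<xi>) \<le> C * (1 / (1 + norm \<xi>) ^ (2 * DIM('a)))" for j
    proof (intro AE_I2)
      fix \<xi> :: 'a
      have "norm (f (\<xi> + t j *\<^sub>R v) - f \<xi>) \<le> C / (1 + norm \<xi>) ^ (2 * DIM('a)) * norm (t j *\<^sub>R v)"
        using t[of j] v by (intro C) auto
      then have "norm (f (t j *\<^sub>R v + \<xi>) - f \<xi>) \<le> C / (1 + norm \<xi>) ^ (2 * DIM('a)) * t j"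
        using t[of j] v by (simp add: add.commute)
      then show "norm (q j \<xi>) \<le> C * (1 / (1 + norm \<xi>) ^ (2 * DIM('a)))"
        using t[of j] by (simp add: q_def norm_mult E_norm norm_divide pos_divide_le_eq)
    qed
    show "AE \<xi> in lborel. (\<lambda>j. q j \<xi>) \<longlonglongrightarrow> E \<xi> * mixed_partial [v] f \<xi>"
    proof (intro AE_I2)
      fix \<xi> :: 'a
      let ?D = "\<lambda>h. \<Sum>w\<in>Basis. (h \<bullet> w) *\<^sub>R mixed_partial [w] f \<xi>"
      have Dv: "?D (s *\<^sub>R v) = s *\<^sub>R mixed_partial [v] f \<xi>" for s
      proof -
        have "?D (s *\<^sub>R v) = (\<Sum>w\<in>Basis. if w = v then s *\<^sub>R mixed_partial [v] f \<xi> else 0)"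
          using v by (intro sum.cong) (auto simp: inner_Basis simp del: mixed_partial.simps)
        then show ?thesis using v by (simp del: mixed_partial.simps)
      qed
      have "((\<lambda>h. norm (f (\<xi> + h) - f \<xi> - ?D h) / norm h) \<longlongrightarrow> 0) (at 0)"
        using schwartz_has_derivative[OF f, of \<xi>] by (simp add: has_derivative_at del: mixed_partial.simps)
      moreover have "filterlim (\<lambda>j. t j *\<^sub>R v) (at 0) sequentially"
        unfolding filterlim_at
        using t v tendsto_scaleR[OF t0 tendsto_const, of v] by (auto intro!: always_eventually simp: less_imp_neq[symmetric] dest: nonzero_Basis)
      ultimately have "(\<lambda>j. norm (f (\<xi> + t j *\<^sub>R v) - f \<xi> - ?D (t j *\<^sub>R v)) / norm (t j *\<^sub>R v)) \<longlonglongrightarrow> 0"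
        by (rule filterlim_compose)
      moreover have "norm (f (\<xi> + t j *\<^sub>R v) - f \<xi> - ?D (t j *\<^sub>R v)) / norm (t j *\<^sub>R v)
          = norm ((f (t j *\<^sub>R v + \<xi>) - f \<xi>) / t j - mixed_partial [v] f \<xi>)" for j
      proof -
        have "(f (t j *\<^sub>R v + \<xi>) - f \<xi>) / t j - mixed_partial [v] f \<xi>
          = (f (\<xi> + t j *\<^sub>R v) - f \<xi> - ?D (t j *\<^sub>R v)) / t j"
          unfolding Dv using t[of j] by (simp add: field_simps scaleR_conv_of_real del: mixed_partial.simps)
        then show ?thesis using t[of j] v by (simp add: norm_divide del: mixed_partial.simps)
      qed
      ultimately have "(\<lambda>j. norm ((f (t j *\<^sub>R v + \<xi>) - f \<xi>) / t j - mixed_partial [v] f \<xi>)) \<longlonglongrightarrow> 0"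
        by (simp only:)
      then have "(\<lambda>j. (f (t j *\<^sub>R v + \<xi>) - f \<xi>) / t j) \<longlonglongrightarrow> mixed_partial [v] f \<xi>"
        by (rule LIM_zero_cancel[OF tendsto_norm_zero_cancel])
      then show "(\<lambda>j. q j \<xi>) \<longlonglongrightarrow> E \<xi> * mixed_partial [v] f \<xi>"
        unfolding q_def by (intro tendsto_mult tendsto_const)
    qed
    show "q j \<in> borel_measurable lborel" for j unfolding q_def by measurable
    show "(\<lambda>\<xi>. E \<xi> * mixed_partial [v] f \<xi>) \<in> borel_measurable lborel"
      by measurable
  qed
  \<comment> \<open>The scalar produced by the translation is itself a difference quotient, that of
    exp (c z) at z = 0, so its limit is c.\<close>
  have lim2: "(\<lambda>j. (E (- t j *\<^sub>R v) - 1) / t j * inv_fourier f x) \<longlonglongrightarrow> - (2 * pi * \<i> * (x \<bullet> v)) * inv_fourier f x"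
  proof -
    define c where "c = - (2 * pi * \<i> * complex_of_real (x \<bullet> v))"
    have "((\<lambda>z. exp (c * z)) has_field_derivative c) (at 0)"
      by (auto intro!: derivative_eq_intros)
    then have "((\<lambda>z. (exp (c * z) - 1) / z) \<longlongrightarrow> c) (at 0)"
      by (simp add: has_field_derivative_iff)
    moreover have "filterlim (\<lambda>j. complex_of_real (t j)) (at 0) sequentially"
      unfolding filterlim_at
      using t tendsto_of_real[OF t0, where 'a=complex] by (auto intro!: always_eventually simp: less_imp_neq[symmetric])
    ultimately have "(\<lambda>j. (exp (c * t j) - 1) / t j) \<longlonglongrightarrow> c"
      by (rule filterlim_compose)
    moreover have "exp (c * t j) = E (- t j *\<^sub>R v)" for j
      by (simp add: c_def E_def mult_ac)
    ultimately have "(\<lambda>j. (E (- t j *\<^sub>R v) - 1) / t j) \<longlonglongrightarrow> c" by (simp only:)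
    then show ?thesis unfolding c_def by (rule tendsto_mult) (rule tendsto_const)
  qed
  show ?thesis
    using LIMSEQ_unique[OF lim1[unfolded qI] lim2] by (simp only: inv_fourier_def E_def)
qed

lemma inv_fourier_iterated_partial:
  assumes f: "schwartz f" and v: "v \<in> Basis"
  shows "inv_fourier (mixed_partial (replicate m v) f) x = (- (2 * pi * \<i> * (x \<bullet> v))) ^ m * inv_fourier f x"
proof (induction m)
  case (Suc m)
  have "inv_fourier (mixed_partial (replicate (Suc m) v) f) x
      = inv_fourier (mixed_partial [v] (mixed_partial (replicate m v) f)) x" by simp
  also have "\<dots> = - (2 * pi * \<i> * (x \<bullet> v)) * inv_fourier (mixed_partial (replicate m v) f) x"
    using v by (intro inv_fourier_partial schwartz_partial f) auto
  finally show ?case using Suc.IH by simp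
qed simp

lemma inv_fourier_norm_le: "norm (inv_fourier f x) \<le> (\<integral>\<xi>. norm (f \<xi>) \<partial>lborel)"
  unfolding inv_fourier_def by (rule order_trans[OF integral_norm_bound]) (simp add: norm_mult)

lemma inv_fourier_measurable:
  assumes [measurable]: "f \<in> borel_measurable borel"
  shows "inv_fourier f \<in> borel_measurable borel"
  unfolding inv_fourier_def[abs_def]
  by (rule lborel.borel_measurable_lebesgue_integral) measurable

text \<open>Up to a factor of modulus at least 1, the m-th power of a coordinate times the inverse
  transform is the inverse transform of an m-fold derivative, hence bounded by the L1 norm of that
  derivative. Pure derivatives in one direction suffice, because |x| is at most n times its largest
  coordinate.\<close>

lemma inv_fourier_rapidly_decreasing:
  fixes f :: "'a::euclidean_space \<Rightarrow> complex"
  assumes f: "schwartz f"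
  shows "rapidly_decreasing (inv_fourier f)"
  unfolding rapidly_decreasing_def
proof (intro conjI allI)
  show "inv_fourier f \<in> borel_measurable borel"
    by (intro inv_fourier_measurable rapidly_decreasing_measurable schwartz_rapidly_decreasing f)
  fix m
  define c where "c v = (\<integral>\<xi>. norm (mixed_partial (replicate m v) f \<xi>) \<partial>lborel)" for v
  define c0 where "c0 = (\<integral>\<xi>. norm (f \<xi>) \<partial>lborel)"
  have c: "\<bar>x \<bullet> v\<bar> ^ m * norm (inv_fourier f x) \<le> c v" if v: "v \<in> Basis" for v x
  proof -
    have "\<bar>x \<bullet> v\<bar> ^ m * norm (inv_fourier f x) \<le> \<bar>2 * pi * (x \<bullet> v)\<bar> ^ m * norm (inv_fourier f x)"
    proof (intro mult_right_mono power_mono)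
      have "1 * \<bar>x \<bullet> v\<bar> \<le> (2 * pi) * \<bar>x \<bullet> v\<bar>"
        using pi_gt3 by (intro mult_right_mono) auto
      then show "\<bar>x \<bullet> v\<bar> \<le> \<bar>2 * pi * (x \<bullet> v)\<bar>" by (simp add: abs_mult)
    qed auto
    also have "\<dots> = norm (inv_fourier (mixed_partial (replicate m v) f) x)"
      by (simp add: inv_fourier_iterated_partial[OF f v] norm_mult norm_power abs_mult)
    also have "\<dots> \<le> c v" unfolding c_def by (rule inv_fourier_norm_le)
    finally show ?thesis .
  qed
  define d where "d = real (DIM('a))"
  have "(1 + norm x) ^ m * norm (inv_fourier f x) \<le> (1 + d) ^ m * (c0 + (\<Sum>v\<in>Basis. c v))" for x
  proof -
    \<comment> \<open>The direction of the largest coordinate depends on x; summing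
      \<open>c v\<close> over all directions at the end removes that dependence from the
      bound.\<close>
    obtain v0 where v0: "v0 \<in> Basis" "\<And>v. v \<in> Basis \<Longrightarrow> \<bar>x \<bullet> v\<bar> \<le> \<bar>x \<bullet> v0\<bar>"
    proof -
      have "Max ((\<lambda>v. \<bar>x \<bullet> v\<bar>) ` Basis) \<in> (\<lambda>v. \<bar>x \<bullet> v\<bar>) ` Basis"
        by (rule Max_in) auto
      then obtain v0 where v0: "Max ((\<lambda>v. \<bar>x \<bullet> v\<bar>) ` Basis) = \<bar>x \<bullet> v0\<bar>" "v0 \<in> Basis" by (rule imageE)
      show ?thesis by (rule that[OF v0(2)]) (simp flip: v0(1))
    qed
    have "norm x \<le> (\<Sum>v\<in>Basis. \<bar>x \<bullet> v\<bar>)" by (rule norm_le_l1)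
    also have "\<dots> \<le> d * \<bar>x \<bullet> v0\<bar>" unfolding d_def by (rule sum_bounded_above) (use v0 in auto)
    finally have "1 + norm x \<le> 1 + d * \<bar>x \<bullet> v0\<bar>" by simp
    also have "\<dots> \<le> max 1 \<bar>x \<bullet> v0\<bar> + d * max 1 \<bar>x \<bullet> v0\<bar>"
      by (intro add_mono mult_left_mono) (auto simp: d_def)
    finally have 1: "1 + norm x \<le> (1 + d) * max 1 \<bar>x \<bullet> v0\<bar>"
      by (simp add: distrib_right)
    have "(1 + norm x) ^ m \<le> (1 + d) ^ m * max 1 \<bar>x \<bullet> v0\<bar> ^ m"
      using power_mono[OF 1, of m] by (simp add: power_mult_distrib)
    also have "\<dots> \<le> (1 + d) ^ m * (1 + \<bar>x \<bullet> v0\<bar> ^ m)"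
      by (intro mult_left_mono) (auto simp: max_def d_def)
    finally have "(1 + norm x) ^ m * norm (inv_fourier f x) \<le> (1 + d) ^ m * (1 + \<bar>x \<bullet> v0\<bar> ^ m) * norm (inv_fourier f x)"
      by (rule mult_right_mono) simp
    also have "\<dots> = (1 + d) ^ m * (norm (inv_fourier f x) + \<bar>x \<bullet> v0\<bar> ^ m * norm (inv_fourier f x))"
      by (simp add: algebra_simps)
    also have "\<dots> \<le> (1 + d) ^ m * (c0 + c v0)"
      by (intro mult_left_mono add_mono c v0) (auto simp: c0_def inv_fourier_norm_le d_def)
    also have "\<dots> \<le> (1 + d) ^ m * (c0 + (\<Sum>v\<in>Basis. c v))"
      by (intro mult_left_mono add_mono order_refl member_le_sum v0) (auto simp: c_def d_def)
    finally show ?thesis .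
  qed
  then show "\<exists>C. \<forall>x. (1 + norm x) ^ m * norm (inv_fourier f x) \<le> C" by blast
qed

section \<open>Fourier inversion by Gaussian summation\<close>

lemma lborel_integrable_prod:
  fixes f :: "'a::euclidean_space \<Rightarrow> real \<Rightarrow> complex"
  assumes f: "\<And>b. b \<in> Basis \<Longrightarrow> integrable lborel (f b)"
  shows "integrable lborel (\<lambda>x::'a. \<Prod>b\<in>Basis. f b (x \<bullet> b))"
proof -
  interpret product_sigma_finite "\<lambda>_::'a. lborel :: real measure" ..
  have [measurable]: "f b \<in> borel_measurable borel" if "b \<in> Basis" for b using f[OF that] by auto
  have "integrable (\<Pi>\<^sub>M b\<in>Basis. lborel) (\<lambda>x. \<Prod>b\<in>Basis. f b (x b))"
    by (intro product_integrable_prod f) auto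
  then show ?thesis
    by (subst lborel_eq) (simp add: integrable_distr_eq cong: prod.cong)
qed

lemma lborel_integral_prod:
  fixes f :: "'a::euclidean_space \<Rightarrow> real \<Rightarrow> complex"
  assumes f: "\<And>b. b \<in> Basis \<Longrightarrow> integrable lborel (f b)"
  shows "(\<integral>(x::'a). (\<Prod>b\<in>Basis. f b (x \<bullet> b)) \<partial>lborel) = (\<Prod>b\<in>Basis. \<integral>x. f b x \<partial>lborel)"
proof -
  interpret product_sigma_finite "\<lambda>_::'a. lborel :: real measure" ..
  have [measurable]: "f b \<in> borel_measurable borel" if "b \<in> Basis" for b using f[OF that] by auto
  have "(\<integral>x. (\<Prod>b\<in>Basis. f b (x b)) \<partial>(\<Pi>\<^sub>M b\<in>Basis. lborel)) = (\<Prod>b\<in>Basis. \<integral>x. f b x \<partial>lborel)"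
    by (intro product_integral_prod f) auto
  then show ?thesis
    by (subst lborel_eq) (simp add: integral_distr cong: prod.cong)
qed

text \<open>A rescaled characteristic function of the standard normal law: the factor
  \<open>c\<close> turns x^2/2 into \<pi> \<epsilon>^2 x^2, and \<open>t\<close> is chosen so that t
  c = -2 \<pi> z.\<close>

lemma gaussian_real:
  fixes \<epsilon> :: real
  assumes \<epsilon>: "0 < \<epsilon>"
  defines "g \<equiv> (\<lambda>z x. exp (- (2 * pi * \<i> * complex_of_real (x * z))) * complex_of_real (exp (- pi * \<epsilon>\<^sup>2 * x\<^sup>2)))"
  shows gaussian_real_integrable: "integrable lborel (g z)"
    and gaussian_real_fourier: "(\<integral>x. g z x \<partial>lborel) = complex_of_real (exp (- pi * z\<^sup>2 / \<epsilon>\<^sup>2) / \<epsilon>)"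
proof -
  define c where "c = \<epsilon> * sqrt (2 * pi)"
  have c: "0 < c" using \<epsilon> by (simp add: c_def)
  define t where "t = - 2 * pi * z / c"
  define h where "h x = complex_of_real (std_normal_density x) * exp (\<i> * complex_of_real (t * x))" for x
  have hi: "integrable lborel h"
  proof (rule Bochner_Integration.integrable_bound[OF integrable_normal_density[of 1 0]])
    show "h \<in> borel_measurable lborel" unfolding h_def by measurable
    show "AE x in lborel. norm (h x) \<le> norm (normal_density 0 1 x)"
      by (intro AE_I2) (simp add: h_def norm_mult del: of_real_mult)
  qed simp
  have hv: "(\<integral>x. h x \<partial>lborel) = complex_of_real (exp (- (t\<^sup>2) / 2))"
  proof -
    have "char std_normal_distribution t = (\<integral>x. std_normal_density x *\<^sub>R exp (\<i> * complex_of_real (t * x)) \<partial>lborel)"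
      unfolding char_def by (subst integral_density) auto
    also have "\<dots> = (\<integral>x. h x \<partial>lborel)" by (simp add: h_def scaleR_conv_of_real)
    finally show ?thesis by (simp add: char_std_normal_distribution)
  qed
  have hg: "h (c * x) = complex_of_real (1 / sqrt (2 * pi)) * g z x" for x
  proof -
    have "exp (- (c * x)\<^sup>2 / 2) = exp (- pi * \<epsilon>\<^sup>2 * x\<^sup>2)"
      by (simp add: c_def power_mult_distrib)
    moreover have "\<i> * complex_of_real (t * (c * x)) = - (2 * pi * \<i> * complex_of_real (x * z))"
      using c by (simp add: t_def)
    ultimately show ?thesis
      by (simp add: h_def g_def std_normal_density_def mult_ac)
  qed
  have "integrable lborel (\<lambda>x. h (c * x))"
    using lborel_integrable_real_affine[OF hi, of c 0] c by simp
  then have "integrable lborel (\<lambda>x. complex_of_real (sqrt (2 * pi)) * h (c * x))"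
    by (rule integrable_mult_right)
  moreover have "(\<lambda>x. complex_of_real (sqrt (2 * pi)) * h (c * x)) = g z"
    unfolding hg by (simp add: fun_eq_iff flip: of_real_mult)
  ultimately show "integrable lborel (g z)" by simp
  have "(\<integral>x. h x \<partial>lborel) = c *\<^sub>R (\<integral>x. h (c * x) \<partial>lborel)"
    using lborel_integral_real_affine[of c h 0] c by simp
  also have "\<dots> = complex_of_real (c * (1 / sqrt (2 * pi))) * (\<integral>x. g z x \<partial>lborel)"
    unfolding hg by (simp add: scaleR_conv_of_real)
  finally have "complex_of_real \<epsilon> * (\<integral>x. g z x \<partial>lborel) = complex_of_real (exp (- (t\<^sup>2) / 2))"
    using hv by (simp add: c_def)
  moreover have "t\<^sup>2 / 2 = pi * z\<^sup>2 / \<epsilon>\<^sup>2"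
    using \<epsilon> by (simp add: t_def c_def power_mult_distrib power_divide power2_eq_square)
  ultimately show "(\<integral>x. g z x \<partial>lborel) = complex_of_real (exp (- pi * z\<^sup>2 / \<epsilon>\<^sup>2) / \<epsilon>)"
    using \<epsilon> by (simp add: field_simps)
qed

lemma gaussian_euclidean:
  fixes \<epsilon> :: real and z :: "'a::euclidean_space"
  assumes \<epsilon>: "0 < \<epsilon>"
  defines "g \<equiv> (\<lambda>x. exp (- (2 * pi * \<i> * complex_of_real (x \<bullet> z))) * complex_of_real (exp (- pi * \<epsilon>\<^sup>2 * (norm x)\<^sup>2)))"
  shows gaussian_euclidean_integrable: "integrable lborel g"
    and gaussian_euclidean_fourier:
      "(\<integral>x. g x \<partial>lborel) = complex_of_real (exp (- pi * (norm z)\<^sup>2 / \<epsilon>\<^sup>2) / \<epsilon> ^ DIM('a))"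
proof -
  define f where "f b x = exp (- (2 * pi * \<i> * complex_of_real (x * (z \<bullet> b)))) * complex_of_real (exp (- pi * \<epsilon>\<^sup>2 * x\<^sup>2))"
    for b :: 'a and x :: real
  have nrm: "(norm y)\<^sup>2 = (\<Sum>b\<in>Basis. (y \<bullet> b)\<^sup>2)" for y :: 'a
    unfolding power2_norm_eq_inner by (subst euclidean_inner) (simp add: power2_eq_square)
  have gf: "g x = (\<Prod>b\<in>Basis. f b (x \<bullet> b))" for x
  proof -
    have 1: "exp (- (2 * pi * \<i> * complex_of_real (x \<bullet> z))) = (\<Prod>b\<in>Basis. exp (- (2 * pi * \<i> * complex_of_real ((x \<bullet> b) * (z \<bullet> b)))))"
      by (subst euclidean_inner) (simp add: exp_sum[symmetric] sum_distrib_left sum_negf)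
    have 2: "exp (- pi * \<epsilon>\<^sup>2 * (norm x)\<^sup>2) = (\<Prod>b\<in>Basis. exp (- pi * \<epsilon>\<^sup>2 * (x \<bullet> b)\<^sup>2))"
      by (simp add: nrm exp_sum[symmetric] sum_distrib_left sum_negf)
    show ?thesis unfolding g_def f_def 1 2 by (simp add: prod.distrib)
  qed
  have fi: "integrable lborel (f b)" for b unfolding f_def by (rule gaussian_real_integrable[OF \<epsilon>])
  show "integrable lborel g"
    unfolding gf[abs_def] by (rule lborel_integrable_prod[OF fi])
  have "(\<integral>x. g x \<partial>lborel) = (\<Prod>b\<in>Basis. \<integral>x. f b x \<partial>lborel)"
    unfolding gf by (rule lborel_integral_prod[OF fi])
  also have "\<dots> = (\<Prod>b\<in>Basis. complex_of_real (exp (- pi * (z \<bullet> b)\<^sup>2 / \<epsilon>\<^sup>2) / \<epsilon>))"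
    unfolding f_def by (subst gaussian_real_fourier[OF \<epsilon>]) simp
  also have "\<dots> = complex_of_real (\<Prod>b\<in>(Basis::'a set). exp (- pi * (z \<bullet> b)\<^sup>2 / \<epsilon>\<^sup>2) / \<epsilon>)" by simp
  also have "(\<Prod>b\<in>(Basis::'a set). exp (- pi * (z \<bullet> b)\<^sup>2 / \<epsilon>\<^sup>2) / \<epsilon>) = exp (- pi * (norm z)\<^sup>2 / \<epsilon>\<^sup>2) / \<epsilon> ^ DIM('a)"
    by (simp add: prod_dividef nrm exp_sum[symmetric] sum_distrib_left sum_divide_distrib sum_negf)
  finally show "(\<integral>x. g x \<partial>lborel) = complex_of_real (exp (- pi * (norm z)\<^sup>2 / \<epsilon>\<^sup>2) / \<epsilon> ^ DIM('a))" .
qed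

text \<open>Tonelli turns joint integrability into finiteness of one iterated integral of the
  modulus. Each exchange of complex integrals below is justified in this way.\<close>

lemma integrable_lborel_pairI:
  fixes F :: "'a::euclidean_space \<Rightarrow> 'b::euclidean_space \<Rightarrow> complex"
  assumes F[measurable]: "case_prod F \<in> borel_measurable (lborel \<Otimes>\<^sub>M lborel)"
    and bound: "(\<integral>\<^sup>+x. \<integral>\<^sup>+y. ennreal (norm (F x y)) \<partial>lborel \<partial>lborel) < \<infinity>"
  shows "integrable (lborel \<Otimes>\<^sub>M lborel) (case_prod F)"
proof (rule integrableI_bounded[OF F])
  have "(\<integral>\<^sup>+p. ennreal (norm (case_prod F p)) \<partial>(lborel \<Otimes>\<^sub>M lborel))
     = (\<integral>\<^sup>+x. \<integral>\<^sup>+y. ennreal (norm (F x y)) \<partial>lborel \<partial>lborel)"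
    by (subst lborel.nn_integral_fst[symmetric]) auto
  then show "(\<integral>\<^sup>+p. ennreal (norm (case_prod F p)) \<partial>(lborel \<Otimes>\<^sub>M lborel)) < \<infinity>" using bound by simp
qed

text \<open>Inserting the definition of the inner transform gives a double integrand of modulus |f
  \<eta>|, constant in x and so not jointly integrable. The Gaussian factor
  \<open>E \<epsilon>\<close> permits the exchange. As \<epsilon> tends to 0, the damped integral
  tends to the left side because the inverse transform is integrable. After the exchange it is a
  Gaussian average of f around \<xi>, which tends to f \<xi> by continuity.\<close>

lemma fourier_inv_fourier:
  fixes f :: "'a::euclidean_space \<Rightarrow> complex"
  assumes f: "schwartz f"
  shows "fourier (inv_fourier f) \<xi> = f \<xi>"
proof -
  define \<Phi> where "\<Phi> = inv_fourier f"
  have fr: "rapidly_decreasing f" by (rule schwartz_rapidly_decreasing[OF f])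
  have \<Phi>r: "rapidly_decreasing \<Phi>" unfolding \<Phi>_def by (rule inv_fourier_rapidly_decreasing[OF f])
  note [measurable] = rapidly_decreasing_measurable[OF fr] rapidly_decreasing_measurable[OF \<Phi>r]
  have fi: "integrable lborel f" and \<Phi>i: "integrable lborel \<Phi>"
    using fr \<Phi>r rapidly_decreasing_imp_integrable by blast+
  define e where "e x z = exp (- (2 * pi * \<i> * complex_of_real (x \<bullet> z)))" for x z :: 'a
  have e_norm: "norm (e x z) = 1" for x z by (simp add: e_def)
  have e_meas[measurable]: "case_prod e \<in> borel_measurable (borel \<Otimes>\<^sub>M borel)" unfolding e_def by measurable
  define E where "E \<epsilon> x = complex_of_real (exp (- pi * \<epsilon>\<^sup>2 * (norm x)\<^sup>2))" for \<epsilon> and x :: 'a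
  have E_norm: "norm (E \<epsilon> x) \<le> 1" for \<epsilon> x by (simp add: E_def)
  have E_meas[measurable]: "E \<epsilon> \<in> borel_measurable borel" for \<epsilon> unfolding E_def by measurable
  define t where "t j = 1 / real (Suc j)" for j
  have t: "0 < t j" for j by (auto simp: t_def)
  have t0: "t \<longlonglongrightarrow> 0" unfolding t_def by (rule LIMSEQ_Suc[OF lim_1_over_n])
  have four: "fourier \<Phi> \<xi> = (\<integral>x. e x \<xi> * \<Phi> x \<partial>lborel)" by (simp add: fourier_def e_def)
  have lim1: "(\<lambda>j. \<integral>x. e x \<xi> * E (t j) x * \<Phi> x \<partial>lborel) \<longlonglongrightarrow> fourier \<Phi> \<xi>"
    unfolding four
  proof (rule integral_dominated_convergence)
    show "integrable lborel (\<lambda>x. norm (\<Phi> x))" using \<Phi>i by simp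
    show "AE x in lborel. norm (e x \<xi> * E (t j) x * \<Phi> x) \<le> norm (\<Phi> x)" for j
      using E_norm by (intro AE_I2) (simp add: norm_mult e_norm mult_left_le_one_le)
    show "AE x in lborel. (\<lambda>j. e x \<xi> * E (t j) x * \<Phi> x) \<longlonglongrightarrow> e x \<xi> * \<Phi> x"
    proof (intro AE_I2)
      fix x :: 'a
      have "(\<lambda>j. exp (- pi * (t j)\<^sup>2 * (norm x)\<^sup>2)) \<longlonglongrightarrow> exp (- pi * 0\<^sup>2 * (norm x)\<^sup>2)"
        by (intro tendsto_intros t0)
      then have "(\<lambda>j. E (t j) x) \<longlonglongrightarrow> 1"
        unfolding E_def by (auto dest: tendsto_of_real[where 'a=complex])
      then have "(\<lambda>j. e x \<xi> * E (t j) x * \<Phi> x) \<longlonglongrightarrow> e x \<xi> * 1 * \<Phi> x"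
        by (intro tendsto_intros)
      then show "(\<lambda>j. e x \<xi> * E (t j) x * \<Phi> x) \<longlonglongrightarrow> e x \<xi> * \<Phi> x" by simp
    qed
  qed measurable
  have eq: "(\<integral>x. e x \<xi> * E \<epsilon> x * \<Phi> x \<partial>lborel) = (\<integral>z. f (\<xi> - \<epsilon> *\<^sub>R z) * E 1 z \<partial>lborel)" if \<epsilon>: "0 < \<epsilon>" for \<epsilon>
  proof -
    have Ei: "integrable lborel (E \<epsilon>)"
      using gaussian_euclidean_integrable[OF \<epsilon>, of "0::'a"] by (simp add: E_def[abs_def])
    have "(\<integral>x. e x \<xi> * E \<epsilon> x * \<Phi> x \<partial>lborel) = (\<integral>x. \<integral>\<eta>. e x (\<xi> - \<eta>) * E \<epsilon> x * f \<eta> \<partial>lborel \<partial>lborel)"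
    proof (rule Bochner_Integration.integral_cong[OF refl])
      fix x :: 'a
      have "e x (\<xi> - \<eta>) = e x \<xi> * exp (2 * pi * \<i> * complex_of_real (x \<bullet> \<eta>))" for \<eta>
        by (simp add: e_def inner_diff_right right_diff_distrib flip: exp_add)
      then show "e x \<xi> * E \<epsilon> x * \<Phi> x = (\<integral>\<eta>. e x (\<xi> - \<eta>) * E \<epsilon> x * f \<eta> \<partial>lborel)"
        by (simp add: \<Phi>_def inv_fourier_def mult_ac flip: integral_mult_right_zero)
    qed
    also have "\<dots> = (\<integral>\<eta>. \<integral>x. e x (\<xi> - \<eta>) * E \<epsilon> x * f \<eta> \<partial>lborel \<partial>lborel)"
    proof (rule lborel_pair.Fubini_integral[symmetric], rule integrable_lborel_pairI)
      show "(\<lambda>(x, \<eta>). e x (\<xi> - \<eta>) * E \<epsilon> x * f \<eta>) \<in> borel_measurable (lborel \<Otimes>\<^sub>M lborel)" by measurable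
      have "(\<integral>\<^sup>+x. \<integral>\<^sup>+\<eta>. ennreal (norm (e x (\<xi> - \<eta>) * E \<epsilon> x * f \<eta>)) \<partial>lborel \<partial>lborel)
          = (\<integral>\<^sup>+x. ennreal (norm (E \<epsilon> x)) \<partial>lborel) * (\<integral>\<^sup>+\<eta>. ennreal (norm (f \<eta>)) \<partial>lborel)"
        by (simp add: norm_mult e_norm ennreal_mult nn_integral_cmult nn_integral_multc)
      also have "\<dots> < \<infinity>"
        using Ei fi by (simp add: integrable_iff_bounded ennreal_mult_less_top)
      finally show "(\<integral>\<^sup>+x. \<integral>\<^sup>+\<eta>. ennreal (norm (e x (\<xi> - \<eta>) * E \<epsilon> x * f \<eta>)) \<partial>lborel \<partial>lborel) < \<infinity>" .
    qed
    also have "\<dots> = (\<integral>\<eta>. complex_of_real (exp (- pi * (norm (\<xi> - \<eta>))\<^sup>2 / \<epsilon>\<^sup>2) / \<epsilon> ^ DIM('a)) * f \<eta> \<partial>lborel)"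
    proof -
      have "(\<integral>x. e x z * E \<epsilon> x \<partial>lborel) = complex_of_real (exp (- pi * (norm z)\<^sup>2 / \<epsilon>\<^sup>2) / \<epsilon> ^ DIM('a))" for z
        unfolding e_def E_def by (rule gaussian_euclidean_fourier[OF \<epsilon>])
      then show ?thesis by simp
    qed
    \<comment> \<open>Substituting \<eta> = \<xi> - \<epsilon> z cancels the factor \<epsilon>^n and
      leaves the fixed Gaussian \<open>E 1\<close> of total mass 1, so that only the argument of f
      still depends on \<epsilon>.\<close>
    also have "\<dots> = \<bar>- \<epsilon>\<bar> ^ DIM('a) *\<^sub>R (\<integral>z. complex_of_real (exp (- pi * (norm (\<xi> - (\<xi> + (- \<epsilon>) *\<^sub>R z)))\<^sup>2 / \<epsilon>\<^sup>2) / \<epsilon> ^ DIM('a)) * f (\<xi> + (- \<epsilon>) *\<^sub>R z) \<partial>lborel)"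
      using \<epsilon> by (intro lborel_integral_affine) auto
    also have "\<dots> = (\<integral>z. f (\<xi> - \<epsilon> *\<^sub>R z) * E 1 z \<partial>lborel)"
      unfolding integral_scaleR_right[symmetric]
      using \<epsilon> by (intro Bochner_Integration.integral_cong)
        (simp_all add: E_def power_mult_distrib scaleR_conv_of_real)
    finally show ?thesis .
  qed
  obtain C where C: "\<And>x. norm (f x) \<le> C"
    using rapidly_decreasing_bound[OF fr, of 0] by auto
  have E1: "integrable lborel (E 1)" and E1v: "(\<integral>x. E 1 x \<partial>lborel) = 1"
    using gaussian_euclidean_integrable[of 1 "0::'a"] gaussian_euclidean_fourier[of 1 "0::'a"] by (simp_all add: E_def[abs_def])
  have "(\<lambda>j. \<integral>z. f (\<xi> - t j *\<^sub>R z) * E 1 z \<partial>lborel) \<longlonglongrightarrow> (\<integral>z. f \<xi> * E 1 z \<partial>lborel)"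
  proof (rule integral_dominated_convergence)
    show "integrable lborel (\<lambda>z. C * norm (E 1 z))" using E1 by simp
    show "AE z in lborel. norm (f (\<xi> - t j *\<^sub>R z) * E 1 z) \<le> C * norm (E 1 z)" for j
      using C by (intro AE_I2) (simp add: norm_mult mult_right_mono)
    show "AE z in lborel. (\<lambda>j. f (\<xi> - t j *\<^sub>R z) * E 1 z) \<longlonglongrightarrow> f \<xi> * E 1 z"
    proof (intro AE_I2 tendsto_mult tendsto_const)
      fix z :: 'a
      have "isCont f \<xi>" using schwartz_continuous[OF f] by (simp add: continuous_on_eq_continuous_at)
      moreover have "(\<lambda>j. \<xi> - t j *\<^sub>R z) \<longlonglongrightarrow> \<xi>" using t0 by (auto intro!: tendsto_eq_intros)
      ultimately show "(\<lambda>j. f (\<xi> - t j *\<^sub>R z)) \<longlonglongrightarrow> f \<xi>" by (rule isCont_tendsto_compose)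
    qed
  qed measurable
  then have "(\<lambda>j. \<integral>x. e x \<xi> * E (t j) x * \<Phi> x \<partial>lborel) \<longlonglongrightarrow> f \<xi>"
    using E1v t by (simp add: eq)
  then show ?thesis using LIMSEQ_unique[OF lim1] by (simp add: \<Phi>_def)
qed

section \<open>The reproducing kernel of a dyadic block\<close>

lemma schwartz_Lipschitz:
  fixes f :: "'a::euclidean_space \<Rightarrow> complex"
  assumes f: "schwartz f"
  obtains L where "0 \<le> L" "\<And>x h. norm (f (x + h) - f x) \<le> L * norm h"
proof -
  obtain C where C: "0 \<le> C" "\<And>x h. norm h \<le> 1 \<Longrightarrow> norm (f (x + h) - f x) \<le> C * norm h"
    using schwartz_increment[OF f, of 0] by auto
  obtain M where M: "0 \<le> M" "\<And>x. norm (f x) \<le> M"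
    using rapidly_decreasing_bound[OF schwartz_rapidly_decreasing[OF f], of 0] by auto
  have "norm (f (x + h) - f x) \<le> (C + 2 * M) * norm h" for x h
  proof (cases "norm h \<le> 1")
    case True
    have "norm (f (x + h) - f x) \<le> C * norm h" by (rule C(2)[OF True])
    also have "\<dots> \<le> (C + 2 * M) * norm h" using M(1) by (intro mult_right_mono) auto
    finally show ?thesis .
  next
    case False
    have "norm (f (x + h) - f x) \<le> norm (f (x + h)) + norm (f x)" by (rule norm_triangle_ineq4)
    also have "\<dots> \<le> 2 * M" using M(2)[of "x + h"] M(2)[of x] by simp
    also have "\<dots> \<le> (C + 2 * M) * 1" using C(1) by simp
    also have "\<dots> \<le> (C + 2 * M) * norm h" using False C(1) M(1) by (intro mult_left_mono) auto
    finally show ?thesis .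
  qed
  then show ?thesis using that[of "C + 2 * M"] C(1) M(1) by simp
qed

text \<open>The transpose of convolution with K: integrating the convolution of K and g against
  \<psi> is integrating g against \<open>correlation K \<psi>\<close>, without complex
  conjugation.\<close>

definition correlation :: "('a::euclidean_space \<Rightarrow> complex) \<Rightarrow> ('a \<Rightarrow> complex) \<Rightarrow> 'a \<Rightarrow> complex" where
  "correlation K \<psi> y = (\<integral>z. K z * \<psi> (y + z) \<partial>lborel)"

lemma correlation_integrable:
  assumes K: "rapidly_decreasing K" and \<psi>: "schwartz \<psi>"
  shows "integrable lborel (\<lambda>z. K z * \<psi> (y + z))"
proof -
  note [measurable] = rapidly_decreasing_measurable[OF K] rapidly_decreasing_measurable[OF schwartz_rapidly_decreasing[OF \<psi>]]
  obtain M where M: "0 \<le> M" "\<And>x. norm (\<psi> x) \<le> M"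
    using rapidly_decreasing_bound[OF schwartz_rapidly_decreasing[OF \<psi>], of 0] by auto
  show ?thesis
  proof (rule Bochner_Integration.integrable_bound)
    show "integrable lborel (\<lambda>z. M * norm (K z))"
      using rapidly_decreasing_imp_integrable[OF K] by simp
    show "AE z in lborel. norm (K z * \<psi> (y + z)) \<le> norm (M * norm (K z))"
      using M by (intro AE_I2) (simp add: norm_mult mult.commute[of M] mult_left_mono)
  qed measurable
qed

text \<open>Differentiation under the integral with the derivative on \<psi>, so that integrability
  of K is enough. The first-order remainder divided by |h| tends to 0 pointwise and is bounded by a
  Lipschitz constant plus a bound on the derivative, which gives the majorant a multiple of
  |K|.\<close>

lemma correlation_has_derivative:
  fixes K \<psi> :: "'a::euclidean_space \<Rightarrow> complex"
  assumes K: "rapidly_decreasing K" and \<psi>: "schwartz \<psi>"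
  shows "(correlation K \<psi> has_derivative
           (\<lambda>h. \<Sum>v\<in>Basis. (h \<bullet> v) *\<^sub>R correlation K (mixed_partial [v] \<psi>) y)) (at y)"
proof -
  define d where "d v = mixed_partial [v] \<psi>" for v :: 'a
  have ds: "schwartz (d v)" if "v \<in> Basis" for v
    unfolding d_def using that by (intro schwartz_partial \<psi>) auto
  define D where "D x h = (\<Sum>v\<in>Basis. (h \<bullet> v) *\<^sub>R d v x)" for x h
  note [measurable] = rapidly_decreasing_measurable[OF K] rapidly_decreasing_measurable[OF schwartz_rapidly_decreasing[OF \<psi>]]
  have [measurable]: "d v \<in> borel_measurable borel" if "v \<in> Basis" for v
    by (rule rapidly_decreasing_measurable[OF schwartz_rapidly_decreasing[OF ds[OF that]]])
  have Dder: "(\<psi> has_derivative D x) (at x)" for x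
    using schwartz_has_derivative[OF \<psi>, of x] by (simp only: D_def[abs_def] d_def)
  obtain L where L: "0 \<le> L" "\<And>x h. norm (\<psi> (x + h) - \<psi> x) \<le> L * norm h"
    using schwartz_Lipschitz[OF \<psi>] by blast
  have "\<exists>M. \<forall>x. norm (d v x) \<le> M" if "v \<in> Basis" for v
    using rapidly_decreasing_bound[OF schwartz_rapidly_decreasing[OF ds[OF that]], of 0] by auto
  then obtain M where M: "\<And>v x. v \<in> Basis \<Longrightarrow> norm (d v x) \<le> M v" by metis
  define N where "N = (\<Sum>v\<in>(Basis::'a set). M v)"
  have DN: "norm (D x h) \<le> N * norm h" for x h
  proof -
    have "norm (D x h) \<le> (\<Sum>v\<in>Basis. norm h * M v)"
      unfolding D_def
    proof (rule sum_norm_le)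
      fix v :: 'a assume v: "v \<in> Basis"
      show "norm ((h \<bullet> v) *\<^sub>R d v x) \<le> norm h * M v"
        unfolding norm_scaleR using Basis_le_norm[OF v, of h] M[OF v, of x] by (intro mult_mono) auto
    qed
    then show ?thesis by (simp add: N_def sum_distrib_left mult.commute)
  qed
  \<comment> \<open>At h = 0 the division yields 0, so the bound \<open>Rb\<close> holds for every
    h.\<close>
  define R where "R h z = (\<psi> (y + h + z) - \<psi> (y + z) - D (y + z) h) / norm h" for h z
  have R_meas[measurable]: "R h \<in> borel_measurable borel" for h unfolding R_def D_def by measurable
  have Rb: "norm (R h z) \<le> L + N" for h z
  proof (cases "h = 0")
    case True
    have "0 \<le> N" unfolding N_def using M by (intro sum_nonneg) (blast intro: order_trans[OF norm_ge_zero])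
    with True L(1) show ?thesis by (simp add: R_def)
  next
    case False
    have "y + h + z = y + z + h" by (simp add: add_ac)
    then have "norm (\<psi> (y + h + z) - \<psi> (y + z) - D (y + z) h) \<le> norm (\<psi> (y + z + h) - \<psi> (y + z)) + norm (D (y + z) h)"
      by (simp only:) (rule norm_triangle_ineq4)
    also have "\<dots> \<le> L * norm h + N * norm h" by (intro add_mono L DN)
    finally have "norm (\<psi> (y + h + z) - \<psi> (y + z) - D (y + z) h) \<le> (L + N) * norm h" by (simp add: distrib_right)
    then show ?thesis using False by (simp add: R_def norm_divide divide_le_eq)
  qed
  have I: "correlation K \<psi> (y + h) - correlation K \<psi> y - (\<Sum>v\<in>Basis. (h \<bullet> v) *\<^sub>R correlation K (d v) y)
      = norm h * (\<integral>z. K z * R h z \<partial>lborel)" if "h \<noteq> 0" for h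
  proof -
    have 1: "(\<Sum>v\<in>Basis. (h \<bullet> v) *\<^sub>R correlation K (d v) y) = (\<integral>z. (\<Sum>v\<in>Basis. (h \<bullet> v) *\<^sub>R (K z * d v (y + z))) \<partial>lborel)"
      unfolding correlation_def using correlation_integrable[OF K ds] by (simp add: integral_sum)
    have i2: "integrable lborel (\<lambda>z. (\<Sum>v\<in>Basis. (h \<bullet> v) *\<^sub>R (K z * d v (y + z))))"
      using correlation_integrable[OF K ds] by auto
    have "norm h * (\<integral>z. K z * R h z \<partial>lborel)
        = (\<integral>z. K z * \<psi> (y + h + z) - K z * \<psi> (y + z) - (\<Sum>v\<in>Basis. (h \<bullet> v) *\<^sub>R (K z * d v (y + z))) \<partial>lborel)"
      unfolding integral_mult_right_zero[symmetric]
    proof (rule Bochner_Integration.integral_cong[OF refl])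
      fix z
      have "norm h * (K z * R h z) = K z * (\<psi> (y + h + z) - \<psi> (y + z) - D (y + z) h)"
        using that by (simp add: R_def)
      then show "norm h * (K z * R h z) = K z * \<psi> (y + h + z) - K z * \<psi> (y + z) - (\<Sum>v\<in>Basis. (h \<bullet> v) *\<^sub>R (K z * d v (y + z)))"
        by (simp add: D_def sum_distrib_left right_diff_distrib)
    qed
    also have "\<dots> = correlation K \<psi> (y + h) - correlation K \<psi> y - (\<Sum>v\<in>Basis. (h \<bullet> v) *\<^sub>R correlation K (d v) y)"
      unfolding 1 using i2 correlation_integrable[OF K \<psi>] by (simp add: correlation_def)
    finally show ?thesis by simp
  qed
  have lim: "((\<lambda>h. \<integral>z. K z * R h z \<partial>lborel) \<longlongrightarrow> 0) (at 0)"
    unfolding tendsto_at_iff_sequentially comp_def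
  proof (intro allI impI)
    fix X :: "nat \<Rightarrow> 'a" assume X: "\<forall>i. X i \<in> UNIV - {0}" "X \<longlonglongrightarrow> 0"
    have "(\<lambda>i. \<integral>z. K z * R (X i) z \<partial>lborel) \<longlonglongrightarrow> (\<integral>(z::'a). 0 \<partial>lborel)"
    proof (rule integral_dominated_convergence)
      show "integrable lborel (\<lambda>z. norm (K z) * (L + N))"
        using rapidly_decreasing_imp_integrable[OF K] by simp
      show "AE z in lborel. norm (K z * R (X i) z) \<le> norm (K z) * (L + N)" for i
        using Rb by (intro AE_I2) (simp add: norm_mult mult_left_mono)
      show "AE z in lborel. (\<lambda>i. K z * R (X i) z) \<longlonglongrightarrow> 0"
      proof (intro AE_I2 tendsto_mult_right_zero)
        fix z :: 'a
        have "((\<lambda>h. norm (\<psi> (y + z + h) - \<psi> (y + z) - D (y + z) h) / norm h) \<longlongrightarrow> 0) (at 0)"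
          using Dder[of "y + z"] by (simp add: has_derivative_at)
        then have "(\<lambda>i. norm (\<psi> (y + z + X i) - \<psi> (y + z) - D (y + z) (X i)) / norm (X i)) \<longlonglongrightarrow> 0"
          using X unfolding tendsto_at_iff_sequentially comp_def by blast
        then have "(\<lambda>i. norm (R (X i) z)) \<longlonglongrightarrow> 0"
          by (simp add: R_def norm_divide add_ac)
        then show "(\<lambda>i. R (X i) z) \<longlonglongrightarrow> 0" by (rule tendsto_norm_zero_cancel)
      qed
    qed measurable
    then show "(\<lambda>i. \<integral>z. K z * R (X i) z \<partial>lborel) \<longlonglongrightarrow> 0" by simp
  qed
  have "((\<lambda>h. norm (correlation K \<psi> (y + h) - correlation K \<psi> y - (\<Sum>v\<in>Basis. (h \<bullet> v) *\<^sub>R correlation K (d v) y)) / norm h) \<longlongrightarrow> 0) (at 0)"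
  proof (rule Lim_transform_eventually[OF tendsto_norm_zero[OF lim]])
    show "\<forall>\<^sub>F h in at 0. norm (\<integral>z. K z * R h z \<partial>lborel)
        = norm (correlation K \<psi> (y + h) - correlation K \<psi> y - (\<Sum>v\<in>Basis. (h \<bullet> v) *\<^sub>R correlation K (d v) y)) / norm h"
      unfolding eventually_at_filter by (rule always_eventually) (auto simp: I norm_mult)
  qed
  moreover have "bounded_linear (\<lambda>h. \<Sum>v\<in>Basis. (h \<bullet> v) *\<^sub>R correlation K (d v) y)"
    by (intro bounded_linear_sum bounded_linear_scaleR_const bounded_linear_inner_left)
  ultimately show ?thesis by (simp only: has_derivative_at d_def)
qed

lemma mixed_partial_correlation:
  assumes K: "rapidly_decreasing K" and \<psi>: "schwartz \<psi>" and vs: "vs \<in> lists Basis"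
  shows "mixed_partial vs (correlation K \<psi>) = correlation K (mixed_partial vs \<psi>)"
  using vs
proof (induction vs)
  case (Cons v vs)
  then have v: "v \<in> Basis" and s: "schwartz (mixed_partial vs \<psi>)" using schwartz_partial[OF \<psi>] by auto
  have IH: "mixed_partial vs (correlation K \<psi>) = correlation K (mixed_partial vs \<psi>)" using Cons by simp
  have *: "frechet_derivative (correlation K (mixed_partial vs \<psi>)) (at y) v = correlation K (mixed_partial [v] (mixed_partial vs \<psi>)) y" for y
  proof -
    have "frechet_derivative (correlation K (mixed_partial vs \<psi>)) (at y) v
      = (\<Sum>w\<in>Basis. (v \<bullet> w) *\<^sub>R correlation K (mixed_partial [w] (mixed_partial vs \<psi>)) y)"
      using frechet_derivative_at[OF correlation_has_derivative[OF K s, of y]] by (metis (no_types, lifting))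
    also have "\<dots> = (\<Sum>w\<in>Basis. if w = v then correlation K (mixed_partial [v] (mixed_partial vs \<psi>)) y else 0)"
      using v by (intro sum.cong) (auto simp: inner_Basis simp del: mixed_partial.simps)
    finally show ?thesis using v by (simp del: mixed_partial.simps)
  qed
  show ?case using * by (simp add: IH fun_eq_iff)
qed simp

text \<open>Partial derivatives commute with correlation, and 1 + |y| \<le> (1 + |y+z|) (1 + |z|)
  distributes a polynomial weight between \<psi> and K, both of which decay faster than any
  power.\<close>

lemma schwartz_correlation:
  fixes K \<psi> :: "'a::euclidean_space \<Rightarrow> complex"
  assumes K: "rapidly_decreasing K" and \<psi>: "schwartz \<psi>"
  shows "schwartz (correlation K \<psi>)"
  unfolding schwartz_def smooth_def
proof (intro conjI ballI allI)
  fix vs :: "'a list" assume vs: "vs \<in> lists Basis"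
  have s: "schwartz (mixed_partial vs \<psi>)" by (rule schwartz_partial[OF \<psi> vs])
  show "mixed_partial vs (correlation K \<psi>) differentiable at x" for x
    unfolding mixed_partial_correlation[OF K \<psi> vs] differentiable_def
    using correlation_has_derivative[OF K s] by blast
  fix m
  obtain C where C: "0 \<le> C" "\<And>x. norm (mixed_partial vs \<psi> x) \<le> C / (1 + norm x) ^ m"
    using rapidly_decreasing_bound[OF schwartz_rapidly_decreasing[OF s]] by blast
  have "norm ((1 + norm y) ^ m *\<^sub>R correlation K (mixed_partial vs \<psi>) y) \<le> (\<integral>z. C * ((1 + norm z) ^ m * norm (K z)) \<partial>lborel)" for y
  proof -
    have "norm ((1 + norm y) ^ m *\<^sub>R correlation K (mixed_partial vs \<psi>) y)
        = norm (\<integral>z. (1 + norm y) ^ m *\<^sub>R (K z * mixed_partial vs \<psi> (y + z)) \<partial>lborel)"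
      by (simp add: correlation_def)
    also have "\<dots> \<le> (\<integral>z. C * ((1 + norm z) ^ m * norm (K z)) \<partial>lborel)"
    proof (rule Bochner_Integration.integral_norm_bound_integral)
      show "integrable lborel (\<lambda>z. (1 + norm y) ^ m *\<^sub>R (K z * mixed_partial vs \<psi> (y + z)))"
        using correlation_integrable[OF K s] by simp
      show "integrable lborel (\<lambda>z. C * ((1 + norm z) ^ m * norm (K z)))"
        using rapidly_decreasing_integrable[OF K] by simp
      fix z :: 'a
      have "norm y \<le> norm (y + z) + norm z" by (metis norm_triangle_ineq4 add_diff_cancel_right')
      then have "1 + norm y \<le> (1 + norm (y + z)) * (1 + norm z)"
        using mult_nonneg_nonneg[OF norm_ge_zero[of "y + z"] norm_ge_zero[of z]] by argo
      then have "(1 + norm y) ^ m \<le> (1 + norm (y + z)) ^ m * (1 + norm z) ^ m"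
        by (metis power_mono power_mult_distrib add_nonneg_nonneg norm_ge_zero zero_le_one)
      then have "(1 + norm y) ^ m * (norm (K z) * norm (mixed_partial vs \<psi> (y + z)))
         \<le> ((1 + norm (y + z)) ^ m * (1 + norm z) ^ m) * (norm (K z) * (C / (1 + norm (y + z)) ^ m))"
        by (intro mult_mono C) (auto intro!: mult_nonneg_nonneg)
      also have "\<dots> = C * ((1 + norm z) ^ m * norm (K z))"
        by (simp add: add_nonneg_eq_0_iff)
      finally show "norm ((1 + norm y) ^ m *\<^sub>R (K z * mixed_partial vs \<psi> (y + z))) \<le> C * ((1 + norm z) ^ m * norm (K z))"
        by (simp add: norm_mult)
    qed
    finally show ?thesis .
  qed
  then show "bounded (range (\<lambda>x. (1 + norm x) ^ m *\<^sub>R mixed_partial vs (correlation K \<psi>) x))"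
    unfolding mixed_partial_correlation[OF K \<psi> vs] bounded_iff by blast
qed

text \<open>The convolution theorem in transposed form. Since \<psi> is shifted by +z, undoing the
  shift contributes \<open>e (- z)\<close>; the factor is therefore the forward transform of K
  although the transform on the left is the inverse one.\<close>

lemma inv_fourier_correlation:
  fixes K \<psi> :: "'a::euclidean_space \<Rightarrow> complex"
  assumes K: "rapidly_decreasing K" and \<psi>: "schwartz \<psi>"
  shows "inv_fourier (correlation K \<psi>) \<xi> = fourier K \<xi> * inv_fourier \<psi> \<xi>"
proof -
  have \<psi>r: "rapidly_decreasing \<psi>" by (rule schwartz_rapidly_decreasing[OF \<psi>])
  note [measurable] = rapidly_decreasing_measurable[OF K] rapidly_decreasing_measurable[OF \<psi>r]
  have Ki: "integrable lborel K" and \<psi>i: "integrable lborel \<psi>"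
    using K \<psi>r rapidly_decreasing_imp_integrable by blast+
  define e where "e x = exp (2 * pi * \<i> * complex_of_real (\<xi> \<bullet> x))" for x :: 'a
  have e_norm: "norm (e x) = 1" for x by (simp add: e_def)
  have e_meas[measurable]: "e \<in> borel_measurable borel" unfolding e_def by measurable
  have e_add: "e (a + b) = e a * e b" for a b
    by (simp add: e_def inner_add_right distrib_left exp_add)
  have "inv_fourier (correlation K \<psi>) \<xi> = (\<integral>y. \<integral>z. e y * (K z * \<psi> (z + y)) \<partial>lborel \<partial>lborel)"
    by (simp add: inv_fourier_def correlation_def e_def add.commute)
  also have "\<dots> = (\<integral>z. \<integral>y. e y * (K z * \<psi> (z + y)) \<partial>lborel \<partial>lborel)"
  proof (rule lborel_pair.Fubini_integral, rule integrable_lborel_pairI)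
    show "(\<lambda>(z, y). e y * (K z * \<psi> (z + y))) \<in> borel_measurable (lborel \<Otimes>\<^sub>M lborel)" by measurable
    have "(\<integral>\<^sup>+y. ennreal (norm (\<psi> (z + y))) \<partial>lborel) = (\<integral>\<^sup>+y. ennreal (norm (\<psi> y)) \<partial>lborel)" for z
      using lborel_nn_integral_affine[of "\<lambda>y. ennreal (norm (\<psi> y))" 1 z] by simp
    then have "(\<integral>\<^sup>+z. \<integral>\<^sup>+y. ennreal (norm (e y * (K z * \<psi> (z + y)))) \<partial>lborel \<partial>lborel)
        = (\<integral>\<^sup>+z. ennreal (norm (K z)) \<partial>lborel) * (\<integral>\<^sup>+y. ennreal (norm (\<psi> y)) \<partial>lborel)"
      by (simp add: norm_mult e_norm ennreal_mult nn_integral_cmult nn_integral_multc)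
    also have "\<dots> < \<infinity>"
      using Ki \<psi>i by (simp add: integrable_iff_bounded ennreal_mult_less_top)
    finally show "(\<integral>\<^sup>+z. \<integral>\<^sup>+y. ennreal (norm (e y * (K z * \<psi> (z + y)))) \<partial>lborel \<partial>lborel) < \<infinity>" .
  qed
  also have "\<dots> = (\<integral>z. (e (- z) * K z) * inv_fourier \<psi> \<xi> \<partial>lborel)"
  proof (rule Bochner_Integration.integral_cong[OF refl])
    fix z :: 'a
    have "(\<integral>y. e y * (K z * \<psi> (z + y)) \<partial>lborel) = (\<integral>y. e (- z + (z + y)) * (K z * \<psi> (z + y)) \<partial>lborel)" by simp
    also have "\<dots> = (\<integral>y. e (- z + y) * (K z * \<psi> y) \<partial>lborel)"
      by (rule lborel_integral_translate[of "\<lambda>y. e (- z + y) * (K z * \<psi> y)"]) measurable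
    also have "\<dots> = (\<integral>y. (e (- z) * K z) * (e y * \<psi> y) \<partial>lborel)"
      by (simp only: e_add mult_ac)
    also have "\<dots> = (e (- z) * K z) * inv_fourier \<psi> \<xi>" by (simp add: inv_fourier_def e_def)
    finally show "(\<integral>y. e y * (K z * \<psi> (z + y)) \<partial>lborel) = (e (- z) * K z) * inv_fourier \<psi> \<xi>" .
  qed
  also have "\<dots> = fourier K \<xi> * inv_fourier \<psi> \<xi>"
    by (simp add: fourier_def e_def inner_commute)
  finally show ?thesis .
qed

section \<open>A kernel with Fourier transform 1 on the dyadic annulus\<close>

lemma fourier_dilate:
  fixes f :: "'a::euclidean_space \<Rightarrow> complex"
  assumes [measurable]: "f \<in> borel_measurable borel" and s: "0 < s"
  shows "fourier (\<lambda>x. complex_of_real (s ^ DIM('a)) * f (s *\<^sub>R x)) \<xi> = fourier f ((1 / s) *\<^sub>R \<xi>)"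
proof -
  have "fourier f ((1 / s) *\<^sub>R \<xi>) = \<bar>s\<bar> ^ DIM('a) *\<^sub>R (\<integral>x. exp (- 2 * pi * \<i> * complex_of_real ((0 + s *\<^sub>R x) \<bullet> (1 / s) *\<^sub>R \<xi>)) * f (0 + s *\<^sub>R x) \<partial>lborel)"
    unfolding fourier_def using s by (intro lborel_integral_affine) auto
  also have "\<dots> = fourier (\<lambda>x. complex_of_real (s ^ DIM('a)) * f (s *\<^sub>R x)) \<xi>"
    unfolding fourier_def integral_scaleR_right[symmetric] using s
    by (intro Bochner_Integration.integral_cong) (simp_all add: scaleR_conv_of_real mult_ac)
  finally show ?thesis by simp
qed

lemma fourier_sum:
  assumes "\<And>j. j \<in> J \<Longrightarrow> integrable lborel (f j)"
  shows "fourier (\<lambda>x. \<Sum>j\<in>J. f j x) \<xi> = (\<Sum>j\<in>J. fourier (f j) \<xi>)"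
proof -
  have "integrable lborel (\<lambda>x. exp (- (2 * pi * \<i> * complex_of_real (x \<bullet> \<xi>))) * f j x)" if "j \<in> J" for j
    by (rule Bochner_Integration.integrable_bound[OF assms[OF that]])
      (use borel_measurable_integrable[OF assms[OF that]] in \<open>auto simp: norm_mult\<close>)
  then show ?thesis by (simp add: fourier_def sum_distrib_left integral_sum)
qed

text \<open>A nonzero term forces \<xi> and its dilate into the same closed annulus. Outer and inner
  radius have ratio 2^2, so |k| is at most 2 and the resolution of unity reduces to five
  terms.\<close>

lemma dyadic_generator_sum:
  assumes \<phi>: "dyadic_generator \<phi>" and \<xi>: "\<phi> \<xi> \<noteq> 0"
  shows "(\<Sum>k\<in>{-2..2::int}. \<phi> ((2 powi (- k)) *\<^sub>R \<xi>)) = 1"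
proof -
  have supp: "1/2 \<le> norm \<eta> \<and> norm \<eta> \<le> 2" if "\<phi> \<eta> \<noteq> 0" for \<eta>
    using \<phi> closure_subset[of "{\<xi>. \<phi> \<xi> \<noteq> 0}"] that unfolding dyadic_generator_def by blast
  have n: "1/2 \<le> norm \<xi>" "norm \<xi> \<le> 2" using supp[OF \<xi>] by auto
  then have "\<xi> \<noteq> 0" by auto
  then have "((\<lambda>k::int. \<phi> ((2 powi (- k)) *\<^sub>R \<xi>)) has_sum 1) UNIV"
    using \<phi> unfolding dyadic_generator_def by blast
  moreover have "\<phi> ((2 powi (- k)) *\<^sub>R \<xi>) = 0" if "k \<notin> {-2..2}" for k
  proof (rule ccontr)
    assume "\<phi> ((2 powi (- k)) *\<^sub>R \<xi>) \<noteq> 0"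
    from supp[OF this] have *: "1/2 \<le> 2 powi (- k) * norm \<xi>" "2 powi (- k) * norm \<xi> \<le> 2"
      by (auto simp: norm_power_int)
    have "k \<ge> 3 \<or> k \<le> -3" using that by auto
    then show False
    proof
      assume "k \<ge> 3"
      then have "2 powi (-k) \<le> (2::real) powi (-3)" by (intro power_int_increasing) auto
      then have "2 powi (-k) * norm \<xi> \<le> 1/8 * 2" using n by (intro mult_mono) (auto simp: power_int_minus)
      with * show False by simp
    next
      assume "k \<le> -3"
      then have "2 powi (3::int) \<le> (2::real) powi (-k)" by (intro power_int_increasing) auto
      then have "8 * (1/2) \<le> 2 powi (-k) * norm \<xi>" using n by (intro mult_mono) auto
      with * show False by simp
    qed
  qed
  ultimately have "((\<lambda>k::int. \<phi> ((2 powi (- k)) *\<^sub>R \<xi>)) has_sum 1) {-2..2}"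
    by (subst has_sum_cong_neutral[where T = UNIV and g = "\<lambda>k::int. \<phi> ((2 powi (- k)) *\<^sub>R \<xi>)"]) auto
  then show ?thesis by (simp add: has_sum_finite_iff)
qed

lemma reproducing_kernel_exists:
  fixes \<phi> :: "'a::euclidean_space \<Rightarrow> real"
  assumes \<phi>: "dyadic_generator \<phi>"
  obtains K where "rapidly_decreasing K" "\<And>\<xi>. \<phi> \<xi> \<noteq> 0 \<Longrightarrow> fourier K \<xi> = 1"
proof -
  let ?f = "\<lambda>\<xi>. complex_of_real (\<phi> \<xi>)"
  have f: "schwartz ?f" using \<phi> by (simp add: dyadic_generator_def)
  \<comment> \<open>The L1-normalising factor makes the transform of \<open>P j\<close> exactly the
    dilate of \<phi>, once Fourier inversion is applied.\<close>
  define P where "P j x = complex_of_real ((2 powi j) ^ DIM('a)) * inv_fourier ?f ((2 powi j) *\<^sub>R x)" for j :: int and x :: 'a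
  have Pr: "rapidly_decreasing (P j)" for j
    unfolding P_def by (intro rapidly_decreasing_dilate inv_fourier_rapidly_decreasing f) simp
  have PF: "fourier (P j) \<xi> = ?f ((2 powi (- j)) *\<^sub>R \<xi>)" for j \<xi>
  proof -
    have "fourier (P j) \<xi> = fourier (inv_fourier ?f) ((1 / 2 powi j) *\<^sub>R \<xi>)"
      unfolding P_def[abs_def]
      by (intro fourier_dilate rapidly_decreasing_measurable inv_fourier_rapidly_decreasing f) simp
    then show ?thesis by (simp add: fourier_inv_fourier[OF f] power_int_minus_divide)
  qed
  show ?thesis
  proof (rule that)
    show "rapidly_decreasing (\<lambda>x. \<Sum>j\<in>{-2..2}. P j x)" by (intro rapidly_decreasing_sum Pr)
    fix \<xi> assume "\<phi> \<xi> \<noteq> 0"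
    have "fourier (\<lambda>x. \<Sum>j\<in>{-2..2}. P j x) \<xi> = (\<Sum>j\<in>{-2..2}. fourier (P j) \<xi>)"
      by (intro fourier_sum rapidly_decreasing_imp_integrable Pr)
    also have "\<dots> = complex_of_real (\<Sum>j\<in>{-2..2}. \<phi> ((2 powi (- j)) *\<^sub>R \<xi>))" by (simp only: PF of_real_sum)
    also have "\<dots> = 1" using dyadic_generator_sum[OF \<phi> \<open>\<phi> \<xi> \<noteq> 0\<close>] by simp
    finally show "fourier (\<lambda>x. \<Sum>j\<in>{-2..2}. P j x) \<xi> = 1" .
  qed
qed

text \<open>Correlation multiplies the inverse transform of the test function by
  \<open>fourier K\<close>, which is 1 wherever the dyadic cut-off is nonzero. The two functions
  handed to T are thus already equal before T is applied.\<close>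

lemma lp_block_correlation:
  assumes K: "rapidly_decreasing K" and \<psi>: "schwartz \<psi>"
    and one: "\<And>\<xi>. \<phi> ((2 powi (- k)) *\<^sub>R \<xi>) \<noteq> 0 \<Longrightarrow> fourier K \<xi> = 1"
  shows "lp_block \<phi> k T (correlation K \<psi>) = lp_block \<phi> k T \<psi>"
proof -
  have "complex_of_real (\<phi> ((2 powi (- k)) *\<^sub>R \<xi>)) * inv_fourier (correlation K \<psi>) \<xi>
      = complex_of_real (\<phi> ((2 powi (- k)) *\<^sub>R \<xi>)) * inv_fourier \<psi> \<xi>" for \<xi>
    using one[of \<xi>] by (cases "\<phi> ((2 powi (- k)) *\<^sub>R \<xi>) = 0") (auto simp: inv_fourier_correlation[OF K \<psi>])
  then show ?thesis by (simp only: lp_block_def dist_inv_fourier_def dist_mult_def)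
qed

section \<open>Rearrangements and convolutions\<close>

lemma emeasure_lebesgue_borel: "A \<in> sets borel \<Longrightarrow> emeasure lebesgue A = emeasure lborel A"
  by simp

lemma rearrangement_le:
  "emeasure lebesgue {x. s < ennreal (norm (f x))} \<le> ennreal t \<Longrightarrow> rearrangement f t \<le> s"
  unfolding rearrangement_def by (rule Inf_lower) simp

lemma rearrangement_antimono: "s \<le> t \<Longrightarrow> rearrangement f t \<le> rearrangement f s"
  unfolding rearrangement_def
  by (rule Inf_superset_mono) (auto intro: order_trans ennreal_leI)

text \<open>With a strict inequality some competitor of the infimum lies below s, so the question
  whether the infimum is attained does not arise.\<close>

lemma rearrangement_lessD:
  fixes f :: "'a::euclidean_space \<Rightarrow> complex"
  assumes f: "f \<in> borel_measurable borel" and less: "rearrangement f t < s"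
  shows "emeasure lebesgue {x. s < ennreal (norm (f x))} \<le> ennreal t"
proof -
  note [measurable] = f
  obtain z where z: "z < s" "emeasure lebesgue {x. z < ennreal (norm (f x))} \<le> ennreal t"
    using less unfolding rearrangement_def Inf_less_iff by auto
  have m: "{x. z < ennreal (norm (f x))} \<in> sets borel" by measurable
  have "emeasure lebesgue {x. s < ennreal (norm (f x))} \<le> emeasure lebesgue {x. z < ennreal (norm (f x))}"
    using z(1) by (intro emeasure_mono) (auto simp: m)
  with z(2) show ?thesis by simp
qed

lemma rearrangement_measurable: "rearrangement f \<in> borel_measurable borel"
proof (rule borel_measurableI_less)
  fix y
  have "is_interval {t. rearrangement f t < y}"
    unfolding is_interval_1 using rearrangement_antimono[of _ _ f] by (auto intro: le_less_trans)
  then show "{x \<in> space borel. rearrangement f x < y} \<in> sets borel"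
    by (simp add: real_interval_borel_measurable)
qed

lemma rearrangement_cong_AE:
  fixes f g :: "'a::euclidean_space \<Rightarrow> complex"
  assumes f: "f \<in> borel_measurable lebesgue" and g: "g \<in> borel_measurable lebesgue"
    and ae: "AE x in lebesgue. f x = g x"
  shows "rearrangement f = rearrangement g"
proof -
  have "emeasure lebesgue {x. s < ennreal (norm (f x))} = emeasure lebesgue {x. s < ennreal (norm (g x))}" for s
  proof (rule emeasure_eq_AE)
    show "AE x in lebesgue. x \<in> {x. s < ennreal (norm (f x))} \<longleftrightarrow> x \<in> {x. s < ennreal (norm (g x))}"
      using ae by eventually_elim auto
    have "{x \<in> space lebesgue. s < ennreal (norm (f x))} \<in> sets lebesgue" using f by measurable
    then show "{x. s < ennreal (norm (f x))} \<in> sets lebesgue" by simp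
    have "{x \<in> space lebesgue. s < ennreal (norm (g x))} \<in> sets lebesgue" using g by measurable
    then show "{x. s < ennreal (norm (g x))} \<in> sets lebesgue" by simp
  qed
  then show ?thesis by (simp add: rearrangement_def fun_eq_iff)
qed

lemma rearrangement_le_integral:
  assumes t: "0 < t"
  shows "rearrangement f t * ennreal t \<le> (\<integral>\<^sup>+s. rearrangement f s * indicator {0<..t} s \<partial>lborel)"
proof -
  have "rearrangement f t * ennreal t = (\<integral>\<^sup>+s. rearrangement f t * indicator {0<..t} s \<partial>lborel)"
    using t by (simp add: nn_integral_cmult)
  also have "\<dots> \<le> (\<integral>\<^sup>+s. rearrangement f s * indicator {0<..t} s \<partial>lborel)"
    by (intro nn_integral_mono) (auto simp: indicator_def intro: rearrangement_antimono)
  finally show ?thesis .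
qed

text \<open>Layer cake: both sides are integrals over the level \<open>\<lambda>\<close> of the distribution function \<open>D\<close>,
  truncated at \<open>t\<close> on the right-hand side.\<close>

lemma integral_superlevel_le_rearrangement:
  fixes g :: "'a::euclidean_space \<Rightarrow> complex"
  assumes g[measurable]: "g \<in> borel_measurable borel" and t: "0 < t"
    and E[measurable]: "E \<in> sets borel" and Et: "emeasure lborel E \<le> ennreal t"
  shows "(\<integral>\<^sup>+x. ennreal (norm (g x)) * indicator E x \<partial>lborel)
       \<le> (\<integral>\<^sup>+s. rearrangement g s * indicator {0<..t} s \<partial>lborel)"
proof -
  define D where "D l = emeasure lborel {x. l < norm (g x)}" for l :: real
  have D_meas[measurable]: "D \<in> borel_measurable borel"
  proof -
    have "{p \<in> space (borel \<Otimes>\<^sub>M lborel). fst p < norm (g (snd p))} \<in> sets (borel \<Otimes>\<^sub>M lborel)" by measurable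
    from lborel.measurable_emeasure_Pair[OF this]
    show ?thesis by (simp add: D_def[abs_def] vimage_def space_pair_measure)
  qed
  \<comment> \<open>One half of the inversion between distribution function and rearrangement; it
    moves the comparison from levels l back to s at the end.\<close>
  have D_le: "ennreal l \<le> rearrangement g s" if "ennreal s < D l" "0 \<le> l" for l s
    unfolding rearrangement_def
  proof (rule Inf_greatest)
    fix z assume z: "z \<in> {z. emeasure lebesgue {x. z < ennreal (norm (g x))} \<le> ennreal s}"
    show "ennreal l \<le> z"
    proof (rule ccontr)
      assume "\<not> ennreal l \<le> z"
      then have "z < ennreal l" by simp
      then have "D l \<le> emeasure lborel {x. z < ennreal (norm (g x))}"
        unfolding D_def by (intro emeasure_mono) (auto intro: less_le_trans ennreal_leI less_imp_le)
      also have "\<dots> \<le> ennreal s" using z by simp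
      finally show False using that(1) by simp
    qed
  qed
  have "(\<integral>\<^sup>+x. ennreal (norm (g x)) * indicator E x \<partial>lborel)
      = (\<integral>\<^sup>+x. (\<integral>\<^sup>+l. indicator {p. 0 \<le> snd p \<and> snd p < norm (g (fst p)) \<and> fst p \<in> E} (x, l) \<partial>lborel) \<partial>lborel)"
  proof (rule nn_integral_cong)
    fix x
    have "(\<integral>\<^sup>+l. indicator {p. 0 \<le> snd p \<and> snd p < norm (g (fst p)) \<and> fst p \<in> E} (x, l) \<partial>lborel)
        = (\<integral>\<^sup>+l. indicator E x * indicator {0..<norm (g x)} l \<partial>lborel)"
      by (intro nn_integral_cong) (auto simp: indicator_def)
    also have "\<dots> = ennreal (norm (g x)) * indicator E x"
      by (simp add: nn_integral_cmult mult.commute)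
    finally show "ennreal (norm (g x)) * indicator E x
      = (\<integral>\<^sup>+l. indicator {p. 0 \<le> snd p \<and> snd p < norm (g (fst p)) \<and> fst p \<in> E} (x, l) \<partial>lborel)" by simp
  qed
  also have "\<dots> = (\<integral>\<^sup>+l. (\<integral>\<^sup>+x. indicator {p. 0 \<le> snd p \<and> snd p < norm (g (fst p)) \<and> fst p \<in> E} (x, l) \<partial>lborel) \<partial>lborel)"
    by (rule lborel_pair.Fubini'[symmetric]) measurable
  also have "\<dots> \<le> (\<integral>\<^sup>+l. (\<integral>\<^sup>+s. indicator {p. 0 \<le> snd p \<and> 0 < fst p \<and> fst p \<le> t \<and> ennreal (fst p) < D (snd p)} (s, l) \<partial>lborel) \<partial>lborel)"
  proof (rule nn_integral_mono)
    fix l :: real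
    show "(\<integral>\<^sup>+x. indicator {p. 0 \<le> snd p \<and> snd p < norm (g (fst p)) \<and> fst p \<in> E} (x, l) \<partial>lborel)
       \<le> (\<integral>\<^sup>+s. indicator {p. 0 \<le> snd p \<and> 0 < fst p \<and> fst p \<le> t \<and> ennreal (fst p) < D (snd p)} (s, l) \<partial>lborel)"
    proof (cases "0 \<le> l")
      case True
      have "(\<integral>\<^sup>+x. indicator {p. 0 \<le> snd p \<and> snd p < norm (g (fst p)) \<and> fst p \<in> E} (x, l) \<partial>lborel)
          = (\<integral>\<^sup>+x. indicator ({x. l < norm (g x)} \<inter> E) x \<partial>lborel)"
        using True by (intro nn_integral_cong) (auto simp: indicator_def)
      also have "\<dots> = emeasure lborel ({x. l < norm (g x)} \<inter> E)" by (subst nn_integral_indicator) auto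
      also have "\<dots> \<le> min (D l) (ennreal t)"
        unfolding D_def using Et by (auto intro!: emeasure_mono order_trans[OF emeasure_mono Et])
      \<comment> \<open>The points s of (0, t] below \<open>D l\<close> fill an interval of length
        at least min (D l) t, which bounds the measure of the level set inside E.\<close>
      also have "\<dots> \<le> (\<integral>\<^sup>+s. indicator {p. 0 \<le> snd p \<and> 0 < fst p \<and> fst p \<le> t \<and> ennreal (fst p) < D (snd p)} (s, l) \<partial>lborel)"
      proof -
        have "min (D l) (ennreal t) < \<infinity>" by (rule le_less_trans[OF min.cobounded2]) simp
        then obtain m where m: "min (D l) (ennreal t) = ennreal m" "0 \<le> m"
          by (cases "min (D l) (ennreal t)") auto
        have mt: "m \<le> t" using m t by (metis ennreal_le_iff less_imp_le min.cobounded2)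
        have mD: "ennreal m \<le> D l" using m by (metis min.cobounded1)
        have "ennreal m = (\<integral>\<^sup>+s. indicator {0<..<m} s \<partial>lborel)" using m(2) by simp
        also have "\<dots> \<le> (\<integral>\<^sup>+s. indicator {p. 0 \<le> snd p \<and> 0 < fst p \<and> fst p \<le> t \<and> ennreal (fst p) < D (snd p)} (s, l) \<partial>lborel)"
        proof (rule nn_integral_mono)
          fix s :: real
          have "ennreal s < D l" if "0 < s" "s < m"
            using that mD by (intro less_le_trans[OF _ mD] ennreal_lessI) auto
          then show "indicator {0<..<m} s \<le> (indicator {p. 0 \<le> snd p \<and> 0 < fst p \<and> fst p \<le> t \<and> ennreal (fst p) < D (snd p)} (s, l) :: ennreal)"
            using True mt by (auto simp: indicator_def)
        qed
        finally show ?thesis by (simp add: m)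
      qed
      finally show ?thesis .
    qed (simp add: indicator_def)
  qed
  also have "\<dots> = (\<integral>\<^sup>+s. (\<integral>\<^sup>+l. indicator {p. 0 \<le> snd p \<and> 0 < fst p \<and> fst p \<le> t \<and> ennreal (fst p) < D (snd p)} (s, l) \<partial>lborel) \<partial>lborel)"
    by (rule lborel_pair.Fubini') measurable
  also have "\<dots> \<le> (\<integral>\<^sup>+s. rearrangement g s * indicator {0<..t} s \<partial>lborel)"
  proof (rule nn_integral_mono)
    fix s :: real
    show "(\<integral>\<^sup>+l. indicator {p. 0 \<le> snd p \<and> 0 < fst p \<and> fst p \<le> t \<and> ennreal (fst p) < D (snd p)} (s, l) \<partial>lborel)
        \<le> rearrangement g s * indicator {0<..t} s"
    proof (cases "s \<in> {0<..t} \<and> rearrangement g s \<noteq> \<infinity>")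
      case True
      then obtain r where r: "rearrangement g s = ennreal r" "0 \<le> r" by (cases "rearrangement g s") auto
      have "(\<integral>\<^sup>+l. indicator {p. 0 \<le> snd p \<and> 0 < fst p \<and> fst p \<le> t \<and> ennreal (fst p) < D (snd p)} (s, l) \<partial>lborel)
         \<le> (\<integral>\<^sup>+l. indicator {0..r} l \<partial>lborel)"
        using D_le[of s] r by (intro nn_integral_mono) (auto simp: indicator_def)
      also have "\<dots> = ennreal r" using r(2) by simp
      finally show ?thesis using True r by simp
    next
      case False
      then show ?thesis by (auto simp: indicator_def)
    qed
  qed
  finally show ?thesis .
qed

text \<open>Split g into \<open>h\<close>, its part above 2M, and a rest bounded by 2M. The rest
  contributes at most 2cM through the mass of \<kappa>. The part \<open>h\<close> lives on a set of
  measure at most t and so has mass at most Mt. It contributes at most cM everywhere if \<kappa> has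
  height c/t, and at most cM off a set of measure t by Markov's inequality in general. Both
  conclusions share the constant 3 = 1 + 2.\<close>

lemma convolution_bounds:
  fixes g :: "'a::euclidean_space \<Rightarrow> complex" and \<kappa> :: "'a \<Rightarrow> ennreal"
  assumes g[measurable]: "g \<in> borel_measurable borel" and \<kappa>[measurable]: "\<kappa> \<in> borel_measurable borel"
    and t: "0 < t" and M: "0 < M"
    and avg: "(\<integral>\<^sup>+s. rearrangement g s * indicator {0<..t} s \<partial>lborel) \<le> ennreal (M * t)"
    and c: "0 < c" and \<kappa>1: "(\<integral>\<^sup>+x. \<kappa> x \<partial>lborel) \<le> ennreal c"
  defines "G \<equiv> (\<lambda>x. \<integral>\<^sup>+y. \<kappa> (x - y) * ennreal (norm (g y)) \<partial>lborel)"
  shows "\<And>x. (\<And>z. \<kappa> z \<le> ennreal (c / t)) \<Longrightarrow> G x \<le> ennreal (3 * c * M)"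
    and "emeasure lborel {x. ennreal (3 * c * M) < G x} \<le> ennreal t"
proof -
  have "rearrangement g t * ennreal t \<le> ennreal M * ennreal t"
    using order_trans[OF rearrangement_le_integral[OF t] avg] M t by (simp add: ennreal_mult)
  then have "rearrangement g t \<le> ennreal M"
    using t by (subst (asm) (1 2) mult.commute) (simp add: ennreal_mult_le_mult_iff)
  \<comment> \<open>Cutting at 2M instead of M supplies the strict inequality that
    \<open>rearrangement_lessD\<close> asks for, even when the rearrangement at t equals M.\<close>
  also have "ennreal M < ennreal (2 * M)" using M by (simp add: ennreal_less_iff)
  finally have r: "rearrangement g t < ennreal (2 * M)" .
  define E where "E = {x. ennreal (2 * M) < ennreal (norm (g x))}"
  have E[measurable]: "E \<in> sets borel" unfolding E_def by measurable
  have Et: "emeasure lborel E \<le> ennreal t"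
    using rearrangement_lessD[OF g r] E by (simp add: E_def)
  define h where "h x = ennreal (norm (g x)) * indicator E x" for x
  have [measurable]: "h \<in> borel_measurable borel" unfolding h_def by measurable
  have hI: "(\<integral>\<^sup>+x. h x \<partial>lborel) \<le> ennreal (M * t)"
    unfolding h_def using integral_superlevel_le_rearrangement[OF g t E Et] avg by (rule order_trans)
  define G1 where "G1 x = (\<integral>\<^sup>+y. \<kappa> (x - y) * h y \<partial>lborel)" for x
  have [measurable]: "G1 \<in> borel_measurable borel" unfolding G1_def by measurable
  have GG1: "G x \<le> G1 x + ennreal (2 * c * M)" for x
  proof -
    have "G x \<le> (\<integral>\<^sup>+y. \<kappa> (x - y) * h y + \<kappa> (x - y) * ennreal (2 * M) \<partial>lborel)"
      unfolding G_def
    proof (rule nn_integral_mono)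
      fix y
      have "ennreal (norm (g y)) \<le> h y + ennreal (2 * M)"
        by (auto simp: h_def E_def indicator_def not_less)
      then have "\<kappa> (x - y) * ennreal (norm (g y)) \<le> \<kappa> (x - y) * (h y + ennreal (2 * M))"
        by (rule mult_left_mono) simp
      then show "\<kappa> (x - y) * ennreal (norm (g y)) \<le> \<kappa> (x - y) * h y + \<kappa> (x - y) * ennreal (2 * M)"
        by (simp add: distrib_left)
    qed
    also have "\<dots> = G1 x + (\<integral>\<^sup>+y. \<kappa> (x - y) \<partial>lborel) * ennreal (2 * M)"
      by (simp add: nn_integral_add nn_integral_multc G1_def)
    also have "(\<integral>\<^sup>+y. \<kappa> (x - y) \<partial>lborel) = (\<integral>\<^sup>+y. \<kappa> y \<partial>lborel)"
      by (rule lborel_nn_integral_reflect) measurable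
    also have "G1 x + (\<integral>\<^sup>+y. \<kappa> y \<partial>lborel) * ennreal (2 * M) \<le> G1 x + ennreal c * ennreal (2 * M)"
      by (intro add_left_mono mult_right_mono \<kappa>1) simp
    also have "\<dots> = G1 x + ennreal (2 * c * M)" using c M by (simp add: mult_ac flip: ennreal_mult)
    finally show ?thesis .
  qed
  show "G x \<le> ennreal (3 * c * M)" if \<kappa>b: "\<And>z. \<kappa> z \<le> ennreal (c / t)" for x
  proof -
    have "G1 x \<le> (\<integral>\<^sup>+y. ennreal (c / t) * h y \<partial>lborel)"
      unfolding G1_def by (intro nn_integral_mono mult_right_mono \<kappa>b) simp
    also have "\<dots> = ennreal (c / t) * (\<integral>\<^sup>+y. h y \<partial>lborel)" by (simp add: nn_integral_cmult)
    also have "\<dots> \<le> ennreal (c / t) * ennreal (M * t)" by (intro mult_left_mono hI) simp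
    also have "\<dots> = ennreal (c * M)" using c M t by (simp flip: ennreal_mult)
    finally have "G1 x + ennreal (2 * c * M) \<le> ennreal (c * M) + ennreal (2 * c * M)" by (rule add_right_mono)
    also have "\<dots> = ennreal (3 * c * M)" using c M by (simp flip: ennreal_plus)
    finally show ?thesis using GG1[of x] by (rule order_trans[rotated])
  qed
  have "(\<integral>\<^sup>+x. G1 x \<partial>lborel) = (\<integral>\<^sup>+y. (\<integral>\<^sup>+x. \<kappa> (x - y) * h y \<partial>lborel) \<partial>lborel)"
    unfolding G1_def by (rule lborel_pair.Fubini') measurable
  also have "\<dots> = (\<integral>\<^sup>+y. (\<integral>\<^sup>+x. \<kappa> x \<partial>lborel) * h y \<partial>lborel)"
  proof (rule nn_integral_cong)
    fix y
    have "(\<integral>\<^sup>+x. \<kappa> (- y + x) \<partial>lborel) = (\<integral>\<^sup>+x. \<kappa> x \<partial>lborel)"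
      using lborel_nn_integral_affine[OF \<kappa>, of 1 "- y"] by simp
    then show "(\<integral>\<^sup>+x. \<kappa> (x - y) * h y \<partial>lborel) = (\<integral>\<^sup>+x. \<kappa> x \<partial>lborel) * h y"
      by (simp add: nn_integral_multc)
  qed
  also have "\<dots> = (\<integral>\<^sup>+x. \<kappa> x \<partial>lborel) * (\<integral>\<^sup>+y. h y \<partial>lborel)" by (simp add: nn_integral_cmult)
  also have "\<dots> \<le> ennreal c * ennreal (M * t)" by (intro mult_mono \<kappa>1 hI) auto
  finally have G1I: "(\<integral>\<^sup>+x. G1 x \<partial>lborel) \<le> ennreal c * ennreal (M * t)" .
  \<comment> \<open>Where G exceeds 3cM, the contribution \<open>G1\<close> of \<open>h\<close>
    alone is at least cM; its total mass is at most c M t.\<close>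
  have "emeasure lborel {x. ennreal (3 * c * M) < G x} \<le> emeasure lborel {x \<in> UNIV. 1 \<le> ennreal (1 / (c * M)) * G1 x}"
  proof (rule emeasure_mono)
    show "{x. ennreal (3 * c * M) < G x} \<subseteq> {x \<in> UNIV. 1 \<le> ennreal (1 / (c * M)) * G1 x}"
    proof clarsimp
      fix x assume "ennreal (3 * c * M) < G x"
      moreover have "ennreal (3 * c * M) = ennreal (c * M) + ennreal (2 * c * M)"
        using c M by (subst ennreal_plus[symmetric]) (auto simp: algebra_simps)
      ultimately have "ennreal (c * M) + ennreal (2 * c * M) < G1 x + ennreal (2 * c * M)"
        using less_le_trans[OF _ GG1[of x]] by metis
      then have "ennreal (c * M) \<le> G1 x" by (meson add_right_mono linorder_not_le order_less_imp_le)
      then have "ennreal (1 / (c * M)) * ennreal (c * M) \<le> ennreal (1 / (c * M)) * G1 x"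
        by (rule mult_left_mono) simp
      moreover have "ennreal (1 / (c * M)) * ennreal (c * M) = 1" using c M by (simp flip: ennreal_mult)
      ultimately show "1 \<le> ennreal (1 / (c * M)) * G1 x" by simp
    qed
  qed measurable
  also have "\<dots> \<le> ennreal (1 / (c * M)) * (\<integral>\<^sup>+x. G1 x * indicator UNIV x \<partial>lborel)"
    by (rule nn_integral_Markov_inequality) auto
  also have "\<dots> \<le> ennreal (1 / (c * M)) * (ennreal c * ennreal (M * t))"
    using G1I by (intro mult_left_mono) auto
  also have "\<dots> = ennreal t" using c M t by (simp flip: ennreal_mult)
  finally show "emeasure lborel {x. ennreal (3 * c * M) < G x} \<le> ennreal t" .
qed

section \<open>Broken logarithms\<close>

lemma broken_log_pos: "0 < broken_log A t"
  unfolding broken_log_def by (simp add: add_pos_nonneg less_imp_neq[symmetric])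

lemma broken_log_add: "broken_log (A + B) t = broken_log A t * broken_log B t"
  by (simp add: broken_log_def powr_add)

lemma broken_log_minus: "broken_log (- A) t = 1 / broken_log A t"
  by (simp add: broken_log_def powr_minus_divide)

lemma broken_log_diff: "broken_log (A - B) t = broken_log A t / broken_log B t"
  using broken_log_add[of A "- B" t] by (simp add: broken_log_minus)

lemma broken_log_shift: "broken_log (pair_shift A s) t = broken_log A t * (1 + \<bar>ln t\<bar>) powr s"
  by (simp add: broken_log_def pair_shift_def powr_add)

lemma broken_log_powr: "broken_log A t powr p = broken_log (fst A * p, snd A * p) t"
  by (simp add: broken_log_def powr_powr)

lemma broken_log_measurable [measurable]: "broken_log A \<in> borel_measurable borel"
  unfolding broken_log_def[abs_def] by measurable

text \<open>The inequality 1 + |x + y| \<le> (1 + |x|) (1 + |y|) compares equal powers of the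
  logarithm at s and t. If 1 separates s from t, the exponents differ, but then |ln s| and |ln t|
  are both at most |ln (t/s)|, so each factor is controlled on its own; this costs the sum of both
  exponents.\<close>

lemma broken_log_ratio:
  assumes s: "0 < s" and t: "0 < t"
  shows "broken_log A t \<le> broken_log A s * (1 + \<bar>ln (t / s)\<bar>) powr (\<bar>fst A\<bar> + \<bar>snd A\<bar>)"
proof -
  define R where "R = 1 + \<bar>ln (t / s)\<bar>"
  define a where "a = \<bar>fst A\<bar> + \<bar>snd A\<bar>"
  have R: "1 \<le> R" by (simp add: R_def)
  have ln: "ln (t / s) = ln t - ln s" using s t by (simp add: ln_div)
  have bern: "1 + \<bar>x + y\<bar> \<le> (1 + \<bar>x\<bar>) * (1 + \<bar>y\<bar>)" for x y :: real
  proof -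
    have "1 + \<bar>x + y\<bar> \<le> 1 + (\<bar>x\<bar> + \<bar>y\<bar>)" by (simp add: abs_triangle_ineq)
    also have "\<dots> \<le> (1 + \<bar>x\<bar>) * (1 + \<bar>y\<bar>)" by (simp add: algebra_simps)
    finally show ?thesis .
  qed
  have st: "1 + \<bar>ln t\<bar> \<le> (1 + \<bar>ln s\<bar>) * R" "1 + \<bar>ln s\<bar> \<le> (1 + \<bar>ln t\<bar>) * R"
    using bern[of "ln s" "ln t - ln s"] bern[of "ln t" "ln s - ln t"] by (simp_all add: R_def ln abs_minus_commute)
  have Ra: "R powr \<bar>e\<bar> \<le> R powr a" if "\<bar>e\<bar> \<le> a" for e using that R by (intro powr_mono) simp_all
  have same: "(1 + \<bar>ln t\<bar>) powr e \<le> (1 + \<bar>ln s\<bar>) powr e * R powr \<bar>e\<bar>" for e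
  proof (cases "e \<ge> 0")
    case True
    have "(1 + \<bar>ln t\<bar>) powr e \<le> ((1 + \<bar>ln s\<bar>) * R) powr e" using True st(1) by (intro powr_mono2) auto
    also have "\<dots> = (1 + \<bar>ln s\<bar>) powr e * R powr e" by (rule powr_mult)
    finally show ?thesis using True by simp
  next
    case False
    have "((1 + \<bar>ln t\<bar>) * R) powr e \<le> (1 + \<bar>ln s\<bar>) powr e" using False by (intro powr_mono2' st(2)) (simp_all add: add_pos_nonneg)
    then have "(1 + \<bar>ln t\<bar>) powr e * R powr e \<le> (1 + \<bar>ln s\<bar>) powr e" using R by (simp add: powr_mult)
    then have "(1 + \<bar>ln t\<bar>) powr e * R powr e * R powr (-e) \<le> (1 + \<bar>ln s\<bar>) powr e * R powr (-e)"
      by (rule mult_right_mono) simp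
    moreover have "R powr e * R powr (-e) = 1" using R by (simp add: powr_minus)
    ultimately show ?thesis using False by (simp only: mult.assoc mult_1_right abs_of_neg not_le)
  qed
  have diff: "(1 + \<bar>ln t\<bar>) powr e \<le> (1 + \<bar>ln s\<bar>) powr e' * R powr (\<bar>e\<bar> + \<bar>e'\<bar>)"
    if le: "\<bar>ln t\<bar> \<le> \<bar>ln (t / s)\<bar>" "\<bar>ln s\<bar> \<le> \<bar>ln (t / s)\<bar>" for e e'
  proof -
    have "(1 + \<bar>ln t\<bar>) powr e \<le> (1 + \<bar>ln t\<bar>) powr \<bar>e\<bar>" by (intro powr_mono) simp_all
    also have "\<dots> \<le> R powr \<bar>e\<bar>" using le by (intro powr_mono2) (auto simp: R_def)
    finally have 1: "(1 + \<bar>ln t\<bar>) powr e \<le> R powr \<bar>e\<bar>" .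
    have "1 = R powr (- \<bar>e'\<bar>) * R powr \<bar>e'\<bar>" using R by (simp add: powr_minus)
    also have "\<dots> \<le> (1 + \<bar>ln s\<bar>) powr (- \<bar>e'\<bar>) * R powr \<bar>e'\<bar>"
      using le by (intro mult_right_mono powr_mono2') (auto simp: R_def)
    also have "\<dots> \<le> (1 + \<bar>ln s\<bar>) powr e' * R powr \<bar>e'\<bar>" by (intro mult_right_mono powr_mono) auto
    finally have 2: "1 \<le> (1 + \<bar>ln s\<bar>) powr e' * R powr \<bar>e'\<bar>" .
    have "(1 + \<bar>ln t\<bar>) powr e * 1 \<le> R powr \<bar>e\<bar> * ((1 + \<bar>ln s\<bar>) powr e' * R powr \<bar>e'\<bar>)"
      by (intro mult_mono 1 2) auto
    then show ?thesis by (simp add: powr_add mult_ac)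
  qed
  consider "t \<le> 1 \<longleftrightarrow> s \<le> 1" | "t \<le> 1" "s > 1" | "t > 1" "s \<le> 1" by linarith
  then have "broken_log A t \<le> broken_log A s * R powr a"
  proof cases
    case 1
    have "(1 + \<bar>ln s\<bar>) powr e * R powr \<bar>e\<bar> \<le> (1 + \<bar>ln s\<bar>) powr e * R powr a" if "\<bar>e\<bar> \<le> a" for e
      using Ra[OF that] by (intro mult_left_mono) auto
    from order_trans[OF same this] show ?thesis
      using 1 by (cases "t \<le> 1") (auto simp: broken_log_def a_def)
  next
    case 2
    have "ln t \<le> 0" "ln s > 0" using 2 t by auto
    then have "\<bar>ln t\<bar> \<le> \<bar>ln (t / s)\<bar>" "\<bar>ln s\<bar> \<le> \<bar>ln (t / s)\<bar>" unfolding ln by linarith+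
    from diff[OF this, of "fst A" "snd A"] 2 show ?thesis by (simp add: broken_log_def a_def)
  next
    case 3
    have "ln t > 0" "ln s \<le> 0" using 3 s by auto
    then have "\<bar>ln t\<bar> \<le> \<bar>ln (t / s)\<bar>" "\<bar>ln s\<bar> \<le> \<bar>ln (t / s)\<bar>" unfolding ln by linarith+
    from diff[OF this, of "snd A" "fst A"] 3 show ?thesis by (simp add: broken_log_def a_def add.commute)
  qed
  then show ?thesis by (simp add: R_def a_def)
qed

lemma powr_le_exp:
  fixes a \<epsilon> :: real
  assumes "0 \<le> a" "0 < \<epsilon>"
  obtains C where "0 < C" "\<And>y. 0 \<le> y \<Longrightarrow> (1 + y) powr a \<le> C * exp (\<epsilon> * y)"
proof -
  \<comment> \<open>Passing from a to a + 1 keeps the divisor in \<epsilon>/b positive when a =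
    0.\<close>
  define b where "b = a + 1"
  have b: "0 < b" using assms by (simp add: b_def)
  define k where "k = max 1 (b / \<epsilon>)"
  have k: "0 < k" by (simp add: k_def)
  show ?thesis
  proof (rule that)
    show "0 < k powr b" using k by simp
    fix y :: real assume y: "0 \<le> y"
    have "1 * 1 + (b / \<epsilon>) * (\<epsilon> / b * y) \<le> k * 1 + k * (\<epsilon> / b * y)"
      using b assms y by (intro add_mono mult_right_mono) (auto simp: k_def)
    then have "1 + y \<le> k * (1 + \<epsilon> / b * y)"
      using b assms by (simp add: distrib_left)
    also have "\<dots> \<le> k * exp (\<epsilon> / b * y)"
      using k exp_ge_add_one_self[of "\<epsilon> / b * y"] by (intro mult_left_mono) auto
    finally have 1: "1 + y \<le> k * exp (\<epsilon> / b * y)" .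
    have "(1 + y) powr a \<le> (1 + y) powr b" using y by (intro powr_mono) (auto simp: b_def)
    also have "\<dots> \<le> (k * exp (\<epsilon> / b * y)) powr b" using 1 y b by (intro powr_mono2) auto
    also have "\<dots> = k powr b * exp (\<epsilon> * y)" using k b by (simp add: powr_mult exp_powr_real)
    finally show "(1 + y) powr a \<le> k powr b * exp (\<epsilon> * y)" .
  qed
qed

text \<open>Broken logarithms vary more slowly than any power, upwards and downwards: the cost in
  \<open>broken_log_ratio\<close> is a power of 1 + |ln (t/s)|, while (t/s)^\<epsilon> is
  exponential in the same quantity. Later proofs use this to trade a logarithm for a small part of
  an available power.\<close>

lemma broken_log_growth:
  assumes \<epsilon>: "0 < \<epsilon>"
  obtains C where "0 < C"
    "\<And>s t. 0 < s \<Longrightarrow> s \<le> t \<Longrightarrow> broken_log A t \<le> C * broken_log A s * (t / s) powr \<epsilon>"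
    "\<And>s t. 0 < s \<Longrightarrow> s \<le> t \<Longrightarrow> broken_log A s \<le> C * broken_log A t * (t / s) powr \<epsilon>"
proof -
  obtain C where C: "0 < C" "\<And>y. 0 \<le> y \<Longrightarrow> (1 + y) powr (\<bar>fst A\<bar> + \<bar>snd A\<bar>) \<le> C * exp (\<epsilon> * y)"
    using powr_le_exp[of "\<bar>fst A\<bar> + \<bar>snd A\<bar>" \<epsilon>] \<epsilon> by auto
  have main: "broken_log A t \<le> C * broken_log A s * exp (\<epsilon> * \<bar>ln (t / s)\<bar>)" if "0 < s" "0 < t" for s t
  proof -
    have "broken_log A t \<le> broken_log A s * (1 + \<bar>ln (t / s)\<bar>) powr (\<bar>fst A\<bar> + \<bar>snd A\<bar>)"
      by (rule broken_log_ratio[OF that])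
    also have "\<dots> \<le> broken_log A s * (C * exp (\<epsilon> * \<bar>ln (t / s)\<bar>))"
      by (intro mult_left_mono C less_imp_le[OF broken_log_pos]) simp
    finally show ?thesis by (simp add: mult_ac)
  qed
  have e: "exp (\<epsilon> * \<bar>ln (t / s)\<bar>) = (t / s) powr \<epsilon>" "exp (\<epsilon> * \<bar>ln (s / t)\<bar>) = (t / s) powr \<epsilon>" if "0 < s" "s \<le> t" for s t
    using that by (simp_all add: powr_def ln_div)
  show ?thesis
  proof (rule that[OF C(1)])
    fix s t :: real assume st: "0 < s" "s \<le> t"
    show "broken_log A t \<le> C * broken_log A s * (t / s) powr \<epsilon>" using main[of s t] e(1)[OF st] st by simp
    show "broken_log A s \<le> C * broken_log A t * (t / s) powr \<epsilon>" using main[of t s] e(2)[OF st] st by simp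
  qed
qed

section \<open>Extended powers and power integrals\<close>

lemma ennpowr_ennreal: "0 \<le> a \<Longrightarrow> ennpowr (ennreal a) r = ennreal (a powr r)"
  by (simp add: ennpowr_def)

lemma ennpowr_mono: "0 < r \<Longrightarrow> x \<le> y \<Longrightarrow> ennpowr x r \<le> ennpowr y r"
  by (cases x; cases y) (auto simp: ennpowr_def top_unique intro!: ennreal_leI powr_mono2)

lemma ennpowr_inverse: "0 < r \<Longrightarrow> ennpowr (ennpowr x r) (1 / r) = x" "0 < r \<Longrightarrow> ennpowr (ennpowr x (1 / r)) r = x"
  by (cases x; simp add: ennpowr_def powr_powr)+

lemma ennpowr_mult: "0 < r \<Longrightarrow> ennpowr (x * y) r = ennpowr x r * ennpowr y r"
  by (cases x; cases y)
    (auto simp: ennpowr_def powr_mult ennreal_top_mult ennreal_mult_top simp flip: ennreal_mult)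

lemma ennpowr_le_iff: "0 < r \<Longrightarrow> ennpowr x r \<le> ennpowr y r \<longleftrightarrow> x \<le> y"
  by (metis ennpowr_inverse(1) ennpowr_mono zero_less_divide_1_iff)

lemma recip_ennreal: "0 < p \<Longrightarrow> recip (ennreal p) = 1 / p"
  by (simp add: recip_def divide_ennreal flip: ennreal_1)

lemma recip_infinity [simp]: "recip \<infinity> = 0" "recip top = 0"
  by (simp_all add: recip_def)

lemma nn_integral_lebesgue_on_half_line:
  "(\<integral>\<^sup>+t. h t \<partial>lebesgue_on {0::real<..}) = (\<integral>\<^sup>+t. h t * indicator {0<..} t \<partial>lborel)"
proof -
  have "{0::real<..} \<inter> space lebesgue \<in> sets lebesgue" by simp
  from nn_integral_restrict_space[OF this, of h] show ?thesis by (simp only: nn_integral_completion)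
qed

lemma nn_integral_powr_from_0:
  assumes "-1 < a" "0 \<le> t"
  shows "(\<integral>\<^sup>+s. ennreal (s powr a) * indicator {0<..t} s \<partial>lborel) = ennreal (t powr (a + 1) / (a + 1))"
proof -
  have "(\<integral>\<^sup>+s. ennreal (s powr a) * indicator {0<..t} s \<partial>lborel) = (\<integral>\<^sup>+s. ennreal (indicator {0..t} s * s powr a) \<partial>lborel)"
  proof (rule nn_integral_cong_AE)
    have "AE s in lborel. s \<noteq> (0::real)" by (rule AE_lborel_singleton)
    then show "AE s in lborel. ennreal (s powr a) * indicator {0<..t} s = ennreal (indicator {0..t} s * s powr a)"
      by eventually_elim (auto simp: indicator_def)
  qed
  also have "\<dots> = ennreal (t powr (a + 1) / (a + 1))"
    by (rule nn_integral_has_integral_lebesgue) (auto intro: has_integral_powr_from_0 assms)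
  finally show ?thesis .
qed

lemma nn_integral_powr_to_inf:
  assumes "a < -1" "0 < r"
  shows "(\<integral>\<^sup>+s. ennreal (s powr a) * indicator {r<..} s \<partial>lborel) \<le> ennreal (- (r powr (a + 1)) / (a + 1))"
proof -
  have "(\<integral>\<^sup>+s. ennreal (s powr a) * indicator {r<..} s \<partial>lborel) \<le> (\<integral>\<^sup>+s. ennreal (indicator {r..} s * s powr a) \<partial>lborel)"
    by (intro nn_integral_mono) (auto simp: indicator_def)
  also have "\<dots> = ennreal (- (r powr (a + 1)) / (a + 1))"
    by (rule nn_integral_has_integral_lebesgue) (simp, rule has_integral_powr_to_inf[OF assms])
  finally show ?thesis .
qed

section \<open>Weak-type bounds from Lorentz--Zygmund quasi-norms\<close>

lemma exponent_cases:
  fixes b :: ennreal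
  assumes "0 < b"
  obtains "b = \<infinity>" | p where "b = ennreal p" "0 < p" "recip b = 1 / p" "enn2real b = p" "b \<noteq> \<infinity>"
proof (cases b)
  case (real p)
  then have "0 < p" using assms by simp
  then show ?thesis using that(2)[of p] real by (simp add: recip_ennreal)
next
  case top
  then show ?thesis using that(1) by simp
qed

lemma le_ennreal_divideI:
  assumes "0 < a" "0 \<le> N" "x * ennreal a \<le> ennreal N"
  shows "x \<le> ennreal (N / a)"
proof (cases x)
  case (real r)
  with assms have "r * a \<le> N" by (simp flip: ennreal_mult)
  with real assms show ?thesis by (simp add: ennreal_leI pos_le_divide_eq)
next
  case top
  with assms show ?thesis by (simp add: ennreal_top_mult top_unique)
qed

text \<open>For finite c the integral is restricted to (s/2, s], an interval of length s/2 on which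
  the rearrangement is at least its value at s and the weight is comparable to its value at s. For c
  = \<infinity> the essential supremum controls only almost every s, which accounts for the form of
  the conclusion.\<close>

lemma rearrangement_le_of_lz_qnorm:
  fixes q :: real and c :: ennreal
  assumes q: "0 < q" and c: "0 < c"
  obtains C where "0 < C"
    "\<And>(g :: 'a::euclidean_space \<Rightarrow> complex) N. 0 < N \<Longrightarrow> lz_qnorm (ennreal q) c B g < ennreal N \<Longrightarrow>
       AE s in lborel. 0 < s \<longrightarrow> rearrangement g s \<le> ennreal (C * N * (s powr (- 1 / q) / broken_log B s))"
  using c
proof (cases rule: exponent_cases)
  case 1
  show ?thesis
  proof (rule that[of 1])
    fix g :: "'a \<Rightarrow> complex" and N :: real assume N: "0 < N" and lz: "lz_qnorm (ennreal q) c B g < ennreal N"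
    define h where "h t = ennreal (t powr (1 / q) * broken_log B t) * rearrangement g t" for t
    have es: "esssup (lebesgue_on {0<..}) h < ennreal N"
      using lz q 1 by (simp add: lz_qnorm_def Lp_qnorm_def recip_ennreal h_def[abs_def])
    have "AE t in lebesgue_on {0<..}. h t \<le> esssup (lebesgue_on {0<..}) h" by (rule esssup_AE)
    then have "AE t in lebesgue. 0 < t \<longrightarrow> h t \<le> esssup (lebesgue_on {0<..}) h"
      by (subst (asm) AE_restrict_space_iff) auto
    then have "AE t in lborel. 0 < t \<longrightarrow> h t \<le> esssup (lebesgue_on {0<..}) h" by (simp add: AE_completion_iff)
    then show "AE s in lborel. 0 < s \<longrightarrow> rearrangement g s \<le> ennreal (1 * N * (s powr (- 1 / q) / broken_log B s))"
    proof eventually_elim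
      case (elim s)
      show ?case
      proof
        assume s: "0 < s"
        have "rearrangement g s * ennreal (s powr (1 / q) * broken_log B s) \<le> ennreal N"
          using elim s es by (auto simp: h_def mult.commute)
        then have "rearrangement g s \<le> ennreal (N / (s powr (1 / q) * broken_log B s))"
          using s N broken_log_pos[of B s] by (intro le_ennreal_divideI) auto
        then show "rearrangement g s \<le> ennreal (1 * N * (s powr (- 1 / q) / broken_log B s))"
          using s by (simp add: powr_minus divide_simps)
      qed
    qed
  qed simp
next
  case (2 p)
  define e where "e = 1 / q - 1 / p"
  obtain D where D: "0 < D" "\<And>s t. 0 < s \<Longrightarrow> s \<le> t \<Longrightarrow> broken_log B t \<le> D * broken_log B s * (t / s) powr 1"
    using broken_log_growth[of 1 B] by (metis zero_less_one)
  \<comment> \<open>The loss in comparing weights when s/t < 2: the power costs 2^|e| and the broken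
    logarithm 2D.\<close>
  define k where "k = 1 / (2 powr \<bar>e\<bar> * (2 * D))"
  have k: "0 < k" using D by (simp add: k_def)
  have lower: "k * (s powr e * broken_log B s) \<le> t powr e * broken_log B t" if t: "s / 2 < t" "t \<le> s" "0 < s" for s t
  proof -
    have t0: "0 < t" using t by simp
    have "s powr e = t powr e * (s / t) powr e" using t t0 by (simp add: powr_divide)
    also have "(s / t) powr e \<le> (s / t) powr \<bar>e\<bar>" using t t0 by (intro powr_mono) auto
    also have "(s / t) powr \<bar>e\<bar> \<le> 2 powr \<bar>e\<bar>" using t t0 by (intro powr_mono2) (auto simp: divide_le_eq)
    finally have 1: "s powr e \<le> t powr e * 2 powr \<bar>e\<bar>" by (simp add: mult_left_mono)
    have "broken_log B s \<le> D * broken_log B t * (s / t) powr 1" using t0 t by (intro D(2)) auto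
    also have "\<dots> \<le> D * broken_log B t * 2"
      using t t0 D(1) broken_log_pos[of B t] by (intro mult_left_mono) (auto simp: divide_le_eq)
    finally have 2: "broken_log B s \<le> D * broken_log B t * 2" .
    have "s powr e * broken_log B s \<le> (t powr e * 2 powr \<bar>e\<bar>) * (D * broken_log B t * 2)"
      using broken_log_pos[of B s] by (intro mult_mono 1 2) auto
    then have "k * (s powr e * broken_log B s) \<le> k * ((t powr e * 2 powr \<bar>e\<bar>) * (D * broken_log B t * 2))"
      using k by (intro mult_left_mono) auto
    also have "\<dots> = t powr e * broken_log B t" using D(1) by (simp add: k_def)
    finally show ?thesis .
  qed
  show ?thesis
  proof (rule that[of "2 powr (1 / p) / k"])
    show "0 < 2 powr (1 / p) / k" using k by simp
    fix g :: "'a \<Rightarrow> complex" and N :: real assume N: "0 < N" and lz: "lz_qnorm (ennreal q) c B g < ennreal N"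
    define h where "h t = ennreal (t powr e * broken_log B t) * rearrangement g t" for t
    define I where "I = (\<integral>\<^sup>+t. ennpowr (h t) p * indicator {0<..} t \<partial>lborel)"
    have "ennpowr I (1 / p) < ennreal N"
      using lz q 2 by (simp add: lz_qnorm_def Lp_qnorm_def recip_ennreal h_def I_def e_def nn_integral_lebesgue_on_half_line)
    then have "ennpowr (ennpowr I (1 / p)) p \<le> ennpowr (ennreal N) p" using 2 by (intro ennpowr_mono) auto
    then have IN: "I \<le> ennpowr (ennreal N) p" using 2 by (simp add: ennpowr_inverse)
    have "rearrangement g s \<le> ennreal (2 powr (1 / p) / k * N * (s powr (- 1 / q) / broken_log B s))" if s: "0 < s" for s
    proof -
      define X where "X = ennreal (k * (s powr e * broken_log B s)) * rearrangement g s"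
      have "ennpowr (X * ennreal ((s / 2) powr (1 / p))) p = ennpowr X p * ennreal (s / 2)"
        using s 2 by (simp add: ennpowr_mult ennpowr_ennreal powr_powr)
      also have "\<dots> = (\<integral>\<^sup>+t. ennpowr X p * indicator {s/2<..s} t \<partial>lborel)"
        using s by (simp add: nn_integral_cmult)
      also have "\<dots> \<le> I"
        unfolding I_def
      proof (rule nn_integral_mono)
        fix t :: real
        show "ennpowr X p * indicator {s/2<..s} t \<le> ennpowr (h t) p * indicator {0<..} t"
        proof (cases "t \<in> {s/2<..s}")
          case True
          then have "X \<le> h t"
            unfolding X_def h_def using s
            by (intro mult_mono ennreal_leI lower rearrangement_antimono) auto
          then show ?thesis using True s 2 by (auto simp: indicator_def intro: ennpowr_mono)
        qed (auto simp: indicator_def)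
      qed
      also note IN
      finally have "X * ennreal ((s / 2) powr (1 / p)) \<le> ennreal N" using 2 by (simp add: ennpowr_le_iff)
      then have "rearrangement g s * (ennreal (k * (s powr e * broken_log B s)) * ennreal ((s / 2) powr (1 / p))) \<le> ennreal N"
        by (simp add: X_def mult_ac)
      then have "rearrangement g s * ennreal (k * (s powr e * broken_log B s) * (s / 2) powr (1 / p)) \<le> ennreal N"
        using k broken_log_pos[of B s] by (subst ennreal_mult) auto
      then have "rearrangement g s \<le> ennreal (N / (k * (s powr e * broken_log B s) * (s / 2) powr (1 / p)))"
        using s k N broken_log_pos[of B s] by (intro le_ennreal_divideI) auto
      also have "N / (k * (s powr e * broken_log B s) * (s / 2) powr (1 / p)) = 2 powr (1 / p) / k * N * (s powr (- 1 / q) / broken_log B s)"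
      proof -
        have a: "s powr e * (s / 2) powr (1 / p) = s powr (1 / q) / 2 powr (1 / p)"
          using s by (simp add: powr_divide e_def powr_diff)
        have b: "s powr (- 1 / q) = 1 / s powr (1 / q)" using s by (simp add: powr_minus_divide)
        have "N / (k * (s powr e * broken_log B s) * (s / 2) powr (1 / p)) = N / (k * broken_log B s * (s powr e * (s / 2) powr (1 / p)))"
          by (simp add: mult_ac)
        also have "\<dots> = 2 powr (1 / p) / k * N * (s powr (- 1 / q) / broken_log B s)"
          unfolding a b using k s broken_log_pos[of B s] by (simp add: field_simps)
        finally show ?thesis .
      qed
      finally show ?thesis .
    qed
    then show "AE s in lborel. 0 < s \<longrightarrow> rearrangement g s \<le> ennreal (2 powr (1 / p) / k * N * (s powr (- 1 / q) / broken_log B s))"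
      by simp
  qed
qed

text \<open>For q = 1 the quasi-norm is the integral of the rearrangement over the half-line, and
  the weight 1/t cancels the factor t. For q > 1 the pointwise bound is integrated: the power with
  exponent -1/q is integrable at 0 with a margin that absorbs the broken logarithm.\<close>

lemma average_le_of_lz_qnorm:
  fixes q :: real and c :: ennreal
  assumes c: "0 < c" and qc: "(q = 1 \<and> c = 1 \<and> B = (0, 0)) \<or> 1 < q"
  obtains C where "0 < C"
    "\<And>(g :: 'a::euclidean_space \<Rightarrow> complex) N t. 0 < N \<Longrightarrow> lz_qnorm (ennreal q) c B g < ennreal N \<Longrightarrow> 0 < t \<Longrightarrow>
       (\<integral>\<^sup>+s. rearrangement g s * indicator {0<..t} s \<partial>lborel)
       \<le> ennreal (C * N * (t powr (- 1 / q) / broken_log B t) * t)"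
  using qc
proof
  assume qc: "q = 1 \<and> c = 1 \<and> B = (0, 0)"
  show ?thesis
  proof (rule that[of 1])
    fix g :: "'a \<Rightarrow> complex" and N t :: real
    assume N: "0 < N" and lz: "lz_qnorm (ennreal q) c B g < ennreal N" and t: "0 < t"
    have r1: "recip 1 = 1" using recip_ennreal[of 1] by simp
    have bl: "broken_log (0, 0) s = 1" for s by (simp add: broken_log_def add_nonneg_eq_0_iff)
    have e1: "ennpowr x 1 = x" for x by (cases x) (auto simp: ennpowr_def)
    have "lz_qnorm (ennreal q) c B g = (\<integral>\<^sup>+s. ennreal (s powr 0) * rearrangement g s * indicator {0<..} s \<partial>lborel)"
      using qc by (simp add: lz_qnorm_def Lp_qnorm_def r1 bl e1 nn_integral_lebesgue_on_half_line)
    also have "\<dots> = (\<integral>\<^sup>+s. rearrangement g s * indicator {0<..} s \<partial>lborel)"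
      by (intro nn_integral_cong) (auto simp: indicator_def)
    finally have "(\<integral>\<^sup>+s. rearrangement g s * indicator {0<..} s \<partial>lborel) \<le> ennreal N" using lz by simp
    moreover have "(\<integral>\<^sup>+s. rearrangement g s * indicator {0<..t} s \<partial>lborel) \<le> (\<integral>\<^sup>+s. rearrangement g s * indicator {0<..} s \<partial>lborel)"
      by (intro nn_integral_mono) (auto simp: indicator_def)
    moreover have "N = 1 * N * (t powr (- 1 / q) / broken_log B t) * t" using qc t by (simp add: bl powr_minus)
    ultimately show "(\<integral>\<^sup>+s. rearrangement g s * indicator {0<..t} s \<partial>lborel)
       \<le> ennreal (1 * N * (t powr (- 1 / q) / broken_log B t) * t)" by (metis order_trans)
  qed simp
next
  assume q: "1 < q"
  obtain C where C: "0 < C" "\<And>(g :: 'a \<Rightarrow> complex) N. 0 < N \<Longrightarrow> lz_qnorm (ennreal q) c B g < ennreal N \<Longrightarrow>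
       AE s in lborel. 0 < s \<longrightarrow> rearrangement g s \<le> ennreal (C * N * (s powr (- 1 / q) / broken_log B s))"
    using rearrangement_le_of_lz_qnorm[where 'a = 'a, of q c B] q c by auto
  \<comment> \<open>Half of the margin 1 - 1/q pays for the logarithm; the other half keeps the
    exponent \<open>a\<close> above -1, with a + 1 = \<epsilon>.\<close>
  define \<epsilon> where "\<epsilon> = (1 - 1 / q) / 2"
  have \<epsilon>: "0 < \<epsilon>" using q by (simp add: \<epsilon>_def)
  obtain D where D: "0 < D" "\<And>s t. 0 < s \<Longrightarrow> s \<le> t \<Longrightarrow> broken_log (- B) s \<le> D * broken_log (- B) t * (t / s) powr \<epsilon>"
    using broken_log_growth[OF \<epsilon>, of "- B"] by metis
  define a where "a = - 1 / q - \<epsilon>"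
  have a: "a + 1 = \<epsilon>" by (simp add: a_def \<epsilon>_def field_simps)
  show ?thesis
  proof (rule that[of "C * D / \<epsilon>"])
    show "0 < C * D / \<epsilon>" using C D \<epsilon> by simp
    fix g :: "'a \<Rightarrow> complex" and N t :: real
    assume N: "0 < N" and lz: "lz_qnorm (ennreal q) c B g < ennreal N" and t: "0 < t"
    define Z where "Z = C * N * D * (t powr \<epsilon> / broken_log B t)"
    have Z: "0 \<le> Z" using C D N broken_log_pos[of B t] by (simp add: Z_def)
    have "(\<integral>\<^sup>+s. rearrangement g s * indicator {0<..t} s \<partial>lborel)
        \<le> (\<integral>\<^sup>+s. ennreal Z * (ennreal (s powr a) * indicator {0<..t} s) \<partial>lborel)"
      using C(2)[OF N lz]
    proof (intro nn_integral_mono_AE, eventually_elim)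
      case (elim s)
      show ?case
      proof (cases "s \<in> {0<..t}")
        case True
        have "1 / broken_log B s \<le> D * (1 / broken_log B t) * (t / s) powr \<epsilon>"
          using D(2)[of s t] True by (simp add: broken_log_minus)
        then have "C * N * (s powr (- 1 / q) * (1 / broken_log B s))
           \<le> C * N * (s powr (- 1 / q) * (D * (1 / broken_log B t) * (t / s) powr \<epsilon>))"
          using C(1) N by (intro mult_left_mono) auto
        also have "\<dots> = Z * s powr a"
          using True t by (simp add: Z_def a_def powr_divide powr_diff)
        finally have "ennreal (C * N * (s powr (- 1 / q) / broken_log B s)) \<le> ennreal Z * ennreal (s powr a)"
          using Z by (simp add: ennreal_leI flip: ennreal_mult)
        then show ?thesis using elim True by (auto simp: indicator_def intro: order_trans)
      qed (auto simp: indicator_def)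
    qed
    also have "\<dots> = ennreal Z * (\<integral>\<^sup>+s. ennreal (s powr a) * indicator {0<..t} s \<partial>lborel)"
      by (rule nn_integral_cmult) measurable
    also have "\<dots> = ennreal Z * ennreal (t powr \<epsilon> / \<epsilon>)"
      using nn_integral_powr_from_0[of a t] \<epsilon> a t by simp
    also have "\<dots> = ennreal (Z * (t powr \<epsilon> / \<epsilon>))" using Z \<epsilon> by (simp flip: ennreal_mult)
    also have "Z * (t powr \<epsilon> / \<epsilon>) = C * D / \<epsilon> * N * (t powr (- 1 / q) / broken_log B t) * t"
    proof -
      have "t powr \<epsilon> * t powr \<epsilon> = t powr (- 1 / q) * t"
      proof -
        have "t powr \<epsilon> * t powr \<epsilon> = t powr (- 1 / q + 1)"
        proof -
          have "\<epsilon> + \<epsilon> = - 1 / q + 1" by (simp add: \<epsilon>_def)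
          then show ?thesis unfolding powr_add[symmetric] by (simp only:)
        qed
        also have "\<dots> = t powr (- 1 / q) * t" using t by (subst powr_add) simp
        finally show ?thesis .
      qed
      moreover have "Z * (t powr \<epsilon> / \<epsilon>) = C * D / \<epsilon> * N / broken_log B t * (t powr \<epsilon> * t powr \<epsilon>)"
        by (simp add: Z_def mult_ac)
      ultimately show ?thesis by simp
    qed
    finally show "(\<integral>\<^sup>+s. rearrangement g s * indicator {0<..t} s \<partial>lborel)
       \<le> ennreal (C * D / \<epsilon> * N * (t powr (- 1 / q) / broken_log B t) * t)" .
  qed
qed

section \<open>The Lorentz--Zygmund quasi-norm with first exponent infinity\<close>

lemma nn_integral_log_near_0:
  assumes a: "a < -1" and r: "0 < r" "r \<le> 1"
  shows "(\<integral>\<^sup>+t. ennreal ((1 - ln t) powr a / t) * indicator {0<..r} t \<partial>lborel)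
    \<le> ennreal ((1 - ln r) powr (a + 1) / - (a + 1))"
proof -
  \<comment> \<open>The antiderivative, extended by 0 at the singular endpoint. Because a + 1 < 0 it
    is continuous there, and no boundary term arises at 0.\<close>
  define F where "F t = (if t \<le> 0 then 0 else (1 - ln t) powr (a + 1) / - (a + 1))" for t :: real
  have lim: "((\<lambda>t. (1 - ln t) powr (a + 1) / - (a + 1)) \<longlongrightarrow> 0) (at_right (0::real))"
  proof -
    have "filterlim (\<lambda>t::real. 1 - ln t) at_top (at_right 0)"
      using filterlim_tendsto_add_at_top[OF tendsto_const[of 1] filterlim_uminus_at_bot[THEN iffD1, OF ln_at_0]] by simp
    then have "((\<lambda>t. (1 - ln t) powr (a + 1)) \<longlongrightarrow> 0) (at_right (0::real))"
      using a by (intro tendsto_neg_powr) auto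
    from tendsto_divide[OF this tendsto_const[of "- (a + 1)"]] show ?thesis using a by simp
  qed
  have cont: "continuous_on {0..r} F"
  proof -
    have "isCont F x" if "0 < x" "x \<le> r" for x
    proof -
      have "isCont (\<lambda>t. (1 - ln t) powr (a + 1) / - (a + 1)) x"
      proof -
        have "ln x \<le> 0" using that r by simp
        then have "ln x \<noteq> 1" by linarith
        then show ?thesis using that a by (intro continuous_intros) auto
      qed
      moreover have "\<forall>\<^sub>F t in nhds x. F t = (1 - ln t) powr (a + 1) / - (a + 1)"
        using eventually_nhds_in_open[of "{0<..}" x] that
        by (auto simp: F_def elim!: eventually_mono)
      ultimately show ?thesis by (subst isCont_cong) auto
    qed
    moreover have "(F \<longlongrightarrow> F 0) (at 0 within {0..r})"
    proof -
      have "((\<lambda>t. (1 - ln t) powr (a + 1) / - (a + 1)) \<longlongrightarrow> 0) (at 0 within {0..r})"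
        using lim r by (simp add: at_within_Icc_at_right)
      moreover have "\<forall>\<^sub>F t in at 0 within {0..r}. (1 - ln t) powr (a + 1) / - (a + 1) = F t"
        unfolding eventually_at_filter by (rule always_eventually) (auto simp: F_def)
      ultimately have "(F \<longlongrightarrow> 0) (at 0 within {0..r})" by (rule Lim_transform_eventually)
      then show ?thesis by (simp add: F_def)
    qed
    ultimately have "(F \<longlongrightarrow> F x) (at x within {0..r})" if "x \<in> {0..r}" for x
      using that by (cases "x = 0") (auto simp: continuous_at_imp_continuous_at_within simp flip: continuous_within)
    then show ?thesis unfolding continuous_on_def by blast
  qed
  have "((\<lambda>t. (1 - ln t) powr a / t) has_integral (F r - F 0)) {0..r}"
  proof (rule fundamental_theorem_of_calculus_interior)
    fix x assume x: "x \<in> {0<..<r}"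
    have "((\<lambda>t. (1 - ln t) powr (a + 1) / - (a + 1)) has_real_derivative (1 - ln x) powr a / x) (at x)"
    proof -
      have "ln x < 0" using x r by auto
      then have "ln x < 1" by linarith
      then have "((\<lambda>t. (1 - ln t) powr (a + 1) / - (a + 1)) has_real_derivative ((a + 1) * (1 - ln x) powr (a + 1 - 1) * (- (1 / x))) / - (a + 1)) (at x)"
        using x a by (auto intro!: derivative_eq_intros simp: powr_diff divide_simps)
      moreover have "((a + 1) * (1 - ln x) powr (a + 1 - 1) * (- (1 / x))) / - (a + 1) = (1 - ln x) powr a / x"
      proof -
        have "((a + 1) * (1 - ln x) powr (a + 1 - 1) * (- (1 / x))) / - (a + 1) = (a + 1) * ((1 - ln x) powr a / x) / (a + 1)"
          by (simp only: mult_minus_right minus_divide_divide add_diff_cancel_right') (simp add: mult.assoc)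
        then show ?thesis using a by simp
      qed
      ultimately show ?thesis by (simp only:)
    qed
    then have "(F has_real_derivative (1 - ln x) powr a / x) (at x)"
      by (rule has_field_derivative_transform_within_open[of _ _ _ "{0<..}"]) (use x in \<open>auto simp: F_def\<close>)
    then show "(F has_vector_derivative (1 - ln x) powr a / x) (at x)"
      by (simp add: has_real_derivative_iff_has_vector_derivative)
  qed (use r cont in auto)
  then have "(\<integral>\<^sup>+t. ennreal (indicator {0..r} t * ((1 - ln t) powr a / t)) \<partial>lborel) = ennreal (F r - F 0)"
    by (intro nn_integral_has_integral_lebesgue) auto
  moreover have "(\<integral>\<^sup>+t. ennreal ((1 - ln t) powr a / t) * indicator {0<..r} t \<partial>lborel)
     \<le> (\<integral>\<^sup>+t. ennreal (indicator {0..r} t * ((1 - ln t) powr a / t)) \<partial>lborel)"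
    by (intro nn_integral_mono) (auto simp: indicator_def)
  ultimately show ?thesis using r by (simp add: F_def)
qed

lemma nn_integral_log_far:
  assumes a: "-1 < a" and r: "1 \<le> r"
  shows "(\<integral>\<^sup>+t. ennreal ((1 + ln t) powr a / t) * indicator {1<..r} t \<partial>lborel)
    \<le> ennreal ((1 + ln r) powr (a + 1) / (a + 1))"
proof -
  define F where "F t = (1 + ln t) powr (a + 1) / (a + 1)" for t :: real
  have "((\<lambda>t. (1 + ln t) powr a / t) has_integral (F r - F 1)) {1..r}"
  proof (rule fundamental_theorem_of_calculus_interior)
    show "continuous_on {1..r} F"
      unfolding F_def using a by (intro continuous_intros) (auto simp: add_nonneg_eq_0_iff)
    fix x assume x: "x \<in> {1<..<r}"
    then have "0 < ln x" by simp
    then have "0 < 1 + ln x" by linarith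
    then have "(F has_real_derivative ((a + 1) * (1 + ln x) powr (a + 1 - 1) * (1 / x)) / (a + 1)) (at x)"
      unfolding F_def using x by (auto intro!: derivative_eq_intros simp: powr_diff divide_simps)
    then have "(F has_real_derivative (1 + ln x) powr a / x) (at x)" using a by simp
    then show "(F has_vector_derivative (1 + ln x) powr a / x) (at x)"
      by (simp add: has_real_derivative_iff_has_vector_derivative)
  qed (use r in auto)
  then have "(\<integral>\<^sup>+t. ennreal (indicator {1..r} t * ((1 + ln t) powr a / t)) \<partial>lborel) = ennreal (F r - F 1)"
    by (intro nn_integral_has_integral_lebesgue) auto
  moreover have "(\<integral>\<^sup>+t. ennreal ((1 + ln t) powr a / t) * indicator {1<..r} t \<partial>lborel)
     \<le> (\<integral>\<^sup>+t. ennreal (indicator {1..r} t * ((1 + ln t) powr a / t)) \<partial>lborel)"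
    by (intro nn_integral_mono) (auto simp: indicator_def)
  moreover have "ennreal (F r - F 1) \<le> ennreal (F r)" using a by (intro ennreal_leI) (simp add: F_def)
  ultimately have "(\<integral>\<^sup>+t. ennreal ((1 + ln t) powr a / t) * indicator {1<..r} t \<partial>lborel) \<le> ennreal (F r)" by simp
  then show ?thesis by (simp only: F_def)
qed

text \<open>An exponent below -1 near 0 gives convergence, and one above -1 far out lets the
  integral grow at the rate of its upper endpoint. Either way the result is the weight at r times 1
  + |ln r|; after a b-th root this becomes the shift of the pair by 1/b.\<close>

lemma nn_integral_broken_log:
  assumes a: "fst A < -1" "-1 < snd A"
  obtains C where "0 < C"
    "\<And>r. 0 < r \<Longrightarrow> (\<integral>\<^sup>+t. ennreal (broken_log A t / t) * indicator {0<..r} t \<partial>lborel)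
       \<le> ennreal (C * (broken_log A r * (1 + \<bar>ln r\<bar>)))"
proof -
  define c0 where "c0 = 1 / - (fst A + 1)"
  define c1 where "c1 = 1 / (snd A + 1)"
  have c: "0 < c0" "0 < c1" using a by (simp_all add: c0_def c1_def)
  have near: "(\<integral>\<^sup>+t. ennreal (broken_log A t / t) * indicator {0<..r} t \<partial>lborel)
       \<le> ennreal (c0 * (1 + \<bar>ln r\<bar>) powr (fst A + 1))" if r: "0 < r" "r \<le> 1" for r
  proof -
    have "(\<integral>\<^sup>+t. ennreal (broken_log A t / t) * indicator {0<..r} t \<partial>lborel)
       = (\<integral>\<^sup>+t. ennreal ((1 - ln t) powr fst A / t) * indicator {0<..r} t \<partial>lborel)"
      using r by (intro nn_integral_cong) (auto simp: indicator_def broken_log_def)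
    also have "\<dots> \<le> ennreal ((1 - ln r) powr (fst A + 1) / - (fst A + 1))"
      by (rule nn_integral_log_near_0[OF a(1) r])
    finally show ?thesis using r by (simp add: c0_def)
  qed
  have Lp: "x powr (e + 1) = x powr e * x" if "0 < x" for x e :: real using that by (simp add: powr_add)
  show ?thesis
  proof (rule that[of "c0 + c1"])
    show "0 < c0 + c1" using c by simp
    fix r :: real assume r: "0 < r"
    define L where "L = 1 + \<bar>ln r\<bar>"
    have L: "1 \<le> L" by (simp add: L_def)
    show "(\<integral>\<^sup>+t. ennreal (broken_log A t / t) * indicator {0<..r} t \<partial>lborel)
       \<le> ennreal ((c0 + c1) * (broken_log A r * (1 + \<bar>ln r\<bar>)))"
    proof (cases "r \<le> 1")
      case True
      have "c0 * L powr (fst A + 1) \<le> (c0 + c1) * L powr (fst A + 1)" using c by (intro mult_right_mono) auto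
      also have "\<dots> = (c0 + c1) * (broken_log A r * L)" using True L by (simp add: broken_log_def Lp L_def[symmetric])
      finally show ?thesis using near[OF r True] unfolding L_def by (meson ennreal_leI order_trans)
    next
      case False
      have "(\<integral>\<^sup>+t. ennreal (broken_log A t / t) * indicator {0<..r} t \<partial>lborel)
        = (\<integral>\<^sup>+t. ennreal (broken_log A t / t) * indicator {0<..1} t + ennreal ((1 + ln t) powr snd A / t) * indicator {1<..r} t \<partial>lborel)"
        using False by (intro nn_integral_cong) (auto simp: indicator_def broken_log_def)
      also have "\<dots> = (\<integral>\<^sup>+t. ennreal (broken_log A t / t) * indicator {0<..1} t \<partial>lborel)
          + (\<integral>\<^sup>+t. ennreal ((1 + ln t) powr snd A / t) * indicator {1<..r} t \<partial>lborel)"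
        by (rule nn_integral_add) measurable
      also have "\<dots> \<le> ennreal c0 + ennreal ((1 + ln r) powr (snd A + 1) / (snd A + 1))"
        using near[of 1] False a by (intro add_mono nn_integral_log_far) auto
      also have "\<dots> = ennreal (c0 + c1 * L powr (snd A + 1))"
        using c False a by (simp add: L_def c1_def flip: ennreal_plus)
      \<comment> \<open>The fixed contribution of (0, 1] is absorbed because L is at least 1 and its
        exponent is positive.\<close>
      also have "\<dots> \<le> ennreal (c0 * L powr (snd A + 1) + c1 * L powr (snd A + 1))"
        using c L a ge_one_powr_ge_zero[of L "snd A + 1"] by (intro ennreal_leI add_mono) auto
      also have "c0 * L powr (snd A + 1) + c1 * L powr (snd A + 1) = (c0 + c1) * (broken_log A r * L)"
      proof -
        have "broken_log A r = L powr snd A" using False by (simp add: broken_log_def L_def)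
        then show ?thesis using L by (simp add: Lp distrib_right)
      qed
      finally show ?thesis unfolding L_def .
    qed
  qed
qed

text \<open>The counterpart of \<open>nn_integral_broken_log\<close> for b = \<infinity>: the
  largest weight on (0, r] sits at r. Across t = 1 the comparison goes through the value 1.\<close>

lemma broken_log_mono:
  assumes A: "fst A \<le> 0" "0 \<le> snd A" and t: "0 < t" "t \<le> r"
  shows "broken_log A t \<le> broken_log A r"
proof -
  have ln: "ln t \<le> ln r" using t by simp
  consider "r \<le> 1" | "t \<le> 1" "1 < r" | "1 < t" by linarith
  then show ?thesis
  proof cases
    case 1
    then have "ln r \<le> 0" using t by simp
    then have "ln r < 1" by linarith
    then show ?thesis using 1 t ln A by (auto simp: broken_log_def intro!: powr_mono2')
  next
    case 2
    have "broken_log A t \<le> 1" 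
    proof -
      have "0 < 1 + \<bar>ln t\<bar>" by (simp add: add_pos_nonneg)
      then show ?thesis using 2 A powr_mono[of "fst A" 0 "1 + \<bar>ln t\<bar>"] by (simp add: broken_log_def)
    qed
    also have "1 \<le> broken_log A r" using 2 A by (auto simp: broken_log_def intro!: ge_one_powr_ge_zero)
    finally show ?thesis .
  next
    case 3
    then show ?thesis using t ln A by (auto simp: broken_log_def intro!: powr_mono2)
  qed
qed

text \<open>Up to r the rearrangement is bounded by a constant, so the weight itself is integrated,
  or maximised for b = \<infinity>. Beyond r the decaying bound takes over, and its power of t
  outweighs the logarithms; the tail is thus comparable to the value at r and brings no further
  logarithm.\<close>

lemma lz_qnorm_infinity_le:
  fixes b :: ennreal and q :: real
  assumes q: "0 < q" and b: "0 < b" and A: "fst A < - recip b" "- recip b < snd A"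
  obtains C where "0 < C"
    "\<And>(g :: 'a::euclidean_space \<Rightarrow> complex) M r. 0 < r \<Longrightarrow> 0 < M \<Longrightarrow>
      (\<And>t. 0 < t \<Longrightarrow> rearrangement g t \<le> ennreal (M * (r powr (- 1 / q) / broken_log B r))) \<Longrightarrow>
      (\<And>t. 0 < t \<Longrightarrow> rearrangement g t \<le> ennreal (M * (t powr (- 1 / q) / broken_log B t))) \<Longrightarrow>
      lz_qnorm \<infinity> b A g \<le> ennreal (C * M * (r powr (- 1 / q) * broken_log (pair_shift (A - B) (recip b)) r))"
  using b
proof (cases rule: exponent_cases)
  case 1
  \<comment> \<open>For a supremum the tail need only stay bounded, so the whole power 1/q may be
    spent on the logarithm.\<close>
  obtain D where D: "0 < D" "\<And>s t. 0 < s \<Longrightarrow> s \<le> t \<Longrightarrow> broken_log (A - B) t \<le> D * broken_log (A - B) s * (t / s) powr (1 / q)"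
  proof -
    have "0 < 1 / q" using q by simp
    then show ?thesis using that broken_log_growth[of "1 / q" "A - B"] by metis
  qed
  show ?thesis
  proof (rule that[of "1 + D"])
    show "0 < 1 + D" using D by simp
    fix g :: "'a \<Rightarrow> complex" and M r :: real
    assume r: "0 < r" and M: "0 < M"
      and g1: "\<And>t. 0 < t \<Longrightarrow> rearrangement g t \<le> ennreal (M * (r powr (- 1 / q) / broken_log B r))"
      and g2: "\<And>t. 0 < t \<Longrightarrow> rearrangement g t \<le> ennreal (M * (t powr (- 1 / q) / broken_log B t))"
    define Y where "Y = M * (r powr (- 1 / q) * broken_log (A - B) r)"
    have Y: "0 \<le> Y" using M broken_log_pos[of "A - B" r] by (simp add: Y_def)
    define h where "h t = ennreal (t powr 0 * broken_log A t) * rearrangement g t" for t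
    have h: "h t \<le> ennreal ((1 + D) * Y)" if t: "0 < t" for t
    proof (cases "t \<le> r")
      case True
      have "broken_log A t \<le> broken_log A r" using A 1 t True by (intro broken_log_mono) auto
      then have "h t \<le> ennreal (broken_log A r) * ennreal (M * (r powr (- 1 / q) / broken_log B r))"
        unfolding h_def using t by (intro mult_mono g1 ennreal_leI) auto
      also have "\<dots> = ennreal Y"
        using broken_log_pos[of A r] broken_log_pos[of B r] M
        by (simp add: Y_def broken_log_diff mult_ac flip: ennreal_mult)
      also have "\<dots> \<le> ennreal ((1 + D) * Y)" using D(1) Y by (intro ennreal_leI) (simp add: distrib_right)
      finally show ?thesis .
    next
      case False
      have "h t \<le> ennreal (broken_log A t) * ennreal (M * (t powr (- 1 / q) / broken_log B t))"
        unfolding h_def using t by (intro mult_mono g2 ennreal_leI) auto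
      also have "\<dots> = ennreal (M * t powr (- 1 / q) * broken_log (A - B) t)"
        using broken_log_pos[of A t] broken_log_pos[of B t] M
        by (simp add: broken_log_diff mult_ac flip: ennreal_mult)
      also have "\<dots> \<le> ennreal (M * t powr (- 1 / q) * (D * broken_log (A - B) r * (t / r) powr (1 / q)))"
        using D(2)[of r t] False r M by (intro ennreal_leI mult_left_mono) auto
      also have "M * t powr (- 1 / q) * (D * broken_log (A - B) r * (t / r) powr (1 / q)) = D * Y"
        using r t by (simp add: Y_def powr_divide powr_minus divide_simps)
      also have "ennreal (D * Y) \<le> ennreal ((1 + D) * Y)" using Y by (intro ennreal_leI) (simp add: distrib_right)
      finally show ?thesis .
    qed
    have [measurable]: "rearrangement g \<in> borel_measurable borel" by (rule rearrangement_measurable)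
    have "h \<in> borel_measurable lborel" unfolding h_def by measurable
    then have "h \<in> borel_measurable (lebesgue_on {0<..})"
      by (intro measurable_restrict_space1 measurable_completion)
    then have "esssup (lebesgue_on {0<..}) h \<le> ennreal ((1 + D) * Y)"
      using h by (intro esssup_I) (auto intro!: AE_I2 simp: space_restrict_space)
    moreover have "lz_qnorm \<infinity> b A g = esssup (lebesgue_on {0<..}) h"
      using 1 by (simp add: lz_qnorm_def Lp_qnorm_def h_def[abs_def])
    ultimately show "lz_qnorm \<infinity> b A g \<le> ennreal ((1 + D) * M * (r powr (- 1 / q) * broken_log (pair_shift (A - B) (recip b)) r))"
      using 1 by (simp add: Y_def broken_log_shift mult.assoc add_nonneg_eq_0_iff)
  qed
next
  case (2 p)
  note p = 2(2)
  \<comment> \<open>Only half of the power 1/q is spent here; the other half leaves the exponent e =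
    -1 - p/(2q) below -1, so that the tail integral converges.\<close>
  obtain D where D: "0 < D" "\<And>s t. 0 < s \<Longrightarrow> s \<le> t \<Longrightarrow> broken_log (A - B) t \<le> D * broken_log (A - B) s * (t / s) powr (1 / (2 * q))"
  proof -
    have "0 < 1 / (2 * q)" using q by simp
    then show ?thesis using that broken_log_growth[of "1 / (2 * q)" "A - B"] by metis
  qed
  have "fst A * p < -1" "-1 < snd A * p" using A p unfolding 2(3) by (simp_all add: field_simps)
  then have A': "fst (fst A * p, snd A * p) < -1" "-1 < snd (fst A * p, snd A * p)" by simp_all
  obtain C where C: "0 < C" "\<And>r. 0 < r \<Longrightarrow> (\<integral>\<^sup>+t. ennreal (broken_log (fst A * p, snd A * p) t / t) * indicator {0<..r} t \<partial>lborel)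
       \<le> ennreal (C * (broken_log (fst A * p, snd A * p) r * (1 + \<bar>ln r\<bar>)))"
    by (rule nn_integral_broken_log[OF A']) blast
  define E where "E = C + D powr p * (2 * q / p)"
  have E: "0 < E" using C D p q by (simp add: E_def add_pos_nonneg)
  show ?thesis
  proof (rule that[of "E powr (1 / p)"])
    show "0 < E powr (1 / p)" using E by simp
    fix g :: "'a \<Rightarrow> complex" and M r :: real
    assume r: "0 < r" and M: "0 < M"
      and g1: "\<And>t. 0 < t \<Longrightarrow> rearrangement g t \<le> ennreal (M * (r powr (- 1 / q) / broken_log B r))"
      and g2: "\<And>t. 0 < t \<Longrightarrow> rearrangement g t \<le> ennreal (M * (t powr (- 1 / q) / broken_log B t))"
    define Y where "Y = M * (r powr (- 1 / q) * broken_log (A - B) r)"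
    have Y: "0 < Y" using r M broken_log_pos[of "A - B" r] by (simp add: Y_def)
    define L where "L = 1 + \<bar>ln r\<bar>"
    have L: "1 \<le> L" by (simp add: L_def)
    define h where "h t = ennreal (t powr (- (1 / p)) * broken_log A t) * rearrangement g t" for t
    define W where "W = M * (r powr (- 1 / q) / broken_log B r)"
    have W: "0 \<le> W" using M broken_log_pos[of B r] by (simp add: W_def)
    have tp: "(t powr (- (1 / p)) * x) powr p = x powr p / t" if "0 < t" "0 \<le> x" for t x :: real
    proof -
      have "(t powr (- (1 / p))) powr p = 1 / t"
        using that p by (simp only: powr_powr) (simp add: powr_minus_divide)
      then show ?thesis by (simp add: powr_mult)
    qed
    define e where "e = - 1 - p / (2 * q)"
    have e: "e < -1" using p q by (simp add: e_def)
    define V where "V = M * D * broken_log (A - B) r * r powr (- 1 / (2 * q))"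
    have V: "0 \<le> V" using M D broken_log_pos[of "A - B" r] by (simp add: V_def)
    have pt: "ennpowr (h t) p * indicator {0<..} t
       \<le> ennreal (W powr p) * (ennreal (broken_log (fst A * p, snd A * p) t / t) * indicator {0<..r} t)
        + ennreal (V powr p) * (ennreal (t powr e) * indicator {r<..} t)" for t
    proof -
      consider "t \<le> 0" | "0 < t" "t \<le> r" | "r < t" by linarith
      then show ?thesis
      proof cases
        case 1
        then show ?thesis using r by (simp add: indicator_def)
      next
        case 2
        have "h t \<le> ennreal (t powr (- (1 / p)) * broken_log A t) * ennreal W"
          unfolding h_def W_def using 2 by (intro mult_left_mono g1) auto
        also have "\<dots> = ennreal (t powr (- (1 / p)) * (broken_log A t * W))"
          using W broken_log_pos[of A t] by (simp add: mult.assoc flip: ennreal_mult)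
        finally have "ennpowr (h t) p \<le> ennpowr (ennreal (t powr (- (1 / p)) * (broken_log A t * W))) p"
          by (rule ennpowr_mono[OF p])
        also have "\<dots> = ennreal ((broken_log A t * W) powr p / t)"
          using W broken_log_pos[of A t] 2 by (subst ennpowr_ennreal) (auto simp: tp)
        also have "(broken_log A t * W) powr p / t = W powr p * (broken_log (fst A * p, snd A * p) t / t)"
          by (simp add: powr_mult broken_log_powr)
        also have "ennreal \<dots> = ennreal (W powr p) * ennreal (broken_log (fst A * p, snd A * p) t / t)"
          using 2 by (intro ennreal_mult) (auto intro!: divide_nonneg_pos less_imp_le[OF broken_log_pos])
        finally show ?thesis using 2 by (simp add: indicator_def)
      next
        case 3
        then have t: "0 < t" using r by simp
        have "h t \<le> ennreal (t powr (- (1 / p)) * broken_log A t) * ennreal (M * (t powr (- 1 / q) / broken_log B t))"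
          unfolding h_def using t by (intro mult_left_mono g2) auto
        also have "\<dots> = ennreal (t powr (- (1 / p)) * (M * t powr (- 1 / q) * broken_log (A - B) t))"
          using M broken_log_pos[of A t] broken_log_pos[of B t] by (simp add: broken_log_diff mult_ac flip: ennreal_mult)
        also have "\<dots> \<le> ennreal (t powr (- (1 / p)) * (M * t powr (- 1 / q) * (D * broken_log (A - B) r * (t / r) powr (1 / (2 * q)))))"
          using D(2)[of r t] 3 r M by (intro ennreal_leI mult_left_mono) auto
        also have "M * t powr (- 1 / q) * (D * broken_log (A - B) r * (t / r) powr (1 / (2 * q))) = V * t powr (- 1 / (2 * q))"
        proof -
          have "- 1 / q + 1 / (2 * q) = - 1 / (2 * q)" using q by (simp add: field_simps)
          then have 4: "t powr (- 1 / q) * t powr (1 / (2 * q)) = t powr (- 1 / (2 * q))"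
            by (simp only: powr_add[symmetric])
          have "r powr (- 1 / (2 * q)) = 1 / r powr (1 / (2 * q))" by (simp add: powr_minus_divide)
          then have 5: "(t / r) powr (1 / (2 * q)) = t powr (1 / (2 * q)) * r powr (- 1 / (2 * q))"
            using r t by (simp add: powr_divide)
          have "M * t powr (- 1 / q) * (D * broken_log (A - B) r * (t / r) powr (1 / (2 * q)))
              = M * D * broken_log (A - B) r * r powr (- 1 / (2 * q)) * (t powr (- 1 / q) * t powr (1 / (2 * q)))"
            unfolding 5 by (simp only: mult_ac)
          then show ?thesis by (simp only: 4 V_def)
        qed
        finally have "ennpowr (h t) p \<le> ennpowr (ennreal (t powr (- (1 / p)) * (V * t powr (- 1 / (2 * q))))) p"
          by (rule ennpowr_mono[OF p])
        also have "\<dots> = ennreal ((V * t powr (- 1 / (2 * q))) powr p / t)"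
          using V t by (subst ennpowr_ennreal) (auto simp: tp)
        also have "(V * t powr (- 1 / (2 * q))) powr p / t = V powr p * t powr e"
        proof -
          have "e = - p / (2 * q) - 1" by (simp add: e_def)
          then have "t powr (- p / (2 * q)) / t = t powr e" using t by (simp only: powr_diff) simp
          moreover have "(V * t powr (- 1 / (2 * q))) powr p / t = V powr p * (t powr (- p / (2 * q)) / t)"
            by (simp add: powr_mult powr_powr)
          ultimately show ?thesis by (simp only:)
        qed
        also have "ennreal \<dots> = ennreal (V powr p) * ennreal (t powr e)" by (rule ennreal_mult) auto
        finally show ?thesis using 3 t by (simp add: indicator_def)
      qed
    qed
    have VY: "V * r powr (- 1 / (2 * q)) = D * Y"
    proof -
      have "r powr (- 1 / (2 * q)) * r powr (- 1 / (2 * q)) = r powr (- 1 / q)"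
      proof -
        have "- 1 / (2 * q) + - 1 / (2 * q) = - 1 / q" using q by (simp add: field_simps)
        then show ?thesis by (simp only: powr_add[symmetric])
      qed
      moreover have "V * r powr (- 1 / (2 * q)) = M * D * broken_log (A - B) r * (r powr (- 1 / (2 * q)) * r powr (- 1 / (2 * q)))"
        by (simp only: V_def mult_ac)
      ultimately have "V * r powr (- 1 / (2 * q)) = M * D * broken_log (A - B) r * r powr (- 1 / q)" by (simp only:)
      then show ?thesis by (simp only: Y_def mult_ac)
    qed
    have WY: "W * broken_log A r = Y" by (simp add: W_def Y_def broken_log_diff mult_ac)
    have "(\<integral>\<^sup>+t. ennpowr (h t) p * indicator {0<..} t \<partial>lborel)
        \<le> (\<integral>\<^sup>+t. ennreal (W powr p) * (ennreal (broken_log (fst A * p, snd A * p) t / t) * indicator {0<..r} t)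
          + ennreal (V powr p) * (ennreal (t powr e) * indicator {r<..} t) \<partial>lborel)"
      by (intro nn_integral_mono pt)
    also have "\<dots> = ennreal (W powr p) * (\<integral>\<^sup>+t. ennreal (broken_log (fst A * p, snd A * p) t / t) * indicator {0<..r} t \<partial>lborel)
          + ennreal (V powr p) * (\<integral>\<^sup>+t. ennreal (t powr e) * indicator {r<..} t \<partial>lborel)"
      by (subst nn_integral_add) (auto simp: nn_integral_cmult)
    also have "\<dots> \<le> ennreal (W powr p) * ennreal (C * (broken_log (fst A * p, snd A * p) r * L))
          + ennreal (V powr p) * ennreal (- (r powr (e + 1)) / (e + 1))"
      unfolding L_def by (intro add_mono mult_left_mono C(2) nn_integral_powr_to_inf r e) auto
    also have "\<dots> = ennreal (C * (Y powr p * L)) + ennreal ((2 * q / p) * ((D * Y) powr p))"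
    proof -
      have 1: "W powr p * (C * (broken_log (fst A * p, snd A * p) r * L)) = C * (Y powr p * L)"
        using W broken_log_pos[of A r] by (simp add: WY[symmetric] powr_mult broken_log_powr mult_ac)
      have ee: "e + 1 = - p / (2 * q)" by (simp add: e_def)
      have "r powr (e + 1) = (r powr (- 1 / (2 * q))) powr p" by (simp add: ee powr_powr)
      then have 2: "V powr p * (- (r powr (e + 1)) / (e + 1)) = (2 * q / p) * ((D * Y) powr p)"
        using p q unfolding VY[symmetric] ee by (simp add: powr_mult field_simps)
      have "ennreal (W powr p) * ennreal (C * (broken_log (fst A * p, snd A * p) r * L)) = ennreal (C * (Y powr p * L))"
        unfolding 1[symmetric] by (subst ennreal_mult') auto
      moreover have "ennreal (V powr p) * ennreal (- (r powr (e + 1)) / (e + 1)) = ennreal ((2 * q / p) * ((D * Y) powr p))"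
        unfolding 2[symmetric] by (subst ennreal_mult') auto
      ultimately show ?thesis by simp
    qed
    also have "\<dots> = ennreal (C * (Y powr p * L) + (2 * q / p) * ((D * Y) powr p))"
      using C(1) p q L by (subst ennreal_plus) auto
    \<comment> \<open>The tail carries no logarithm; inserting L \<ge> 1 gives both parts the common
      factor that the p-th root turns into the shift.\<close>
    also have "\<dots> \<le> ennreal (C * (Y powr p * L) + (2 * q / p) * ((D * Y) powr p) * L)"
    proof (intro ennreal_leI add_left_mono)
      have "(2 * q / p) * ((D * Y) powr p) * 1 \<le> (2 * q / p) * ((D * Y) powr p) * L"
        using p q L by (intro mult_left_mono) auto
      then show "(2 * q / p) * ((D * Y) powr p) \<le> (2 * q / p) * ((D * Y) powr p) * L" by simp
    qed
    also have "C * (Y powr p * L) + (2 * q / p) * ((D * Y) powr p) * L = E * (Y powr p * L)"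
      using D(1) Y by (simp add: E_def powr_mult algebra_simps)
    finally have "ennpowr (\<integral>\<^sup>+t. ennpowr (h t) p * indicator {0<..} t \<partial>lborel) (1 / p) \<le> ennpowr (ennreal (E * (Y powr p * L))) (1 / p)"
      using p by (intro ennpowr_mono) auto
    also have "\<dots> = ennreal (E powr (1 / p) * (Y * L powr (1 / p)))"
      using E Y L p by (subst ennpowr_ennreal) (auto simp: powr_mult powr_powr)
    finally have "ennpowr (\<integral>\<^sup>+t. ennpowr (h t) p * indicator {0<..} t \<partial>lborel) (1 / p) \<le> ennreal (E powr (1 / p) * (Y * L powr (1 / p)))" .
    moreover have "lz_qnorm \<infinity> b A g = ennpowr (\<integral>\<^sup>+t. ennpowr (h t) p * indicator {0<..} t \<partial>lborel) (1 / p)"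
      using 2 by (simp add: lz_qnorm_def Lp_qnorm_def h_def nn_integral_lebesgue_on_half_line)
    moreover have "E powr (1 / p) * (Y * L powr (1 / p)) = E powr (1 / p) * M * (r powr (- 1 / q) * broken_log (pair_shift (A - B) (recip b)) r)"
      by (simp add: Y_def L_def broken_log_shift 2(3) mult_ac)
    ultimately show "lz_qnorm \<infinity> b A g \<le> ennreal (E powr (1 / p) * M * (r powr (- 1 / q) * broken_log (pair_shift (A - B) (recip b)) r))"
      by simp
  qed
qed

section \<open>The estimate for a single block\<close>

text \<open>Fubini moves the kernel from g onto the test function, where it becomes a correlation
  that T ignores. The uniform bound on the absolute convolution gives pointwise existence of the
  integral, the exchange of integrals, and integrability of the bounded result against Schwartz
  functions.\<close>

lemma represents_convolution:
  fixes K g g0 :: "'a::euclidean_space \<Rightarrow> complex"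
  assumes K: "rapidly_decreasing K" and g0: "g0 \<in> borel_measurable borel"
    and rep: "represents g T" and ae: "AE x in lebesgue. g x = g0 x"
    and bound: "\<And>x. (\<integral>\<^sup>+y. ennreal (norm (K (x - y))) * ennreal (norm (g0 y)) \<partial>lborel) \<le> ennreal M"
    and inv: "\<And>\<psi>. schwartz \<psi> \<Longrightarrow> T (correlation K \<psi>) = T \<psi>"
  defines "g' \<equiv> (\<lambda>x. \<integral>y. K (x - y) * g0 y \<partial>lborel)"
  shows "represents g' T" and "g' \<in> borel_measurable borel"
    and "\<And>x. ennreal (norm (g' x)) \<le> (\<integral>\<^sup>+y. ennreal (norm (K (x - y))) * ennreal (norm (g0 y)) \<partial>lborel)"
proof -
  note [measurable] = g0 rapidly_decreasing_measurable[OF K]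
  have bound': "(\<integral>\<^sup>+y. ennreal (norm (K (x - y) * g0 y)) \<partial>lborel) = (\<integral>\<^sup>+y. ennreal (norm (K (x - y))) * ennreal (norm (g0 y)) \<partial>lborel)" for x
    by (simp add: norm_mult ennreal_mult)
  have int: "integrable lborel (\<lambda>y. K (x - y) * g0 y)" for x
  proof (rule integrableI_bounded)
    show "(\<integral>\<^sup>+y. ennreal (norm (K (x - y) * g0 y)) \<partial>lborel) < \<infinity>"
      unfolding bound' by (rule le_less_trans[OF bound]) simp
  qed measurable
  show le: "ennreal (norm (g' x)) \<le> (\<integral>\<^sup>+y. ennreal (norm (K (x - y))) * ennreal (norm (g0 y)) \<partial>lborel)" for x
    unfolding g'_def bound'[symmetric] by (rule integral_norm_bound_ennreal[OF int])
  show g'_meas: "g' \<in> borel_measurable borel"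
    unfolding g'_def by (rule lborel.borel_measurable_lebesgue_integral) measurable
  note [measurable] = g'_meas
  have g'_bound: "norm (g' x) \<le> max 0 M" for x
  proof -
    have "ennreal (norm (g' x)) \<le> ennreal (max 0 M)"
      using order_trans[OF le bound] by (rule order_trans) (simp add: ennreal_leI)
    then show ?thesis by (subst (asm) ennreal_le_iff) auto
  qed
  show "represents g' T"
    unfolding represents_def
  proof (intro conjI allI impI)
    show "g' \<in> borel_measurable lebesgue" by (intro measurable_completion) simp
    fix \<psi> :: "'a \<Rightarrow> complex" assume \<psi>: "schwartz \<psi>"
    note [measurable] = rapidly_decreasing_measurable[OF schwartz_rapidly_decreasing[OF \<psi>]]
    have \<psi>i: "integrable lborel \<psi>" by (rule rapidly_decreasing_imp_integrable[OF schwartz_rapidly_decreasing[OF \<psi>]])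
    have "integrable lborel (\<lambda>x. g' x * \<psi> x)"
    proof (rule Bochner_Integration.integrable_bound)
      show "integrable lborel (\<lambda>x. max 0 M * norm (\<psi> x))" using \<psi>i by simp
      show "AE x in lborel. norm (g' x * \<psi> x) \<le> norm (max 0 M * norm (\<psi> x))"
        using g'_bound by (intro AE_I2) (simp add: norm_mult mult_right_mono)
    qed measurable
    then show "integrable lebesgue (\<lambda>x. g' x * \<psi> x)" by (subst integrable_completion) auto
    have ws: "schwartz (correlation K \<psi>)" by (rule schwartz_correlation[OF K \<psi>])
    note [measurable] = rapidly_decreasing_measurable[OF schwartz_rapidly_decreasing[OF ws]]
    have "T \<psi> = T (correlation K \<psi>)" by (simp add: inv[OF \<psi>])
    also have "\<dots> = (\<integral>y. g y * correlation K \<psi> y \<partial>lebesgue)" using rep ws by (simp add: represents_def)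
    also have "\<dots> = (\<integral>y. g0 y * correlation K \<psi> y \<partial>lebesgue)"
    proof (rule integral_cong_AE)
      show "(\<lambda>y. g y * correlation K \<psi> y) \<in> borel_measurable lebesgue"
        using rep ws unfolding represents_def by (metis borel_measurable_integrable)
      show "(\<lambda>y. g0 y * correlation K \<psi> y) \<in> borel_measurable lebesgue"
        by (intro measurable_completion) measurable
      show "AE y in lebesgue. g y * correlation K \<psi> y = g0 y * correlation K \<psi> y"
        using ae by eventually_elim simp
    qed
    also have "\<dots> = (\<integral>y. g0 y * correlation K \<psi> y \<partial>lborel)"
      by (rule integral_completion) measurable
    also have "\<dots> = (\<integral>y. (\<integral>x. g0 y * (K (x - y) * \<psi> x) \<partial>lborel) \<partial>lborel)"
    proof (rule Bochner_Integration.integral_cong[OF refl])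
      fix y
      have "(\<integral>x. K (- y + x) * \<psi> (y + (- y + x)) \<partial>lborel) = correlation K \<psi> y"
        unfolding correlation_def by (rule lborel_integral_translate[of "\<lambda>x. K x * \<psi> (y + x)"]) measurable
      then show "g0 y * correlation K \<psi> y = (\<integral>x. g0 y * (K (x - y) * \<psi> x) \<partial>lborel)" by simp
    qed
    also have "\<dots> = (\<integral>x. (\<integral>y. g0 y * (K (x - y) * \<psi> x) \<partial>lborel) \<partial>lborel)"
    proof (rule lborel_pair.Fubini_integral, rule integrable_lborel_pairI)
      show "(\<lambda>(x, y). g0 y * (K (x - y) * \<psi> x)) \<in> borel_measurable (lborel \<Otimes>\<^sub>M lborel)" by measurable
      have "(\<integral>\<^sup>+x. \<integral>\<^sup>+y. ennreal (norm (g0 y * (K (x - y) * \<psi> x))) \<partial>lborel \<partial>lborel)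
          = (\<integral>\<^sup>+x. (\<integral>\<^sup>+y. ennreal (norm (K (x - y))) * ennreal (norm (g0 y)) \<partial>lborel) * ennreal (norm (\<psi> x)) \<partial>lborel)"
        by (simp add: norm_mult ennreal_mult mult_ac nn_integral_cmult)
      also have "\<dots> \<le> (\<integral>\<^sup>+x. ennreal M * ennreal (norm (\<psi> x)) \<partial>lborel)"
        by (intro nn_integral_mono mult_right_mono bound) simp
      also have "\<dots> = ennreal M * (\<integral>\<^sup>+x. ennreal (norm (\<psi> x)) \<partial>lborel)" by (simp add: nn_integral_cmult)
      also have "\<dots> < \<infinity>" using \<psi>i by (simp add: integrable_iff_bounded ennreal_mult_less_top)
      finally show "(\<integral>\<^sup>+x. \<integral>\<^sup>+y. ennreal (norm (g0 y * (K (x - y) * \<psi> x))) \<partial>lborel \<partial>lborel) < \<infinity>" .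
    qed
    also have "\<dots> = (\<integral>x. g' x * \<psi> x \<partial>lborel)"
    proof (rule Bochner_Integration.integral_cong[OF refl])
      fix x
      have "(\<integral>y. g0 y * (K (x - y) * \<psi> x) \<partial>lborel) = (\<integral>y. (K (x - y) * g0 y) * \<psi> x \<partial>lborel)" by (simp add: mult_ac)
      then show "(\<integral>y. g0 y * (K (x - y) * \<psi> x) \<partial>lborel) = g' x * \<psi> x" by (simp add: g'_def)
    qed
    also have "\<dots> = (\<integral>x. g' x * \<psi> x \<partial>lebesgue)"
      by (rule integral_completion[symmetric]) measurable
    finally show "T \<psi> = (\<integral>x. g' x * \<psi> x \<partial>lebesgue)" .
  qed
qed

text \<open>A representative is only Lebesgue measurable, whereas convolution and Fubini are carried
  out with Borel functions. A change on a null set affects neither the distribution nor the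
  rearrangement.\<close>

lemma lebesgue_measurable_borel_version:
  fixes g :: "'a::euclidean_space \<Rightarrow> complex"
  assumes g: "g \<in> borel_measurable lebesgue"
  obtains g0 where "g0 \<in> borel_measurable borel" "AE x in lebesgue. g x = g0 x"
proof -
  have "(\<lambda>x. Re (g x)) \<in> borel_measurable lebesgue" "(\<lambda>x. Im (g x)) \<in> borel_measurable lebesgue"
    using g by simp_all
  then obtain u v where uv: "u \<in> borel_measurable lborel" "AE x in lborel. Re (g x) = u x"
    "v \<in> borel_measurable lborel" "AE x in lborel. Im (g x) = v x"
    using completion_ex_borel_measurable_real by metis
  show ?thesis
  proof (rule that)
    show "(\<lambda>x. Complex (u x) (v x)) \<in> borel_measurable borel"
      using uv by (simp add: borel_measurable_complex_iff)
    have "AE x in lborel. g x = Complex (u x) (v x)"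
      using uv(2,4) by eventually_elim (simp add: complex_eq_iff)
    then show "AE x in lebesgue. g x = Complex (u x) (v x)" by (rule AE_completion)
  qed
qed

text \<open>The logarithm of the argument on the left is -n k ln 2. The sign exchanges the two
  branches, and the factor n costs only a constant independent of k.\<close>

lemma broken_log_dyadic_swap:
  assumes n: "1 \<le> n"
  shows "broken_log D (1 / (2 powi k) ^ n)
     \<le> real n powr (\<bar>fst D\<bar> + \<bar>snd D\<bar>) * broken_log (prod.swap D) (2 powi k)"
proof -
  define s where "s = (2::real) powi k"
  have s: "0 < s" by (simp add: s_def)
  have lr: "ln (1 / s ^ n) = - (real n * ln s)" using s by (simp add: ln_div ln_realpow)
  have n1: "1 \<le> real n" using n by simp
  have L: "1 + \<bar>ln s\<bar> \<le> 1 + \<bar>ln (1 / s ^ n)\<bar>" "1 + \<bar>ln (1 / s ^ n)\<bar> \<le> real n * (1 + \<bar>ln s\<bar>)"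
    using mult_right_mono[OF n1, of "\<bar>ln s\<bar>"] n1 unfolding lr by (simp_all add: abs_mult distrib_left)
  have main: "(1 + \<bar>ln (1 / s ^ n)\<bar>) powr e \<le> real n powr (\<bar>fst D\<bar> + \<bar>snd D\<bar>) * (1 + \<bar>ln s\<bar>) powr e"
    if e: "\<bar>e\<bar> \<le> \<bar>fst D\<bar> + \<bar>snd D\<bar>" for e
  proof -
    have "(1 + \<bar>ln (1 / s ^ n)\<bar>) powr e \<le> real n powr \<bar>e\<bar> * (1 + \<bar>ln s\<bar>) powr e"
    proof (cases "0 \<le> e")
      case True
      have "(1 + \<bar>ln (1 / s ^ n)\<bar>) powr e \<le> (real n * (1 + \<bar>ln s\<bar>)) powr e"
        using True L(2) by (intro powr_mono2) auto
      then show ?thesis using True by (simp add: powr_mult)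
    next
      case False
      have "(1 + \<bar>ln (1 / s ^ n)\<bar>) powr e \<le> (1 + \<bar>ln s\<bar>) powr e"
        using False by (intro powr_mono2' L(1)) (simp_all add: add_pos_nonneg)
      also have "\<dots> \<le> real n powr \<bar>e\<bar> * (1 + \<bar>ln s\<bar>) powr e"
        using ge_one_powr_ge_zero[OF n1, of "\<bar>e\<bar>"] by (simp add: mult_le_cancel_right1)
      finally show ?thesis .
    qed
    also have "\<dots> \<le> real n powr (\<bar>fst D\<bar> + \<bar>snd D\<bar>) * (1 + \<bar>ln s\<bar>) powr e"
      using e n1 by (intro mult_right_mono powr_mono) auto
    finally show ?thesis .
  qed
  \<comment> \<open>At s = 1 both arguments fall into the branch t \<le> 1, so nothing is exchanged;
    both broken logarithms are 1 there.\<close>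
  consider "s = 1" | "s < 1" | "1 < s" by linarith
  then show ?thesis unfolding s_def[symmetric]
  proof cases
    case 1
    then show "broken_log D (1 / s ^ n) \<le> real n powr (\<bar>fst D\<bar> + \<bar>snd D\<bar>) * broken_log (prod.swap D) s"
      using ge_one_powr_ge_zero[OF n1, of "\<bar>fst D\<bar> + \<bar>snd D\<bar>"] by (simp add: broken_log_def)
  next
    case 2
    then have "s ^ n < 1" using n s by (simp add: power_less_one_iff)
    then have "1 < 1 / s ^ n" using s by simp
    with 2 show "broken_log D (1 / s ^ n) \<le> real n powr (\<bar>fst D\<bar> + \<bar>snd D\<bar>) * broken_log (prod.swap D) s"
      using main[of "snd D"] by (simp add: broken_log_def del: less_divide_eq_1_pos)
  next
    case 3
    then have "1 < s ^ n" using n by (simp add: one_less_power)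
    then have "1 / s ^ n \<le> 1" using s by simp
    with 3 show "broken_log D (1 / s ^ n) \<le> real n powr (\<bar>fst D\<bar> + \<bar>snd D\<bar>) * broken_log (prod.swap D) s"
      using main[of "fst D"] by (simp add: broken_log_def del: divide_le_eq_1_pos)
  qed
qed

text \<open>The Nikolskii inequality. Dilation preserves the mass of the kernel and multiplies its
  height by 1/r, so one constant \<open>c1\<close> fits \<open>convolution_bounds\<close> for every
  k; this makes the final constant uniform in k.\<close>

lemma lp_block_lz_qnorm_le:
  fixes \<phi> :: "'a::euclidean_space \<Rightarrow> real" and q :: real and c b :: ennreal and A B :: "real \<times> real"
  assumes \<phi>: "dyadic_generator \<phi>" and c: "0 < c"
    and qc: "(q = 1 \<and> c = 1 \<and> B = (0, 0)) \<or> 1 < q"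
    and b: "0 < b" and A: "fst A < - recip b" "- recip b < snd A"
  obtains C where "0 < C"
    "\<And>k T. dist_lz_qnorm \<infinity> b A (lp_block \<phi> k T)
       \<le> ennreal (C * (2 powr (real DIM('a) / q * real_of_int k)
            * broken_log (pair_shift (prod.swap A - prod.swap B) (recip b)) (2 powi k)))
          * dist_lz_qnorm (ennreal q) c B (lp_block \<phi> k T)"
proof -
  define n where "n = DIM('a)"
  have n: "1 \<le> n" unfolding n_def by (simp add: DIM_positive Suc_leI)
  have q: "0 < q" using qc by auto
  obtain K where K: "rapidly_decreasing K" "\<And>\<xi>. \<phi> \<xi> \<noteq> 0 \<Longrightarrow> fourier K \<xi> = 1"
    using reproducing_kernel_exists[OF \<phi>] by blast
  note [measurable] = rapidly_decreasing_measurable[OF K(1)]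
  obtain c0 where c0: "0 \<le> c0" "\<And>x. norm (K x) \<le> c0"
    using rapidly_decreasing_bound[OF K(1), of 0] by auto
  \<comment> \<open>A common bound for the L1 norm and the supremum of K; the summand 1 makes it
    positive.\<close>
  define c1 where "c1 = (\<integral>x. norm (K x) \<partial>lborel) + c0 + 1"
  have c1: "0 < c1" using c0 by (simp add: c1_def add_nonneg_pos)
  have "0 \<le> (\<integral>x. norm (K x) \<partial>lborel)" by simp
  then have Kb: "norm (K x) \<le> c1" for x unfolding c1_def using c0(2)[of x] by argo
  have KI: "(\<integral>\<^sup>+x. ennreal (norm (K x)) \<partial>lborel) \<le> ennreal c1"
    using rapidly_decreasing_imp_integrable[OF K(1)] c0(1) by (subst nn_integral_eq_integral) (auto simp: c1_def intro!: ennreal_leI)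
  obtain Ca where Ca: "0 < Ca"
    "\<And>(g :: 'a \<Rightarrow> complex) N t. 0 < N \<Longrightarrow> lz_qnorm (ennreal q) c B g < ennreal N \<Longrightarrow> 0 < t \<Longrightarrow>
       (\<integral>\<^sup>+s. rearrangement g s * indicator {0<..t} s \<partial>lborel)
       \<le> ennreal (Ca * N * (t powr (- 1 / q) / broken_log B t) * t)"
    by (rule average_le_of_lz_qnorm[OF c qc, where 'a = 'a]) blast
  obtain Ci where Ci: "0 < Ci"
    "\<And>(g :: 'a \<Rightarrow> complex) M r. 0 < r \<Longrightarrow> 0 < M \<Longrightarrow>
      (\<And>t. 0 < t \<Longrightarrow> rearrangement g t \<le> ennreal (M * (r powr (- 1 / q) / broken_log B r))) \<Longrightarrow>
      (\<And>t. 0 < t \<Longrightarrow> rearrangement g t \<le> ennreal (M * (t powr (- 1 / q) / broken_log B t))) \<Longrightarrow>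
      lz_qnorm \<infinity> b A g \<le> ennreal (Ci * M * (r powr (- 1 / q) * broken_log (pair_shift (A - B) (recip b)) r))"
    by (rule lz_qnorm_infinity_le[OF q b A, where 'a = 'a and B = B]) blast
  define D where "D = pair_shift (A - B) (recip b)"
  define Cs where "Cs = real n powr (\<bar>fst D\<bar> + \<bar>snd D\<bar>)"
  have Cs: "0 < Cs" using n by (simp add: Cs_def)
  have swapD: "prod.swap D = pair_shift (prod.swap A - prod.swap B) (recip b)"
    by (simp add: D_def pair_shift_def)
  define C where "C = Ci * (3 * c1 * Ca) * Cs"
  have C: "0 < C" using Ci Ca c1 Cs by (simp add: C_def)
  show ?thesis
  proof (rule that[OF C])
    fix k :: int and T :: "'a functional"
    define s where "s = (2::real) powi k"
    have s: "0 < s" by (simp add: s_def)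
    define r where "r = 1 / s ^ n"
    have r: "0 < r" using s by (simp add: r_def)
    define Kk where "Kk x = complex_of_real (s ^ DIM('a)) * K (s *\<^sub>R x)" for x
    have Kk: "rapidly_decreasing Kk" unfolding Kk_def by (rule rapidly_decreasing_dilate[OF K(1) s])
    note [measurable] = rapidly_decreasing_measurable[OF Kk]
    have KkF: "fourier Kk \<xi> = 1" if "\<phi> ((2 powi (- k)) *\<^sub>R \<xi>) \<noteq> 0" for \<xi>
    proof -
      have "fourier Kk \<xi> = fourier K ((1 / s) *\<^sub>R \<xi>)" unfolding Kk_def[abs_def] by (rule fourier_dilate[OF _ s]) measurable
      also have "1 / s = 2 powi (- k)" by (simp add: s_def power_int_minus_divide)
      finally show ?thesis using K(2)[OF that] by simp
    qed
    have Kkb: "ennreal (norm (Kk x)) \<le> ennreal (c1 / r)" for x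
      using Kb[of "s *\<^sub>R x"] s by (intro ennreal_leI) (simp add: Kk_def norm_mult norm_power r_def n_def mult.commute)
    have KkI: "(\<integral>\<^sup>+x. ennreal (norm (Kk x)) \<partial>lborel) \<le> ennreal c1"
    proof -
      have "(\<integral>\<^sup>+x. ennreal (norm (Kk x)) \<partial>lborel) = ennreal (s ^ DIM('a)) * (\<integral>\<^sup>+x. ennreal (norm (K (s *\<^sub>R x))) \<partial>lborel)"
        using s by (simp add: Kk_def norm_mult norm_power ennreal_mult nn_integral_cmult)
      also have "\<dots> = (\<integral>\<^sup>+x. ennreal (norm (K x)) \<partial>lborel)"
        using lborel_nn_integral_affine[of "\<lambda>x. ennreal (norm (K x))" s 0] s by simp
      finally show ?thesis using KI by simp
    qed
    \<comment> \<open>This power is the gain n/q in the smoothness index.\<close>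
    have rq: "r powr (- 1 / q) = 2 powr (real n / q * real_of_int k)"
    proof -
      have "s = 2 powr real_of_int k" by (simp add: s_def powr_real_of_int')
      then have "r = 2 powr (- (real_of_int k * real n))"
        by (simp add: r_def powr_minus_divide powr_powr flip: powr_realpow)
      then show ?thesis by (simp add: powr_powr mult.commute)
    qed
    define f where "f = 2 powr (real n / q * real_of_int k) * broken_log (prod.swap D) (2 powi k)"
    have f: "0 < f" unfolding f_def by (intro mult_pos_pos broken_log_pos) simp
    let ?T = "lp_block \<phi> k T"
    \<comment> \<open>The quasi-norm is an infimum over representatives. A number N strictly above
      it yields an actual representative g, and N > 0 also covers quasi-norm 0.\<close>
    have key: "dist_lz_qnorm \<infinity> b A ?T \<le> ennreal (C * f * N)"
      if N: "0 < N" "dist_lz_qnorm (ennreal q) c B ?T < ennreal N" for N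
    proof -
      obtain g where g: "represents g ?T" "lz_qnorm (ennreal q) c B g < ennreal N"
        using N(2) unfolding dist_lz_qnorm_def INF_less_iff by auto
      have gm: "g \<in> borel_measurable lebesgue" using g(1) by (simp add: represents_def)
      obtain g0 where g0: "g0 \<in> borel_measurable borel" "AE x in lebesgue. g x = g0 x"
        using lebesgue_measurable_borel_version[OF gm] by blast
      note [measurable] = g0(1)
      have "rearrangement g = rearrangement g0"
        by (rule rearrangement_cong_AE[OF gm _ g0(2)]) (intro measurable_completion, simp)
      then have lz0: "lz_qnorm (ennreal q) c B g0 < ennreal N" using g(2) by (simp add: lz_qnorm_def)
      define M where "M t = Ca * N * (t powr (- 1 / q) / broken_log B t)" for t
      have M: "0 < M t" if "0 < t" for t using that Ca N broken_log_pos[of B t] by (simp add: M_def)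
      have avg: "(\<integral>\<^sup>+s. rearrangement g0 s * indicator {0<..t} s \<partial>lborel) \<le> ennreal (M t * t)" if "0 < t" for t
        using Ca(2)[OF N(1) lz0 that] by (simp only: M_def)
      define G where "G x = (\<integral>\<^sup>+y. ennreal (norm (Kk (x - y))) * ennreal (norm (g0 y)) \<partial>lborel)" for x
      have Km: "(\<lambda>x. ennreal (norm (Kk x))) \<in> borel_measurable borel" by measurable
      have G1: "G x \<le> ennreal (3 * c1 * M r)" for x
        unfolding G_def by (rule convolution_bounds(1)[OF g0(1) Km r M[OF r] avg[OF r] c1 KkI Kkb])
      have G2: "emeasure lborel {x. ennreal (3 * c1 * M t) < G x} \<le> ennreal t" if t: "0 < t" for t
        unfolding G_def by (rule convolution_bounds(2)[OF g0(1) Km t M[OF t] avg[OF t] c1 KkI])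
      define g' where "g' x = (\<integral>y. Kk (x - y) * g0 y \<partial>lborel)" for x
      have inv: "?T (correlation Kk \<psi>) = ?T \<psi>" if "schwartz \<psi>" for \<psi>
        by (rule lp_block_correlation[OF Kk that KkF])
      note rc = represents_convolution[OF Kk g0(1) g(1) g0(2) G1[unfolded G_def] inv]
      have rep: "represents g' ?T" unfolding g'_def[abs_def] by (rule rc(1))
      have g'm[measurable]: "g' \<in> borel_measurable borel" unfolding g'_def[abs_def] by (rule rc(2))
      have le: "ennreal (norm (g' x)) \<le> G x" for x unfolding g'_def G_def by (rule rc(3))
      have Gm[measurable]: "G \<in> borel_measurable borel" unfolding G_def by measurable
      \<comment> \<open>The bound from the height of the kernel is used only at the scale r; the
        weak-type bound \<open>b2\<close>, which uses only its mass, is available at every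
        t.\<close>
      have b1: "rearrangement g' t \<le> ennreal (3 * c1 * M r)" for t
      proof (rule rearrangement_le)
        have "{x. ennreal (3 * c1 * M r) < ennreal (norm (g' x))} = {}"
          using order_trans[OF le G1] by (auto simp: not_less)
        then show "emeasure lebesgue {x. ennreal (3 * c1 * M r) < ennreal (norm (g' x))} \<le> ennreal t" by simp
      qed
      have b2: "rearrangement g' t \<le> ennreal (3 * c1 * M t)" if t: "0 < t" for t
      proof (rule rearrangement_le)
        have "emeasure lebesgue {x. ennreal (3 * c1 * M t) < ennreal (norm (g' x))}
            = emeasure lborel {x. ennreal (3 * c1 * M t) < ennreal (norm (g' x))}"
          by (rule emeasure_lebesgue_borel) measurable
        also have "\<dots> \<le> emeasure lborel {x. ennreal (3 * c1 * M t) < G x}"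
          using le by (intro emeasure_mono) (auto intro: less_le_trans)
        also have "\<dots> \<le> ennreal t" by (rule G2[OF t])
        finally show "emeasure lebesgue {x. ennreal (3 * c1 * M t) < ennreal (norm (g' x))} \<le> ennreal t" .
      qed
      have MM: "3 * c1 * M t = 3 * c1 * Ca * N * (t powr (- 1 / q) / broken_log B t)" for t by (simp add: M_def)
      have "dist_lz_qnorm \<infinity> b A ?T \<le> lz_qnorm \<infinity> b A g'"
        unfolding dist_lz_qnorm_def using rep by (intro INF_lower) simp
      also have "\<dots> \<le> ennreal (Ci * (3 * c1 * Ca * N) * (r powr (- 1 / q) * broken_log D r))"
        unfolding D_def using b1[unfolded MM] b2[unfolded MM] c1 Ca N by (intro Ci(2) r) auto
      also have "\<dots> \<le> ennreal (Ci * (3 * c1 * Ca * N) * (r powr (- 1 / q) * (Cs * broken_log (prod.swap D) (2 powi k))))"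
        using Ci(1) c1 Ca(1) N(1) broken_log_dyadic_swap[OF n, of D k]
        by (intro ennreal_leI mult_left_mono) (auto simp: Cs_def r_def s_def)
      also have "Ci * (3 * c1 * Ca * N) * (r powr (- 1 / q) * (Cs * broken_log (prod.swap D) (2 powi k))) = C * f * N"
        unfolding C_def f_def rq by (simp only: mult_ac)
      finally show ?thesis .
    qed
    have "dist_lz_qnorm \<infinity> b A ?T \<le> ennreal (C * f) * dist_lz_qnorm (ennreal q) c B ?T"
    proof (cases "dist_lz_qnorm (ennreal q) c B ?T")
      case (real y)
      show ?thesis
      proof (rule ennreal_le_epsilon)
        fix e :: real assume e: "0 < e"
        \<comment> \<open>N is taken above y by just enough to produce an excess of exactly
          e.\<close>
        have "dist_lz_qnorm \<infinity> b A ?T \<le> ennreal (C * f * (y + e / (C * f)))"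
          using real e C f by (intro key) (auto simp: add_nonneg_pos ennreal_less_iff)
        also have "C * f * (y + e / (C * f)) = C * f * y + e" using C f by (simp add: field_simps)
        also have "ennreal (C * f * y + e) = ennreal (C * f) * ennreal y + ennreal e"
          using real C f e by (simp add: ennreal_mult)
        finally show "dist_lz_qnorm \<infinity> b A ?T \<le> ennreal (C * f) * dist_lz_qnorm (ennreal q) c B ?T + ennreal e"
          by (simp add: real)
      qed
    next
      case top
      then show ?thesis using C f by (simp add: ennreal_mult_top)
    qed
    then show "dist_lz_qnorm \<infinity> b A ?T \<le> ennreal (C * (2 powr (real DIM('a) / q * real_of_int k)
            * broken_log (pair_shift (prod.swap A - prod.swap B) (recip b)) (2 powi k)))
          * dist_lz_qnorm (ennreal q) c B ?T"
      by (simp only: f_def swapD n_def)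
  qed
qed

section \<open>Summation over the dyadic blocks\<close>

lemma infsum_ennreal_le_cmult:
  fixes f g :: "'i \<Rightarrow> ennreal"
  assumes "\<And>i. f i \<le> a * g i"
  shows "infsum f I \<le> a * infsum g I"
proof -
  have "sum f F \<le> a * infsum g I" if "finite F" "F \<subseteq> I" for F
  proof -
    have "sum f F \<le> a * sum g F" using assms by (simp add: sum_distrib_left sum_mono)
    also have "sum g F \<le> infsum g I"
      using that by (subst nonneg_infsum_complete) (auto intro: SUP_upper)
    finally show ?thesis by (simp add: mult_left_mono)
  qed
  then show ?thesis
    by (intro infsum_le_finite_sums nonneg_summable_on_complete) auto
qed

theorem corollary21:
  fixes \<phi> :: "real ^ 'n \<Rightarrow> real"
    and q \<sigma> :: real and c u b :: ennreal and A B \<Gamma> :: "real \<times> real"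
  assumes "dyadic_generator \<phi>"
    and "1 \<le> q" and "0 < c"
    and "(q = 1 \<and> c = 1 \<and> B = (0, 0)) \<or> 1 < q"
    and "0 < u" and "0 < b"
    and "fst A < - recip b" and "- recip b < snd A"
  shows "continuously_embedded
    (besov_qnorm \<phi> (\<sigma> + real CARD('n) / q)
       (\<Gamma> + pair_shift (prod.swap A - prod.swap B) (recip b)) (ennreal q) c B u)
    (besov_qnorm \<phi> \<sigma> \<Gamma> \<infinity> b A u)"
proof -
  define \<Delta> where "\<Delta> = pair_shift (prod.swap A - prod.swap B) (recip b)"
  obtain C where C: "0 < C"
    "\<And>k T. dist_lz_qnorm \<infinity> b A (lp_block \<phi> k T)
       \<le> ennreal (C * (2 powr (real CARD('n) / q * real_of_int k) * broken_log \<Delta> (2 powi k)))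
          * dist_lz_qnorm (ennreal q) c B (lp_block \<phi> k T)"
    using lp_block_lz_qnorm_le[OF assms(1,3,4,6,7,8)] unfolding \<Delta>_def by auto
  define X where "X T k = ennreal (2 powr ((\<sigma> + real CARD('n) / q) * real_of_int k) * broken_log (\<Gamma> + \<Delta>) (2 powi k))
      * dist_lz_qnorm (ennreal q) c B (lp_block \<phi> k T)" for T k
  define Y where "Y T k = ennreal (2 powr (\<sigma> * real_of_int k) * broken_log \<Gamma> (2 powi k))
      * dist_lz_qnorm \<infinity> b A (lp_block \<phi> k T)" for T k
  \<comment> \<open>The powers of 2 and the broken logarithms multiply exactly to the weight of the
    source space, so the block estimate becomes a termwise comparison with the same C for all k and
    T.\<close>
  have YX: "Y T k \<le> ennreal C * X T k" for T k
  proof -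
    let ?a = "2 powr (\<sigma> * real_of_int k) * broken_log \<Gamma> (2 powi k)"
    let ?d = "2 powr (real CARD('n) / q * real_of_int k) * broken_log \<Delta> (2 powi k)"
    have a: "0 \<le> ?a" "0 \<le> ?d" by (intro mult_nonneg_nonneg less_imp_le[OF broken_log_pos] powr_ge_zero)+
    have "Y T k \<le> ennreal ?a * (ennreal (C * ?d) * dist_lz_qnorm (ennreal q) c B (lp_block \<phi> k T))"
      unfolding Y_def by (intro mult_left_mono C) simp
    also have "\<dots> = ennreal (?a * (C * ?d)) * dist_lz_qnorm (ennreal q) c B (lp_block \<phi> k T)"
    proof -
      have "0 \<le> C * ?d" using C(1) by (intro mult_nonneg_nonneg[OF _ a(2)]) simp
      then have "ennreal (?a * (C * ?d)) = ennreal ?a * ennreal (C * ?d)" by (intro ennreal_mult a)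
      then show ?thesis by (simp only: mult.assoc)
    qed
    also have "?a * (C * ?d) = C * (2 powr ((\<sigma> + real CARD('n) / q) * real_of_int k) * broken_log (\<Gamma> + \<Delta>) (2 powi k))"
      unfolding broken_log_add distrib_right powr_add by (simp only: mult_ac)
    also have "ennreal \<dots> * dist_lz_qnorm (ennreal q) c B (lp_block \<phi> k T) = ennreal C * X T k"
      unfolding X_def using C(1)
      by (subst ennreal_mult) (auto simp: mult.assoc intro!: mult_nonneg_nonneg less_imp_le[OF broken_log_pos])
    finally show ?thesis .
  qed
  let ?NX = "besov_qnorm \<phi> (\<sigma> + real CARD('n) / q) (\<Gamma> + \<Delta>) (ennreal q) c B u"
  let ?NY = "besov_qnorm \<phi> \<sigma> \<Gamma> \<infinity> b A u"
  have main: "?NY T \<le> ennreal C * ?NX T" for T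
    using assms(5)
  proof (cases rule: exponent_cases)
    case 1
    have "(SUP k. Y T k) \<le> ennreal C * (SUP k. X T k)"
      by (intro SUP_least order_trans[OF YX] mult_left_mono SUP_upper) auto
    then show ?thesis using 1 by (simp add: besov_qnorm_def X_def Y_def)
  next
    case (2 p)
    have "ennpowr (Y T k) p \<le> ennpowr (ennreal C) p * ennpowr (X T k) p" for k
      using ennpowr_mono[OF 2(2) YX[of T k]] by (simp add: ennpowr_mult[OF 2(2)])
    then have "(\<Sum>\<^sub>\<infinity>k. ennpowr (Y T k) p) \<le> ennpowr (ennreal C) p * (\<Sum>\<^sub>\<infinity>k. ennpowr (X T k) p)"
      by (rule infsum_ennreal_le_cmult)
    then have "ennpowr (\<Sum>\<^sub>\<infinity>k. ennpowr (Y T k) p) (1 / p) \<le> ennpowr (ennpowr (ennreal C) p * (\<Sum>\<^sub>\<infinity>k. ennpowr (X T k) p)) (1 / p)"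
      using 2(2) by (intro ennpowr_mono) auto
    also have "\<dots> = ennreal C * ennpowr (\<Sum>\<^sub>\<infinity>k. ennpowr (X T k) p) (1 / p)"
      using 2(2) by (simp add: ennpowr_mult ennpowr_inverse)
    finally show ?thesis using 2 by (simp add: besov_qnorm_def X_def Y_def)
  qed
  \<comment> \<open>Temperedness is common to both sides; only finiteness of the target quasi-norm
    has to be derived from \<open>main\<close>.\<close>
  have "tempered_space ?NX \<subseteq> tempered_space ?NY"
  proof
    fix T assume T: "T \<in> tempered_space ?NX"
    then have "ennreal C * ?NX T < \<infinity>" by (simp add: tempered_space_def ennreal_mult_less_top)
    then show "T \<in> tempered_space ?NY"
      using T le_less_trans[OF main[of T]] by (simp add: tempered_space_def)
  qed
  then show ?thesis unfolding continuously_embedded_def \<Delta>_def[symmetric] using main by blast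
qed

end
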